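(* Let $\{H_\omega\}_{\omega\in\Omega}$ be a $\mathbb Z^d$-ergodic family of selfadjoint operators acting on $\mathcal H = L_2(\mathbb R^d)$ (continuous model) or on $\mathcal H = \ell_2(\mathbb Z^d)$ (discrete model), where the corresponding unitary operators are the translations $(U_i\varphi)(x)=\varphi(x-i)$, $i\in\mathbb Z^d$, $\varphi\in\mathcal H$. Let $\nu$ be the density of states measure of the family, and assume that $\nu$ is absolutely continuous with respect to a Borel measure $\gamma$ on $\mathbb R$. Then for every closed interval $I\subset\mathbb R$ (possibly unbounded, with interior $I^\circ$) and every almost sure spectrum $\sigma_\star$ for $\{H_\omega\}_{\omega\in\Omega}$, $\gamma(I\cap\sigma_\star)=0$ implies $I^\circ\cap\sigma_\star=\emptyset$.
   Context: $(\Omega,\mathcal M,\mathbb P)$ is a complete probability space, and $\mathbb E$ denotes expectation with respect to $\mathbb P$. Measurability: a family of bounded operators $\{B_\omega\}_{\omega\in\Omega}$ on $\mathcal H$ is weakly measurable if $\omega\mapsto\langle x,B_\omega y\rangle$ is measurable for all $x,y\in\mathcal H$. A family of (possibly unbounded) selfadjoint operators $\{H_\omega\}_{\omega\in\Omega}$ is measurable if $\omega\mapsto (H_\omega-z)^{-1}$ is weakly measurable for all $z\in\mathbb C\setminus\mathbb R$. Ergodicity: a family of measurable transformations $T_i:\Omega\to\Omega$, $i\in\mathbb Z^d$, is measure preserving if $\mathbb P(T_i^{-1}A)=\mathbb P(A)$ for every $A\in\mathcal M$ and every $i$, and ergodic if $T_i^{-1}A=A$ for all $i\in\mathbb Z^d$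 implies $\mathbb P(A)\in\{0,1\}$. A measurable family of selfadjoint operators $\{H_\omega\}_{\omega\in\Omega}$ on a separable Hilbert space $\mathcal H$ is $\mathbb Z^d$-ergodic if there are a measure preserving and ergodic family $\{T_i\}_{i\in\mathbb Z^d}$ and a family $\{U_i\}_{i\in\mathbb Z^d}$ of unitary operators on $\mathcal H$ such that $H_{T_i\omega}=U_iH_\omega U_i^*$ (for all $i$ and $\omega$). Density of states measure: $E_{H_\omega}(A)=\chi_A(H_\omega)$ denotes the spectral projection of $H_\omega$ for a Borel set $A\subset\mathbb R$. In the discrete model, $\nu(A):=\mathbb E(\langle\delta_0,E_{H_\omega}(A)\delta_0\rangle)$, where $\delta_0(0)=1$ and $\delta_0(n)=0$ for $n\neq 0$. In the continuous model, $\nu(A):=\mathbb E(\operatorname{tr}\,\chi_\Lambda E_{H_\omega}(A)\chi_\Lambda)$, where $\Lambda=[-1/2,1/2]^d$, $\chi_\Lambda$ is the operator of multiplication by the characteristic function of $\Lambda$, and the trace of a bounded positive operator $B$ is $\operatorname{tr}B=\sum_n\langle\varphi_n,B\varphi_n\rangle\in[0,\infty]$ for an orthonormal basis $\{\varphi_n\}$. Absolute continuity of $\nu$ with respect to $\gamma$ means $\gamma(A)=0\Rightarrow\nu(A)=0$ for Borel $A$. Reducing subspaces and restrictions: a closed subspace $M\subset\mathcal H$ with orthogonal projection $P_M$ reduces an operator $H$ with domain $D(H)$ if $u\in D(H)$ implies $P_Mu\in D(H)$ and $HP_Mu\in M$. The restriction $H|_M$ is the operator in $M$ with domain $M\cap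 D(H)$ and $H|_Mf=Hf$. The spectrum of the operator on the zero space is empty. Almost sure spectrum: a set $\Sigma\subset\mathbb R$ (independent of $\omega$) is an almost sure spectrum for $\{H_\omega\}_{\omega\in\Omega}$ if there are closed subspaces $M_\omega\subseteq\mathcal H$, with $M_\omega$ reducing $H_\omega$, and a set $\Omega_\Sigma\in\mathcal M$ with $\mathbb P(\Omega_\Sigma)=1$ such that $\Sigma=\sigma(H_\omega|_{M_\omega})$ for all $\omega\in\Omega_\Sigma$. No measurability of $\omega\mapsto M_\omega$ is required. Examples of almost sure spectra of an ergodic family are the $\mathbb P$-almost surely constant sets $\sigma(H_\omega)$, $\sigma_{ac}(H_\omega)$, $\sigma_{sc}(H_\omega)$, $\sigma_{pp}(H_\omega)$ (the spectrum and the absolutely continuous, singular continuous and pure point spectra, the last being the closure of the set of eigenvalues). *)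

theory Defs
  imports "HOL-Probability.Probability"
begin

section \<open>Complex inner product spaces\<close>

class complex_inner = real_inner +
  fixes scaleC :: "complex \<Rightarrow> 'a \<Rightarrow> 'a"  (infixr \<open>*\<^sub>C\<close> 75)
    and cinner :: "'a \<Rightarrow> 'a \<Rightarrow> complex"
  assumes scaleC_add_right: "c *\<^sub>C (x + y) = c *\<^sub>C x + c *\<^sub>C y"
    and scaleC_add_left: "(c + d) *\<^sub>C x = c *\<^sub>C x + d *\<^sub>C x"
    and scaleC_scaleC: "c *\<^sub>C d *\<^sub>C x = (c * d) *\<^sub>C x"
    and scaleR_scaleC: "r *\<^sub>R x = complex_of_real r *\<^sub>C x"
    and cinner_commute: "cinner x y = cnj (cinner y x)"
    and cinner_add_right: "cinner x (y + z) = cinner x y + cinner x z"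
    and cinner_scaleC_right: "cinner x (c *\<^sub>C y) = c * cinner x y"
    and inner_eq_Re_cinner: "inner x y = Re (cinner x y)"

definition csubspace :: "'v::complex_inner set \<Rightarrow> bool" where
  "csubspace S \<longleftrightarrow> 0 \<in> S \<and> (\<forall>x\<in>S. \<forall>y\<in>S. x + y \<in> S) \<and> (\<forall>c. \<forall>x\<in>S. c *\<^sub>C x \<in> S)"

definition clinear :: "('v::complex_inner \<Rightarrow> 'v) \<Rightarrow> bool" where
  "clinear B \<longleftrightarrow> (\<forall>x y. B (x + y) = B x + B y) \<and> (\<forall>c x. B (c *\<^sub>C x) = c *\<^sub>C B x)"

definition unitary :: "('v::complex_inner \<Rightarrow> 'v) \<Rightarrow> bool" where
  "unitary U \<longleftrightarrow> clinear U \<and> bij U \<and> (\<forall>x y. cinner (U x) (U y) = cinner x y)"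

definition cadjoint :: "('v::complex_inner \<Rightarrow> 'v) \<Rightarrow> 'v \<Rightarrow> 'v" where
  "cadjoint B = (THE C. \<forall>x y. cinner (C x) y = cinner x (B y))"

definition projection_operator :: "('v::complex_inner \<Rightarrow> 'v) \<Rightarrow> bool" where
  "projection_operator Q \<longleftrightarrow>
     clinear Q \<and> Q \<circ> Q = Q \<and> (\<forall>x y. cinner (Q x) y = cinner x (Q y))"

definition orth_proj :: "'v::complex_inner set \<Rightarrow> 'v \<Rightarrow> 'v" where
  "orth_proj M u = (THE v. v \<in> M \<and> (\<forall>w\<in>M. cinner w (u - v) = 0))"

definition orthonormal_basis :: "(nat \<Rightarrow> 'v::complex_inner) \<Rightarrow> bool" where
  "orthonormal_basis \<phi> \<longleftrightarrow>
     (\<forall>m n. cinner (\<phi> m) (\<phi> n) = (if m = n then 1 else 0)) \<and>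
     closure (csubspace hull range \<phi>) = UNIV"

text \<open>The trace of a bounded positive operator, computed in the orthonormal basis \<open>\<phi>\<close>; its value
  does not depend on the basis.\<close>

definition trace_in :: "(nat \<Rightarrow> 'v::complex_inner) \<Rightarrow> ('v \<Rightarrow> 'v) \<Rightarrow> ennreal" where
  "trace_in \<phi> B = (\<Sum>n. ennreal (Re (cinner (\<phi> n) (B (\<phi> n)))))"

section \<open>Unbounded operators\<close>

text \<open>A possibly unbounded operator is a partial function with domain \<^term>\<open>dom H\<close>.
  Equality of operators thus includes equality of domains.\<close>

type_synonym 'v operator = "'v \<rightharpoonup> 'v"

definition linear_operator :: "'v::complex_inner operator \<Rightarrow> bool" where
  "linear_operator H \<longleftrightarrow> csubspace (dom H) \<and>
     (\<forall>u\<in>dom H. \<forall>v\<in>dom H. the (H (u + v)) = the (H u) + the (H v)) \<and>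
     (\<forall>c. \<forall>u\<in>dom H. the (H (c *\<^sub>C u)) = c *\<^sub>C the (H u))"

definition op_adjoint :: "'v::complex_inner operator \<Rightarrow> 'v operator" where
  "op_adjoint H x =
     (if \<exists>y. \<forall>u\<in>dom H. cinner y u = cinner x (the (H u))
      then Some (THE y. \<forall>u\<in>dom H. cinner y u = cinner x (the (H u)))
      else None)"

definition selfadjoint :: "'v::complex_inner operator \<Rightarrow> bool" where
  "selfadjoint H \<longleftrightarrow> linear_operator H \<and> closure (dom H) = UNIV \<and> op_adjoint H = H"

definition resolvent :: "'v::complex_inner operator \<Rightarrow> complex \<Rightarrow> 'v \<Rightarrow> 'v" where
  "resolvent H z = inv_into (dom H) (\<lambda>u. the (H u) - z *\<^sub>C u)"

text \<open>The spectrum of an operator \<open>H\<close> in the Hilbert space \<open>M\<close>, a closed subspace containing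
  \<^term>\<open>dom H\<close>.\<close>

definition spectrum_in :: "'v::complex_inner set \<Rightarrow> 'v operator \<Rightarrow> complex set" where
  "spectrum_in M H = - {z. bij_betw (\<lambda>u. the (H u) - z *\<^sub>C u) (dom H) M \<and>
                           (\<exists>C. \<forall>y\<in>M. norm (resolvent H z y) \<le> C * norm y)}"

definition reduces :: "'v::complex_inner set \<Rightarrow> 'v operator \<Rightarrow> bool" where
  "reduces M H \<longleftrightarrow>
     (\<forall>u\<in>dom H. orth_proj M u \<in> dom H \<and> the (H (orth_proj M u)) \<in> M)"

text \<open>Scalar spectral measures \<open>A \<mapsto> \<langle>x, E(A) x\<rangle>\<close>; these inner products are real and nonnegative
  because \<open>E(A)\<close> is an orthogonal projection.\<close>

definition scalar_measure :: "(real set \<Rightarrow> 'v::complex_inner \<Rightarrow> 'v) \<Rightarrow> 'v \<Rightarrow> real measure" where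
  "scalar_measure E x = measure_of UNIV (sets borel) (\<lambda>A. ennreal (Re (cinner x (E A x))))"

definition projection_valued_measure :: "(real set \<Rightarrow> 'v::complex_inner \<Rightarrow> 'v) \<Rightarrow> bool" where
  "projection_valued_measure E \<longleftrightarrow>
     (\<forall>A\<in>sets borel. projection_operator (E A)) \<and> E UNIV = id \<and>
     (\<forall>A :: nat \<Rightarrow> real set. range A \<subseteq> sets borel \<longrightarrow> disjoint_family A \<longrightarrow>
        (\<forall>x. (\<lambda>n. E (A n) x) sums E (\<Union>n. A n) x))"

text \<open>\<open>E\<close> is the spectral measure of \<open>H\<close>, that is, \<open>H = \<integral> t dE(t)\<close>, so that \<open>E(A)\<close> is the
  spectral projection \<open>\<chi>\<^sub>A(H)\<close>. By the spectral theorem every selfadjoint operator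
  has exactly one spectral measure on the Borel sets.\<close>

definition spectral_measure_of ::
    "'v::complex_inner operator \<Rightarrow> (real set \<Rightarrow> 'v \<Rightarrow> 'v) \<Rightarrow> bool" where
  "spectral_measure_of H E \<longleftrightarrow> projection_valued_measure E \<and>
     dom H = {x. (\<integral>\<^sup>+t. ennreal (t\<^sup>2) \<partial>scalar_measure E x) < \<infinity>} \<and>
     (\<forall>x\<in>dom H. cinner x (the (H x)) = complex_of_real (\<integral>t. t \<partial>scalar_measure E x))"

section \<open>Random operators\<close>

definition measurable_family :: "'w measure \<Rightarrow> ('w \<Rightarrow> 'v::complex_inner operator) \<Rightarrow> bool" where
  "measurable_family P H \<longleftrightarrow> (\<forall>\<omega>\<in>space P. selfadjoint (H \<omega>)) \<and>
     (\<forall>z. z \<notin> \<real> \<longrightarrow> (\<forall>x y. (\<lambda>\<omega>. cinner x (resolvent (H \<omega>) z y)) \<in> borel_measurable P))"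

definition measure_preserving_family :: "'w measure \<Rightarrow> ('i \<Rightarrow> 'w \<Rightarrow> 'w) \<Rightarrow> bool" where
  "measure_preserving_family P T \<longleftrightarrow>
     (\<forall>i. T i \<in> measurable P P \<and>
          (\<forall>A\<in>sets P. measure P (T i -` A \<inter> space P) = measure P A))"

definition ergodic_transformations :: "'w measure \<Rightarrow> ('i \<Rightarrow> 'w \<Rightarrow> 'w) \<Rightarrow> bool" where
  "ergodic_transformations P T \<longleftrightarrow>
     (\<forall>A\<in>sets P. (\<forall>i. T i -` A \<inter> space P = A) \<longrightarrow> measure P A = 0 \<or> measure P A = 1)"

text \<open>Ergodicity with prescribed unitary operators \<open>U i\<close>; the index type is the group
  \<open>\<int>\<^sup>d\<close> in the form \<^typ>\<open>'d \<Rightarrow> int\<close>, where \<open>d\<close> is the cardinality of the finite type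
  \<^typ>\<open>'d\<close>.\<close>

definition ergodic_family ::
    "'w measure \<Rightarrow> (('d::finite \<Rightarrow> int) \<Rightarrow> 'v \<Rightarrow> 'v) \<Rightarrow> ('w \<Rightarrow> 'v::complex_inner operator) \<Rightarrow> bool" where
  "ergodic_family P U H \<longleftrightarrow> measurable_family P H \<and> (\<forall>i. unitary (U i)) \<and>
     (\<exists>T. measure_preserving_family P T \<and> ergodic_transformations P T \<and>
        (\<forall>i. \<forall>\<omega>\<in>space P. H (T i \<omega>) = map_option (U i) \<circ> H \<omega> \<circ> cadjoint (U i)))"

definition almost_sure_spectrum ::
    "'w measure \<Rightarrow> ('w \<Rightarrow> 'v::complex_inner operator) \<Rightarrow> real set \<Rightarrow> bool" where
  "almost_sure_spectrum P H \<Sigma> \<longleftrightarrow>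
     (\<exists>M \<Omega>. (\<forall>\<omega>\<in>space P. csubspace (M \<omega>) \<and> closed (M \<omega>) \<and> reduces (M \<omega>) (H \<omega>)) \<and>
        \<Omega> \<in> sets P \<and> measure P \<Omega> = 1 \<and>
        (\<forall>\<omega>\<in>\<Omega>. complex_of_real ` \<Sigma> = spectrum_in (M \<omega>) (H \<omega> |` M \<omega>)))"

section \<open>Square integrable functions\<close>

text \<open>Both Hilbert spaces of interest are spaces \<open>L\<^sub>2\<close> over a type that carries a fixed measure:
  Lebesgue measure on \<open>\<real>\<^sup>d\<close> = \<^typ>\<open>real ^ 'd\<close> and counting measure on
  \<open>\<int>\<^sup>d\<close> = \<^typ>\<open>'d \<Rightarrow> int\<close>.\<close>

class base_measure =
  fixes base_measure :: "'a measure"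

instantiation vec :: (euclidean_space, finite) base_measure
begin
definition base_measure_vec :: "('a ^ 'b) measure" where "base_measure_vec = lborel"
instance ..
end

instantiation "fun" :: (finite, countable) base_measure
begin
definition base_measure_fun :: "('a \<Rightarrow> 'b) measure" where "base_measure_fun = count_space UNIV"
instance ..
end

definition square_integrable :: "('a::base_measure \<Rightarrow> complex) \<Rightarrow> bool" where
  "square_integrable f \<longleftrightarrow> f \<in> borel_measurable base_measure \<and>
     integrable base_measure (\<lambda>x. (cmod (f x))\<^sup>2)"

definition L2_rel :: "('a::base_measure \<Rightarrow> complex) \<Rightarrow> ('a \<Rightarrow> complex) \<Rightarrow> bool" where
  "L2_rel f g \<longleftrightarrow> square_integrable f \<and> square_integrable g \<and> (AE x in base_measure. f x = g x)"

lemma square_integrable_zero: "square_integrable (\<lambda>_. 0)"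
  by (simp add: square_integrable_def)

lemma part_equivp_L2_rel: "part_equivp L2_rel"
proof (rule part_equivpI)
  show "\<exists>x::'a \<Rightarrow> complex. L2_rel x x"
    by (rule exI[of _ "\<lambda>_. 0"]) (simp add: L2_rel_def square_integrable_zero)
  show "symp (L2_rel :: ('a \<Rightarrow> complex) \<Rightarrow> _)"
    by (rule sympI) (auto simp: L2_rel_def eq_commute)
  show "transp (L2_rel :: ('a \<Rightarrow> complex) \<Rightarrow> _)"
  proof (rule transpI)
    fix f g h :: "'a \<Rightarrow> complex"
    assume *: "L2_rel f g" "L2_rel g h"
    then have "AE x in base_measure. f x = g x" "AE x in base_measure. g x = h x"
      by (simp_all add: L2_rel_def)
    then have "AE x in base_measure. f x = h x"
      by eventually_elim simp
    with * show "L2_rel f h"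
      by (simp add: L2_rel_def)
  qed
qed

quotient_type (overloaded) 'a L2 = "'a::base_measure \<Rightarrow> complex" / partial: L2_rel
  by (rule part_equivp_L2_rel)

lemma square_integrable_measurable:
  "square_integrable f \<Longrightarrow> f \<in> borel_measurable base_measure"
  by (simp add: square_integrable_def)

lemma borel_measurable_cnj_mult:
  assumes [measurable]: "f \<in> borel_measurable M" "g \<in> borel_measurable M"
  shows "(\<lambda>x. cnj (f x) * g x) \<in> borel_measurable M"
proof -
  have [measurable]: "cnj \<in> borel_measurable borel"
    by (intro borel_measurable_continuous_onI continuous_intros)
  show ?thesis by measurable
qed

lemma square_integrable_mult:
  assumes "square_integrable f" "square_integrable g"
  shows "integrable base_measure (\<lambda>x. cnj (f x) * g x)"
proof (rule Bochner_Integration.integrable_bound)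
  show "integrable base_measure (\<lambda>x. (cmod (f x))\<^sup>2 + (cmod (g x))\<^sup>2)"
    using assms by (simp add: square_integrable_def)
  show "(\<lambda>x. cnj (f x) * g x) \<in> borel_measurable base_measure"
    by (intro borel_measurable_cnj_mult square_integrable_measurable assms)
  have "cmod (cnj a * b) \<le> norm ((cmod a)\<^sup>2 + (cmod b)\<^sup>2)" for a b
    using sum_squares_bound[of "cmod a" "cmod b"] mult_nonneg_nonneg[of "cmod a" "cmod b"]
    by (simp add: norm_mult del: mult_nonneg_nonneg)
  then show "AE x in base_measure. cmod (cnj (f x) * g x) \<le> norm ((cmod (f x))\<^sup>2 + (cmod (g x))\<^sup>2)"
    by simp
qed

lemma square_integrable_add:
  assumes "square_integrable f" "square_integrable g"
  shows "square_integrable (\<lambda>x. f x + g x)"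
  unfolding square_integrable_def
proof
  show "(\<lambda>x. f x + g x) \<in> borel_measurable base_measure"
    by (intro borel_measurable_add square_integrable_measurable assms)
  have *: "(cmod (a + b))\<^sup>2 = (cmod a)\<^sup>2 + (cmod b)\<^sup>2 + 2 * Re (cnj a * b)" for a b
    by (simp only: cmod_power2) (simp add: power2_eq_square algebra_simps)
  show "integrable base_measure (\<lambda>x. (cmod (f x + g x))\<^sup>2)"
    unfolding * using assms square_integrable_mult[OF assms]
    by (intro Bochner_Integration.integrable_add integrable_mult_right integrable_Re)
       (auto simp: square_integrable_def)
qed

lemma square_integrable_scale:
  assumes "square_integrable f"
  shows "square_integrable (\<lambda>x. c * f x)"
  using assms
  by (auto simp: square_integrable_def norm_mult power_mult_distrib intro!: borel_measurable_times)

lemma square_integrable_bounded_mult: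
  assumes "square_integrable f" "g \<in> borel_measurable base_measure" "\<And>x. cmod (g x) \<le> 1"
  shows "square_integrable (\<lambda>x. g x * f x)"
  unfolding square_integrable_def
proof
  show m: "(\<lambda>x. g x * f x) \<in> borel_measurable base_measure"
    by (intro borel_measurable_times square_integrable_measurable assms)
  have "cmod (g x * f x) \<le> cmod (f x)" for x
    using mult_right_mono[OF assms(3)[of x], of "cmod (f x)"] by (simp add: norm_mult)
  then have le: "norm ((cmod (g x * f x))\<^sup>2) \<le> norm ((cmod (f x))\<^sup>2)" for x
    using power_mono[of "cmod (g x * f x)" "cmod (f x)" 2] by simp
  show "integrable base_measure (\<lambda>x. (cmod (g x * f x))\<^sup>2)"
  proof (rule Bochner_Integration.integrable_bound)
    show "integrable base_measure (\<lambda>x. (cmod (f x))\<^sup>2)"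
      using assms by (simp add: square_integrable_def)
    show "(\<lambda>x. (cmod (g x * f x))\<^sup>2) \<in> borel_measurable base_measure"
      using m by measurable
    show "AE x in base_measure. norm ((cmod (g x * f x))\<^sup>2) \<le> norm ((cmod (f x))\<^sup>2)"
      by (rule AE_I2) (rule le)
  qed
qed

instantiation L2 :: (base_measure) real_vector
begin

lift_definition zero_L2 :: "'a L2" is "\<lambda>_. 0"
  by (simp add: L2_rel_def square_integrable_zero)

lift_definition plus_L2 :: "'a L2 \<Rightarrow> 'a L2 \<Rightarrow> 'a L2" is "\<lambda>f g x. f x + g x"
proof -
  fix f g f' g' :: "'a \<Rightarrow> complex"
  assume *: "L2_rel f f'" "L2_rel g g'"
  then have "AE x in base_measure. f x = f' x" "AE x in base_measure. g x = g' x"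
    by (simp_all add: L2_rel_def)
  then have "AE x in base_measure. f x + g x = f' x + g' x"
    by eventually_elim simp
  with * show "L2_rel (\<lambda>x. f x + g x) (\<lambda>x. f' x + g' x)"
    by (simp add: L2_rel_def square_integrable_add)
qed

lift_definition uminus_L2 :: "'a L2 \<Rightarrow> 'a L2" is "\<lambda>f x. - f x"
  using square_integrable_scale[of _ "-1"] by (auto simp: L2_rel_def)

definition minus_L2 :: "'a L2 \<Rightarrow> 'a L2 \<Rightarrow> 'a L2" where "minus_L2 f g = f + - g"

lift_definition scaleR_L2 :: "real \<Rightarrow> 'a L2 \<Rightarrow> 'a L2" is "\<lambda>r f x. complex_of_real r * f x"
  by (auto simp: L2_rel_def square_integrable_scale)

instance
proof
  fix f g h :: "'a L2" and r s :: real
  show "f + g + h = f + (g + h)"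
    by transfer (auto simp: L2_rel_def add.assoc intro!: square_integrable_add)
  show "f + g = g + f"
    by transfer (auto simp: L2_rel_def add.commute intro!: square_integrable_add)
  show "0 + f = f"
    by transfer (auto simp: L2_rel_def)
  show "- f + f = 0"
    by transfer (auto simp: L2_rel_def square_integrable_zero)
  show "f - g = f + - g"
    by (fact minus_L2_def)
  show "r *\<^sub>R (f + g) = r *\<^sub>R f + r *\<^sub>R g"
    by transfer (auto simp: L2_rel_def distrib_left intro!: square_integrable_add square_integrable_scale)
  show "(r + s) *\<^sub>R f = r *\<^sub>R f + s *\<^sub>R f"
    by transfer
      (auto simp: L2_rel_def distrib_right intro!: square_integrable_add square_integrable_scale)
  show "r *\<^sub>R s *\<^sub>R f = (r * s) *\<^sub>R f"
    by transfer (auto simp: L2_rel_def mult.assoc intro!: square_integrable_scale)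
  show "1 *\<^sub>R f = f"
    by transfer (auto simp: L2_rel_def)
qed

end

instantiation L2 :: (base_measure) complex_inner
begin

lift_definition scaleC_L2 :: "complex \<Rightarrow> 'a L2 \<Rightarrow> 'a L2" is "\<lambda>c f x. c * f x"
  by (auto simp: L2_rel_def square_integrable_scale)

lift_definition cinner_L2 :: "'a L2 \<Rightarrow> 'a L2 \<Rightarrow> complex" is
  "\<lambda>f g. \<integral>x. cnj (f x) * g x \<partial>base_measure"
proof (rule integral_cong_AE)
  fix f g f' g' :: "'a \<Rightarrow> complex"
  assume "L2_rel f f'" "L2_rel g g'"
  then have sq: "square_integrable f" "square_integrable f'" "square_integrable g" "square_integrable g'"
    and eq: "AE x in base_measure. f x = f' x" "AE x in base_measure. g x = g' x"
    by (simp_all add: L2_rel_def)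
  show "(\<lambda>x. cnj (f x) * g x) \<in> borel_measurable base_measure"
    and "(\<lambda>x. cnj (f' x) * g' x) \<in> borel_measurable base_measure"
    by (intro borel_measurable_cnj_mult square_integrable_measurable sq)+
  show "AE x in base_measure. cnj (f x) * g x = cnj (f' x) * g' x"
    using eq by eventually_elim simp
qed

definition inner_L2 :: "'a L2 \<Rightarrow> 'a L2 \<Rightarrow> real" where "inner_L2 f g = Re (cinner f g)"

definition norm_L2 :: "'a L2 \<Rightarrow> real" where "norm_L2 f = sqrt (inner f f)"

definition dist_L2 :: "'a L2 \<Rightarrow> 'a L2 \<Rightarrow> real" where "dist_L2 f g = norm (f - g)"

definition sgn_L2 :: "'a L2 \<Rightarrow> 'a L2" where "sgn_L2 f = f /\<^sub>R norm f"

definition uniformity_L2 :: "('a L2 \<times> 'a L2) filter" where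
  "uniformity_L2 = (INF e\<in>{0<..}. principal {(f, g). dist f g < e})"

definition open_L2 :: "'a L2 set \<Rightarrow> bool" where
  "open_L2 S \<longleftrightarrow> (\<forall>x\<in>S. \<forall>\<^sub>F (x', y) in uniformity. x' = x \<longrightarrow> y \<in> S)"

instance
proof
  fix f g h :: "'a L2" and c d :: complex and r :: real
  show "c *\<^sub>C (f + g) = c *\<^sub>C f + c *\<^sub>C g"
    by transfer (auto simp: L2_rel_def distrib_left intro!: square_integrable_add square_integrable_scale)
  show "(c + d) *\<^sub>C f = c *\<^sub>C f + d *\<^sub>C f"
    by transfer (auto simp: L2_rel_def distrib_right intro!: square_integrable_add square_integrable_scale)
  show "c *\<^sub>C d *\<^sub>C f = (c * d) *\<^sub>C f"
    by transfer (auto simp: L2_rel_def mult.assoc intro!: square_integrable_scale)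
  show "r *\<^sub>R f = complex_of_real r *\<^sub>C f"
    by transfer (auto simp: L2_rel_def intro!: square_integrable_scale)
  show comm: "cinner f g = cnj (cinner g f)" for f g :: "'a L2"
    by transfer (simp add: mult.commute flip: Bochner_Integration.integral_cnj)
  show add: "cinner f (g + h) = cinner f g + cinner f h" for f g h :: "'a L2"
    by transfer (simp add: L2_rel_def distrib_left square_integrable_mult)
  show scale: "cinner f (c *\<^sub>C g) = c * cinner f g" for f g :: "'a L2" and c
    by transfer (simp add: mult.left_commute)
  show "inner f g = Re (cinner f g)"
    by (fact inner_L2_def)
  show "dist f g = norm (f - g)"
    by (fact dist_L2_def)
  show "sgn f = f /\<^sub>R norm f"
    by (fact sgn_L2_def)
  show "(uniformity :: ('a L2 \<times> 'a L2) filter) = (INF e\<in>{0<..}. principal {(f, g). dist f g < e})"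
    by (fact uniformity_L2_def)
  show "open S \<longleftrightarrow> (\<forall>x\<in>S. \<forall>\<^sub>F (x', y) in uniformity. x' = x \<longrightarrow> y \<in> S)" for S :: "'a L2 set"
    by (fact open_L2_def)
  show "inner f g = inner g f"
    unfolding inner_L2_def by (subst comm) simp
  show "inner (f + g) h = inner f h + inner g h"
    unfolding inner_L2_def by (subst (1 2 3) comm) (simp add: add)
  have scaleR: "r *\<^sub>R f = complex_of_real r *\<^sub>C f" for f :: "'a L2"
    by transfer (auto simp: L2_rel_def intro!: square_integrable_scale)
  show "inner (r *\<^sub>R f) g = r * inner f g"
    unfolding inner_L2_def scaleR by (subst (1 2) comm) (simp add: scale)
  have ff: "cinner f f = complex_of_real (\<integral>x. (cmod (rep_L2 f x))\<^sup>2 \<partial>base_measure)"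
    for f :: "'a L2"
  proof -
    have "cinner f f = (\<integral>x. cnj (rep_L2 f x) * rep_L2 f x \<partial>base_measure)"
      by (simp add: cinner_L2.rep_eq)
    then show ?thesis
      by (simp add: mult.commute complex_norm_square[symmetric] flip: integral_complex_of_real)
  qed
  show "0 \<le> inner f f"
    by (simp add: inner_L2_def ff)
  show "inner f f = 0 \<longleftrightarrow> f = 0"
  proof
    assume "inner f f = 0"
    then have int0: "cinner f f = 0"
      by (simp add: inner_L2_def ff)
    then show "f = 0"
    proof transfer
      fix f :: "'a \<Rightarrow> complex"
      assume f: "L2_rel f f" and 0: "(\<integral>x. cnj (f x) * f x \<partial>base_measure) = 0"
      have "(\<integral>x. cnj (f x) * f x \<partial>base_measure)
          = complex_of_real (\<integral>x. (cmod (f x))\<^sup>2 \<partial>base_measure)"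
        by (simp add: mult.commute complex_norm_square[symmetric] flip: integral_complex_of_real)
      with 0 have "(\<integral>x. (cmod (f x))\<^sup>2 \<partial>base_measure) = 0" by simp
      moreover have "integrable base_measure (\<lambda>x. (cmod (f x))\<^sup>2)"
        using f by (simp add: L2_rel_def square_integrable_def)
      ultimately have "AE x in base_measure. (cmod (f x))\<^sup>2 = 0"
        by (subst (asm) integral_nonneg_eq_0_iff_AE) auto
      then show "L2_rel f (\<lambda>_. 0)"
        using f by (simp add: L2_rel_def square_integrable_zero)
    qed
  next
    assume "f = 0"
    moreover have "cinner 0 (0 :: 'a L2) = 0"
      by transfer simp
    ultimately show "inner f f = 0" by (simp add: inner_L2_def)
  qed
  show "norm f = sqrt (inner f f)"
    by (fact norm_L2_def)
qed

end

section \<open>The continuous and the discrete model\<close>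

lemma square_integrable_compose:
  assumes "t \<in> measurable base_measure base_measure" "distr base_measure base_measure t = base_measure"
    and "square_integrable f"
  shows "square_integrable (\<lambda>x. f (t x))"
proof -
  have "integrable (distr base_measure base_measure t) (\<lambda>x. (cmod (f x))\<^sup>2)"
    using assms by (simp add: square_integrable_def)
  then have "integrable base_measure (\<lambda>x. (cmod (f (t x)))\<^sup>2)"
    by (rule integrable_distr[OF assms(1)])
  then show ?thesis
    using assms measurable_compose[OF assms(1) square_integrable_measurable]
    by (simp add: square_integrable_def)
qed

lemma AE_compose:
  assumes "t \<in> measurable M N" "distr M N t = N" "AE x in N. Q x"
  shows "AE x in M. Q (t x)"
proof -
  have "AE x in distr M N t. Q x"
    unfolding assms(2) by (rule assms(3))
  then show ?thesis
    by (rule AE_distrD[OF assms(1)])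
qed

lemma L2_rel_compose:
  assumes "t \<in> measurable base_measure base_measure" "distr base_measure base_measure t = base_measure"
    and "L2_rel f g"
  shows "L2_rel (\<lambda>x. f (t x)) (\<lambda>x. g (t x))"
  using assms(3) square_integrable_compose[OF assms(1,2)] AE_compose[OF assms(1,2), of "\<lambda>x. f x = g x"]
  by (simp add: L2_rel_def)

lemma base_measure_vec_shift:
  fixes a :: "real ^ 'd"
  shows "(\<lambda>x. x - a) \<in> measurable base_measure base_measure"
    and "distr base_measure base_measure (\<lambda>x. x - a) = base_measure"
proof -
  show "(\<lambda>x. x - a) \<in> measurable base_measure base_measure"
    by (simp add: base_measure_vec_def)
  have "distr base_measure base_measure (\<lambda>x. x - a) = distr lborel borel ((+) (- a))"
    unfolding base_measure_vec_def by (rule distr_cong) auto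
  then show "distr base_measure base_measure (\<lambda>x. x - a) = base_measure"
    by (simp add: lborel_distr_plus base_measure_vec_def)
qed

lemma base_measure_lattice_shift:
  fixes i :: "'d::finite \<Rightarrow> int"
  shows "(\<lambda>n k. n k - i k) \<in> measurable base_measure base_measure"
    and "distr base_measure base_measure (\<lambda>n k. n k - i k) = base_measure"
proof -
  show "(\<lambda>n k. n k - i k) \<in> measurable base_measure base_measure"
    by (simp add: base_measure_fun_def)
  have "bij (\<lambda>n k. n k - i k)"
    by (rule bij_betw_byWitness[where f' = "\<lambda>n k. n k + i k"]) auto
  then show "distr base_measure base_measure (\<lambda>n k. n k - i k) = base_measure"
    unfolding base_measure_fun_def by (intro distr_bij_count_space) auto
qed

lift_definition translate_cont :: "('d::finite \<Rightarrow> int) \<Rightarrow> (real ^ 'd) L2 \<Rightarrow> (real ^ 'd) L2" is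
  "\<lambda>i f x. f (x - (\<chi> k. real_of_int (i k)))"
  by (rule L2_rel_compose[OF base_measure_vec_shift])

lift_definition translate_discr :: "('d::finite \<Rightarrow> int) \<Rightarrow> ('d \<Rightarrow> int) L2 \<Rightarrow> ('d \<Rightarrow> int) L2" is
  "\<lambda>i f n. f (\<lambda>k. n k - i k)"
  by (rule L2_rel_compose[OF base_measure_lattice_shift])

definition unit_cube :: "(real ^ 'd) set" where
  "unit_cube = cbox (\<chi> k. - 1 / 2) (\<chi> k. 1 / 2)"

lift_definition mult_unit_cube :: "(real ^ 'd::finite) L2 \<Rightarrow> (real ^ 'd) L2" is
  "\<lambda>f x. indicator unit_cube x * f x"
proof -
  fix f g :: "real ^ 'd \<Rightarrow> complex"
  assume fg: "L2_rel f g"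
  have "(indicator unit_cube :: real ^ 'd \<Rightarrow> complex) \<in> borel_measurable base_measure"
    by (simp add: base_measure_vec_def unit_cube_def)
  moreover have "cmod (indicator unit_cube x) \<le> 1" for x :: "real ^ 'd"
    by (simp split: split_indicator)
  ultimately show "L2_rel (\<lambda>x. indicator unit_cube x * f x) (\<lambda>x. indicator unit_cube x * g x)"
    using fg unfolding L2_rel_def
    by (intro conjI square_integrable_bounded_mult) auto
qed

lift_definition delta0 :: "('d::finite \<Rightarrow> int) L2" is
  "\<lambda>n. if n = (\<lambda>_. 0) then 1 else 0"
proof -
  have "integrable (count_space UNIV) (\<lambda>n :: 'd \<Rightarrow> int. (cmod (if n = (\<lambda>_. 0) then 1 else 0))\<^sup>2)"
  proof -
    have "integrable (count_space UNIV) (indicator {\<lambda>_. 0} :: ('d \<Rightarrow> int) \<Rightarrow> real)"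
      by (intro integrable_real_indicator) auto
    also have "indicator {\<lambda>_. 0} = (\<lambda>n :: 'd \<Rightarrow> int. (cmod (if n = (\<lambda>_. 0) then 1 else 0))\<^sup>2)"
      by (rule ext) simp
    finally show ?thesis .
  qed
  then show "L2_rel (\<lambda>n :: 'd \<Rightarrow> int. if n = (\<lambda>_. 0) then 1 else 0) (\<lambda>n. if n = (\<lambda>_. 0) then 1 else 0)"
    by (simp add: L2_rel_def square_integrable_def base_measure_fun_def)
qed

text \<open>\<open>\<nu>\<close> is the density of states measure of \<open>H\<close>: the values \<open>\<nu>(A)\<close> on Borel sets are
  determined by \<open>H\<close>, since the spectral measures \<open>E \<omega>\<close> are, and since the trace does not depend on
  the basis.\<close>

definition dos_measure_cont ::
    "'w measure \<Rightarrow> ('w \<Rightarrow> (real ^ 'd::finite) L2 operator) \<Rightarrow> real measure \<Rightarrow> bool" where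
  "dos_measure_cont P H \<nu> \<longleftrightarrow> sets \<nu> = sets borel \<and>
     (\<exists>E \<phi>. (\<forall>\<omega>\<in>space P. spectral_measure_of (H \<omega>) (E \<omega>)) \<and> orthonormal_basis \<phi> \<and>
        (\<forall>A\<in>sets borel. emeasure \<nu> A =
           (\<integral>\<^sup>+\<omega>. trace_in \<phi> (mult_unit_cube \<circ> E \<omega> A \<circ> mult_unit_cube) \<partial>P)))"

definition dos_measure_discr ::
    "'w measure \<Rightarrow> ('w \<Rightarrow> ('d::finite \<Rightarrow> int) L2 operator) \<Rightarrow> real measure \<Rightarrow> bool" where
  "dos_measure_discr P H \<nu> \<longleftrightarrow> sets \<nu> = sets borel \<and>
     (\<exists>E. (\<forall>\<omega>\<in>space P. spectral_measure_of (H \<omega>) (E \<omega>)) \<and>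
        (\<forall>A\<in>sets borel. emeasure \<nu> A =
           (\<integral>\<^sup>+\<omega>. ennreal (Re (cinner delta0 (E \<omega> A delta0))) \<partial>P)))"

end

theory Submission
  imports Defs
begin

text \<open>Since \<open>\<nu>\<close> is absolutely continuous, \<open>\<nu>(I \<inter> \<sigma>) = 0\<close>. Hence almost every
  \<open>E\<^sub>\<omega>(I \<inter> \<sigma>)\<close> annihilates \<open>\<delta>\<^sub>0\<close> (in the continuous model: the functions supported in the unit
  cube), and by covariance and invariance of the probability it annihilates all translates of
  these, so \<open>E\<^sub>\<omega>(I \<inter> \<sigma>) = 0\<close>. On the reducing subspace \<open>M\<^sub>\<omega>\<close> the spectral projection of \<open>I - \<sigma>\<close>
  vanishes as well, so interior points of \<open>I\<close> lie outside the spectrum \<open>\<sigma>\<close> of the part of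
  \<open>H\<^sub>\<omega>\<close> in \<open>M\<^sub>\<omega>\<close>.

  Measurability in \<open>\<omega>\<close> and covariance of the spectral measures are read off from
  \<open>\<langle>x, (H - z)\<^sup>-\<^sup>1 x\<rangle> = \<integral> 1 / (t - z) d\<langle>x, E(t) x\<rangle>\<close>.\<close>

section \<open>Complex Hilbert spaces\<close>

text \<open>\<open>spectral_measure_of\<close> ties \<open>E\<close> to \<open>H\<close> only
  through the domain and the diagonal form \<open>cinner x (op_app H x)\<close>, so no functional
  calculus is at hand. Commutation of \<open>H\<close> with spectral projections and upper and lower
  bounds for \<open>H - l\<close> on spectral subspaces are extracted from that form, by splitting
  integrals and by polarization.

  The subspace \<open>M \<omega>\<close> may vary with \<omega> in an arbitrary way, but
  \<open>I \<inter> \<sigma>\<close> does not vary at all. All null sets come from this one Borel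
  set, countably many test vectors and countably many translations; then a single \<omega> outside
  them is fixed and the rest is deterministic. That \<sigma> is closed, hence Borel, holds because
  it is the spectrum of a part.

  The interior of \<open>I\<close> enters because a point leaves the spectrum only together with a
  gap around it: the lower bound \<open>e * norm v\<close> for \<open>H - l\<close> on the subspace
  uses the radius \<open>e\<close> of a ball inside \<open>I\<close>.\<close>

lemma cinner_add_left: "cinner (x + y) z = cinner x z + cinner y z"
  by (metis cinner_commute cinner_add_right complex_cnj_add)

lemma cinner_scaleC_left: "cinner (c *\<^sub>C x) y = cnj c * cinner x y"
  by (metis cinner_commute cinner_scaleC_right complex_cnj_mult)

lemma cinner_zero_right [simp]: "cinner x 0 = 0"
  using cinner_add_right[of x 0 0] by simp

lemma cinner_zero_left [simp]: "cinner 0 x = 0"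
  using cinner_add_left[of 0 0 x] by simp

lemma cinner_minus_right: "cinner x (- y) = - cinner x y"
  using cinner_add_right[of x y "- y"] by (simp add: eq_neg_iff_add_eq_0 add.commute)

lemma cinner_minus_left: "cinner (- x) y = - cinner x y"
  using cinner_add_left[of x "- x" y] by (simp add: eq_neg_iff_add_eq_0 add.commute)

lemma cinner_diff_right: "cinner x (y - z) = cinner x y - cinner x z"
  using cinner_add_right[of x y "- z"] by (simp add: cinner_minus_right)

lemma cinner_diff_left: "cinner (x - y) z = cinner x z - cinner y z"
  using cinner_add_left[of x "- y" z] by (simp add: cinner_minus_left)

lemmas cinner_simps = cinner_add_left cinner_add_right cinner_diff_left cinner_diff_right
  cinner_scaleC_left cinner_scaleC_right

lemma scaleC_zero_left [simp]: "0 *\<^sub>C x = 0"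
  using scaleR_scaleC[of 0 x] by simp

lemma scaleC_one [simp]: "1 *\<^sub>C x = x"
  using scaleR_scaleC[of 1 x] by simp

lemma scaleC_minus_one: "(- 1) *\<^sub>C x = - x"
  using scaleR_scaleC[of "-1" x] by simp

lemma scaleC_zero_right [simp]: "c *\<^sub>C 0 = 0"
  using scaleC_add_right[of c 0 0] by simp

lemma scaleC_minus_right: "c *\<^sub>C (- x) = - (c *\<^sub>C x)"
  using scaleC_add_right[of c x "- x"] by (simp add: eq_neg_iff_add_eq_0 add.commute)

lemma scaleC_diff_right: "c *\<^sub>C (x - y) = c *\<^sub>C x - c *\<^sub>C y"
  using scaleC_add_right[of c x "- y"] by (simp add: scaleC_minus_right)

lemma scaleC_diff_left: "(c - d) *\<^sub>C x = c *\<^sub>C x - d *\<^sub>C x"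
  using scaleC_add_left[of "c - d" d x] by (simp add: algebra_simps)

lemma cinner_self: "cinner x x = complex_of_real ((norm x)\<^sup>2)"
proof (rule complex_eqI)
  show "Re (cinner x x) = Re (complex_of_real ((norm x)\<^sup>2))"
    by (simp add: power2_norm_eq_inner inner_eq_Re_cinner)
  show "Im (cinner x x) = Im (complex_of_real ((norm x)\<^sup>2))"
    using arg_cong[OF cinner_commute[of x x], of Im] by simp
qed

lemma norm_scaleC: "norm (c *\<^sub>C x) = cmod c * norm x"
proof -
  have "complex_of_real ((norm (c *\<^sub>C x))\<^sup>2) = complex_of_real ((cmod c * norm x)\<^sup>2)"
    unfolding cinner_self[of "c *\<^sub>C x", symmetric]
    by (simp only: cinner_scaleC_left cinner_scaleC_right cinner_self[of x])
       (simp add: power_mult_distrib complex_norm_square[of c] mult_ac del: of_real_power flip: of_real_power)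
  then have "(norm (c *\<^sub>C x))\<^sup>2 = (cmod c * norm x)\<^sup>2"
    unfolding of_real_eq_iff .
  then show ?thesis by simp
qed

lemma cmod_cinner_le: "cmod (cinner x y) \<le> norm x * norm y"
proof (cases "cinner x y = 0")
  case False
  \<comment> \<open>The phase \<open>c\<close> makes \<open>c * cinner x y\<close> real and
    nonnegative, which reduces the claim to the real Cauchy-Schwarz inequality.\<close>
  define c where "c = cnj (cinner x y) / cmod (cinner x y)"
  have "cmod c = 1" using False by (simp add: c_def norm_divide)
  have "c * cinner x y = complex_of_real (cmod (cinner x y))"
    using False by (simp add: c_def mult.commute[of "cnj _"] complex_norm_square[symmetric] power2_eq_square)
  then have "cmod (cinner x y) = inner x (c *\<^sub>C y)"
    by (simp add: inner_eq_Re_cinner cinner_simps)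
  also have "\<dots> \<le> norm x * norm (c *\<^sub>C y)"
    by (rule norm_cauchy_schwarz)
  finally show ?thesis by (simp add: norm_scaleC \<open>cmod c = 1\<close>)
qed simp

lemma bounded_linear_cinner_right: "bounded_linear (cinner x)"
  by (rule bounded_linear_intro[where K = "norm x"])
     (auto simp: cinner_simps scaleR_scaleC scaleR_conv_of_real cmod_cinner_le mult.commute[of _ "norm x"])

lemma bounded_linear_cinner_left: "bounded_linear (\<lambda>x. cinner x y)"
  by (rule bounded_linear_intro[where K = "norm y"])
     (auto simp: cinner_simps scaleR_scaleC scaleR_conv_of_real cmod_cinner_le)

lemma bounded_linear_scaleC: "bounded_linear (\<lambda>x. c *\<^sub>C x)"
  by (rule bounded_linear_intro[where K = "cmod c"])
     (auto simp: scaleC_add_right scaleR_scaleC scaleC_scaleC norm_scaleC mult.commute)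

lemmas tendsto_cinner_left = bounded_linear.tendsto[OF bounded_linear_cinner_left]
lemmas tendsto_scaleC = bounded_linear.tendsto[OF bounded_linear_scaleC]

lemma eq_0_if_orthogonal_dense:
  assumes "closure D = UNIV" and "\<And>u. u \<in> D \<Longrightarrow> cinner u x = 0"
  shows "x = 0"
proof -
  have "x \<in> closure D" using assms(1) by simp
  then obtain s where s: "\<And>n. s n \<in> D" "s \<longlonglongrightarrow> x"
    unfolding closure_sequential by blast
  have "(\<lambda>n. cinner (s n) x) \<longlonglongrightarrow> cinner x x" by (rule tendsto_cinner_left[OF s(2)])
  then have "cinner x x = 0" using assms(2)[OF s(1)] by (simp add: LIMSEQ_const_iff)
  then show ?thesis by (simp add: cinner_self)
qed

lemma norm_sum_orthogonal:
  assumes "cinner x y = 0"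
  shows "(norm (x + y))\<^sup>2 = (norm x)\<^sup>2 + (norm y)\<^sup>2"
proof -
  have "inner x y = 0" using assms by (simp add: inner_eq_Re_cinner)
  then show ?thesis by (simp add: power2_norm_eq_inner inner_simps inner_commute)
qed

lemma csubspace_diff: "csubspace S \<Longrightarrow> x \<in> S \<Longrightarrow> y \<in> S \<Longrightarrow> x - y \<in> S"
  unfolding csubspace_def using scaleC_minus_one by (metis add_uminus_conv_diff)

section \<open>Orthogonal projections\<close>

text \<open>A minimizing sequence for the distance from \<open>u\<close> to \<open>M\<close> is
  Cauchy by the parallelogram law; its limit is a best approximation, and the error of a best
  approximation is orthogonal to \<open>M\<close>.\<close>

lemma orth_proj_exists:
  fixes M :: "'v::{complex_inner, complete_space} set"
  assumes M: "csubspace M" "closed M"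
  shows "\<exists>v\<in>M. \<forall>w\<in>M. cinner w (u - v) = 0"
proof -
  define d where "d = infdist u M"
  have M0: "M \<noteq> {}" using M unfolding csubspace_def by auto
  have d_le: "d \<le> norm (u - v)" if "v \<in> M" for v
    using infdist_le[OF that, of u] by (simp add: d_def dist_norm)
  have d0: "0 \<le> d" by (simp add: d_def infdist_nonneg)
  have "\<exists>v\<in>M. norm (u - v) < d + inverse (Suc n)" for n
    using cINF_less_iff[OF M0, of "dist u" "d + inverse (real (Suc n))"] bdd_below.I2[of M 0 "dist u"]
    by (auto simp: d_def infdist_notempty[OF M0] dist_norm)
  then obtain s where s: "\<And>n. s n \<in> M" "\<And>n. norm (u - s n) < d + inverse (Suc n)" by metis
  \<comment> \<open>Parallelogram law for \<open>u - v\<close> and \<open>u - w\<close>; the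
    midpoint of \<open>v\<close> and \<open>w\<close> lies in \<open>M\<close>, hence at distance at
    least \<open>d\<close> from \<open>u\<close>.\<close>
  have par: "(norm (v - w))\<^sup>2 \<le> 2 * (norm (u - v))\<^sup>2 + 2 * (norm (u - w))\<^sup>2 - 4 * d\<^sup>2"
    if "v \<in> M" "w \<in> M" for v w
  proof -
    have "(1/2) *\<^sub>R (v + w) \<in> M"
      using M that by (auto simp: csubspace_def scaleR_scaleC)
    then have "d \<le> norm (u - (1/2) *\<^sub>R (v + w))" by (rule d_le)
    then have "d\<^sup>2 \<le> (norm (u - (1/2) *\<^sub>R (v + w)))\<^sup>2" using d0 by (intro power_mono)
    then show ?thesis
      by (simp add: power2_norm_eq_inner inner_simps inner_commute algebra_simps)
  qed
  have "Cauchy s"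
  proof (rule metric_CauchyI)
    fix e :: real assume e: "0 < e"
    have "(\<lambda>n. 4 * (d + inverse (real (Suc n)))\<^sup>2 - 4 * d\<^sup>2) \<longlonglongrightarrow> 4 * (d + 0)\<^sup>2 - 4 * d\<^sup>2"
      by (intro tendsto_intros LIMSEQ_inverse_real_of_nat)
    then have "\<forall>\<^sub>F n in sequentially. 4 * (d + inverse (real (Suc n)))\<^sup>2 - 4 * d\<^sup>2 < e\<^sup>2"
      using e by (intro order_tendstoD) auto
    then obtain N where N: "4 * (d + inverse (real (Suc N)))\<^sup>2 - 4 * d\<^sup>2 < e\<^sup>2"
      by (auto simp: eventually_sequentially)
    have b: "(norm (u - s n))\<^sup>2 \<le> (d + inverse (real (Suc N)))\<^sup>2" if "n \<ge> N" for n
    proof (rule power_mono)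
      have "inverse (real (Suc n)) \<le> inverse (real (Suc N))"
        using that by (intro le_imp_inverse_le) auto
      then show "norm (u - s n) \<le> d + inverse (real (Suc N))" using s(2)[of n] by linarith
    qed simp
    have "dist (s m) (s n) < e" if "m \<ge> N" "n \<ge> N" for m n
    proof -
      have "(norm (s m - s n))\<^sup>2 < e\<^sup>2"
        using par[OF s(1)[of m] s(1)[of n]] b[OF that(1)] b[OF that(2)] N by linarith
      then show ?thesis using e by (simp add: dist_norm power_less_imp_less_base)
    qed
    then show "\<exists>N. \<forall>m\<ge>N. \<forall>n\<ge>N. dist (s m) (s n) < e" by blast
  qed
  then obtain v where v: "s \<longlonglongrightarrow> v" by (metis Cauchy_convergent_iff convergent_def)
  have vM: "v \<in> M" by (rule closed_sequentially[OF M(2) s(1) v])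
  have "(\<lambda>n. norm (u - s n)) \<longlonglongrightarrow> norm (u - v)" by (intro tendsto_intros v)
  moreover have "(\<lambda>n. d + inverse (real (Suc n))) \<longlonglongrightarrow> d + 0"
    by (intro tendsto_intros LIMSEQ_inverse_real_of_nat)
  ultimately have vd: "norm (u - v) \<le> d"
    using s(2) by (intro LIMSEQ_le) (auto intro!: exI[of _ 0] less_imp_le)
  have "cinner w (u - v) = 0" if w: "w \<in> M" for w
  proof (cases "w = 0")
    case False
    \<comment> \<open>\<open>c *\<^sub>C w\<close> is the component of \<open>u - v\<close> along
      \<open>w\<close>. By Pythagoras, adding it to \<open>v\<close> would come strictly closer to
      \<open>u\<close> unless \<open>c = 0\<close>.\<close>
    define c where "c = cinner w (u - v) / (norm w)\<^sup>2"
    have "v + c *\<^sub>C w \<in> M" using M vM w by (auto simp: csubspace_def)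
    then have "norm (u - v) \<le> norm (u - (v + c *\<^sub>C w))"
      using d_le vd by fastforce
    then have *: "(norm (u - v))\<^sup>2 \<le> (norm (u - (v + c *\<^sub>C w)))\<^sup>2" by (intro power_mono) auto
    have cw: "c * (norm w)\<^sup>2 = cinner w (u - v)" using False by (simp add: c_def)
    have orth: "cinner (c *\<^sub>C w) (u - (v + c *\<^sub>C w)) = 0"
    proof -
      have "cinner (c *\<^sub>C w) (u - (v + c *\<^sub>C w)) = cnj c * (cinner w (u - v) - c * (norm w)\<^sup>2)"
        by (simp add: cinner_simps cinner_self[of w] algebra_simps)
      then show ?thesis using cw by simp
    qed
    have "u - v = c *\<^sub>C w + (u - (v + c *\<^sub>C w))" by simp
    then have "(norm (u - v))\<^sup>2 = (norm (c *\<^sub>C w))\<^sup>2 + (norm (u - (v + c *\<^sub>C w)))\<^sup>2"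
      using norm_sum_orthogonal[OF orth] by metis
    with * have "c *\<^sub>C w = 0" by simp
    then have "c = 0" using False norm_scaleC[of c w] by simp
    with cw show ?thesis by simp
  qed simp
  with vM show ?thesis by blast
qed

lemma orth_proj_unique:
  assumes "csubspace M" "v \<in> M" "\<And>w. w \<in> M \<Longrightarrow> cinner w (u - v) = 0"
  shows "orth_proj M u = v"
  unfolding orth_proj_def
proof (rule the_equality)
  show "v \<in> M \<and> (\<forall>w\<in>M. cinner w (u - v) = 0)" using assms by auto
  fix v' assume v': "v' \<in> M \<and> (\<forall>w\<in>M. cinner w (u - v') = 0)"
  then have "v - v' \<in> M" using assms csubspace_diff by blast
  then have "cinner (v - v') (u - v') - cinner (v - v') (u - v) = 0"
    using v' assms by simp
  moreover have "cinner (v - v') (u - v') - cinner (v - v') (u - v) = cinner (v - v') (v - v')"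
    by (simp add: cinner_simps)
  ultimately show "v' = v" by (simp add: cinner_self)
qed

context
  fixes M :: "'v::{complex_inner, complete_space} set"
  assumes M: "csubspace M" "closed M"
begin

lemma orth_proj_in: "orth_proj M u \<in> M"
  using orth_proj_exists[OF M] orth_proj_unique[OF M(1)] by metis

lemma orth_proj_orth: "w \<in> M \<Longrightarrow> cinner w (u - orth_proj M u) = 0"
  using orth_proj_exists[OF M, of u] orth_proj_unique[OF M(1), of _ u] by metis

lemma orth_proj_id: "w \<in> M \<Longrightarrow> orth_proj M w = w"
  by (rule orth_proj_unique[OF M(1)]) auto

lemma cinner_orth_proj: "w \<in> M \<Longrightarrow> cinner w (orth_proj M u) = cinner w u"
  using orth_proj_orth[of w u] by (simp add: cinner_simps)

lemma orth_proj_add: "orth_proj M (x + y) = orth_proj M x + orth_proj M y"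
  by (rule orth_proj_unique[OF M(1)])
     (use M orth_proj_in in \<open>auto simp: csubspace_def cinner_simps cinner_orth_proj\<close>)

lemma orth_proj_scaleC: "orth_proj M (c *\<^sub>C x) = c *\<^sub>C orth_proj M x"
  by (rule orth_proj_unique[OF M(1)])
     (use M orth_proj_in in \<open>auto simp: csubspace_def cinner_simps cinner_orth_proj\<close>)

lemma norm_orth_proj_le: "norm (orth_proj M u) \<le> norm u"
proof -
  have "(norm (orth_proj M u))\<^sup>2 + (norm (u - orth_proj M u))\<^sup>2 = (norm u)\<^sup>2"
    using norm_sum_orthogonal[OF orth_proj_orth[OF orth_proj_in], of u u] by simp
  then have "(norm (orth_proj M u))\<^sup>2 \<le> (norm u)\<^sup>2"
    using zero_le_power2[of "norm (u - orth_proj M u)"] by linarith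
  then show ?thesis by (rule power2_le_imp_le) simp
qed

lemma bounded_linear_orth_proj: "bounded_linear (orth_proj M)"
  by (rule bounded_linear_intro[where K = 1])
     (auto simp: orth_proj_add orth_proj_scaleC scaleR_scaleC norm_orth_proj_le)

end

section \<open>Selfadjoint operators\<close>

abbreviation op_app :: "'v operator \<Rightarrow> 'v \<Rightarrow> 'v" where
  "op_app H u \<equiv> the (H u)"

context
  fixes H :: "'v::complex_inner operator"
  assumes H: "selfadjoint H"
begin

lemma selfadjoint_csubspace: "csubspace (dom H)"
  using H by (simp add: selfadjoint_def linear_operator_def)

lemma selfadjoint_zero_dom: "0 \<in> dom H"
  and selfadjoint_add_dom: "u \<in> dom H \<Longrightarrow> v \<in> dom H \<Longrightarrow> u + v \<in> dom H"
  and selfadjoint_scaleC_dom: "u \<in> dom H \<Longrightarrow> c *\<^sub>C u \<in> dom H"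
  using selfadjoint_csubspace unfolding csubspace_def by blast+

lemma selfadjoint_diff_dom: "u \<in> dom H \<Longrightarrow> v \<in> dom H \<Longrightarrow> u - v \<in> dom H"
  by (rule csubspace_diff[OF selfadjoint_csubspace])

lemma selfadjoint_add: "u \<in> dom H \<Longrightarrow> v \<in> dom H \<Longrightarrow> op_app H (u + v) = op_app H u + op_app H v"
  using H unfolding selfadjoint_def linear_operator_def by blast

lemma selfadjoint_scaleC: "u \<in> dom H \<Longrightarrow> op_app H (c *\<^sub>C u) = c *\<^sub>C op_app H u"
  using H unfolding selfadjoint_def linear_operator_def by blast

lemma selfadjoint_diff: "u \<in> dom H \<Longrightarrow> v \<in> dom H \<Longrightarrow> op_app H (u - v) = op_app H u - op_app H v"
  using selfadjoint_add[of u "(-1) *\<^sub>C v"] selfadjoint_scaleC[of v "-1"]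
    selfadjoint_scaleC_dom[of v "-1"] by (simp add: scaleC_minus_one)

lemma selfadjoint_dense: "closure (dom H) = UNIV"
  using H by (simp add: selfadjoint_def)

text \<open>The usable form of \<open>op_adjoint H = H\<close>: weak solutions lie in the domain.
  Density of the domain makes the definite description in \<open>op_adjoint\<close> well
  determined.\<close>

lemma selfadjoint_adjoint_eqI:
  assumes "\<And>u. u \<in> dom H \<Longrightarrow> cinner y u = cinner w (op_app H u)"
  shows "w \<in> dom H" "op_app H w = y"
proof -
  have *: "y' = y" if "\<forall>u\<in>dom H. cinner y' u = cinner w (op_app H u)" for y'
  proof -
    have "cinner u (y' - y) = 0" if "u \<in> dom H" for u
    proof -
      have "cinner (y' - y) u = 0"
        using assms[OF that] \<open>\<forall>u\<in>dom H. _ u\<close> that by (simp add: cinner_simps)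
      then show ?thesis using cinner_commute[of u "y' - y"] by simp
    qed
    then have "y' - y = 0" by (rule eq_0_if_orthogonal_dense[OF selfadjoint_dense])
    then show ?thesis by simp
  qed
  have "op_adjoint H w = Some (THE y. \<forall>u\<in>dom H. cinner y u = cinner w (op_app H u))"
    unfolding op_adjoint_def using assms by auto
  also have "(THE y. \<forall>u\<in>dom H. cinner y u = cinner w (op_app H u)) = y"
    using assms * by (intro the_equality) auto
  also have "op_adjoint H = H" using H by (simp add: selfadjoint_def)
  finally show "w \<in> dom H" "op_app H w = y" by auto
qed

lemma selfadjoint_symmetric:
  assumes "x \<in> dom H" "y \<in> dom H"
  shows "cinner (op_app H x) y = cinner x (op_app H y)"
proof -
  have "op_adjoint H x \<noteq> None" using assms H by (auto simp: selfadjoint_def)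
  then obtain y' where y': "\<forall>u\<in>dom H. cinner y' u = cinner x (op_app H u)"
    unfolding op_adjoint_def by (auto split: if_splits)
  then have "op_app H x = y'" using selfadjoint_adjoint_eqI(2) by blast
  then show ?thesis using y' assms by blast
qed

text \<open>\<open>H\<close> equals its adjoint, and the identity that defines an adjoint survives
  limits.\<close>

lemma selfadjoint_closed:
  assumes "\<And>n. s n \<in> dom H" "s \<longlonglongrightarrow> x" "(\<lambda>n. op_app H (s n)) \<longlonglongrightarrow> y"
  shows "x \<in> dom H" "op_app H x = y"
proof -
  have *: "cinner y u = cinner x (op_app H u)" if "u \<in> dom H" for u
  proof (rule LIMSEQ_unique)
    show "(\<lambda>n. cinner (op_app H (s n)) u) \<longlonglongrightarrow> cinner y u"
      by (rule tendsto_cinner_left[OF assms(3)])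
    show "(\<lambda>n. cinner (op_app H (s n)) u) \<longlonglongrightarrow> cinner x (op_app H u)"
      using tendsto_cinner_left[OF assms(2)] assms(1) that by (simp add: selfadjoint_symmetric)
  qed
  show "x \<in> dom H" "op_app H x = y" using selfadjoint_adjoint_eqI[OF *] by blast+
qed

end

text \<open>By symmetry of \<open>H\<close>, the cross terms of both squared norms combine to
  \<open>(z + cnj z) * cinner v (op_app H v)\<close>, which is unchanged when \<open>z\<close> is
  conjugated.\<close>

lemma norm_shift_cnj:
  assumes H: "selfadjoint H" and v: "v \<in> dom H"
  shows "norm (op_app H v - cnj z *\<^sub>C v) = norm (op_app H v - z *\<^sub>C v)"
proof -
  have "complex_of_real ((norm (op_app H v - cnj z *\<^sub>C v))\<^sup>2) = complex_of_real ((norm (op_app H v - z *\<^sub>C v))\<^sup>2)"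
    unfolding cinner_self[symmetric]
    by (simp add: cinner_simps selfadjoint_symmetric[OF H v v] algebra_simps)
  then have "(norm (op_app H v - cnj z *\<^sub>C v))\<^sup>2 = (norm (op_app H v - z *\<^sub>C v))\<^sup>2"
    unfolding of_real_eq_iff .
  then show ?thesis by simp
qed

section \<open>Parts of selfadjoint operators in reducing subspaces\<close>

context
  fixes H :: "'v::{complex_inner, complete_space} operator" and M :: "'v set"
  assumes H: "selfadjoint H" and M: "csubspace M" "closed M" and red: "reduces M H"
begin

lemma reduces_dom: "u \<in> dom H \<Longrightarrow> orth_proj M u \<in> dom H"
  using red by (simp add: reduces_def)

lemma reduces_in: "u \<in> dom H \<Longrightarrow> u \<in> M \<Longrightarrow> op_app H u \<in> M"
  using red orth_proj_id[OF M, of u] by (force simp: reduces_def)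

text \<open>\<open>reduces\<close> only says that \<open>H\<close> maps projected vectors into
  \<open>M\<close>. Symmetry of \<open>H\<close> yields the dual statement: \<open>H\<close> maps
  \<open>u - orth_proj M u\<close> into the orthogonal complement of \<open>M\<close>, which is
  tested against the dense domain.\<close>

lemma reduces_commute:
  assumes u: "u \<in> dom H"
  shows "orth_proj M (op_app H u) = op_app H (orth_proj M u)"
proof (rule orth_proj_unique[OF M(1)])
  have Pu: "orth_proj M u \<in> dom H" by (rule reduces_dom[OF u])
  show "op_app H (orth_proj M u) \<in> M" using red u by (auto simp: reduces_def)
  fix w assume w: "w \<in> M"
  define r where "r = op_app H (u - orth_proj M u)"
  have *: "cinner v (orth_proj M r) = 0" if v: "v \<in> dom H" for v
  proof -
    have "cinner v (orth_proj M r) = cinner (orth_proj M v) (orth_proj M r)"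
      using cinner_orth_proj[OF M orth_proj_in[OF M, of r], of v]
      by (metis cinner_commute)
    also have "\<dots> = cinner (orth_proj M v) r"
      by (rule cinner_orth_proj[OF M orth_proj_in[OF M]])
    also have "\<dots> = cinner (op_app H (orth_proj M v)) (u - orth_proj M u)"
      unfolding r_def
      by (rule selfadjoint_symmetric[OF H, symmetric])
         (intro reduces_dom v selfadjoint_diff_dom[OF H] u)+
    also have "\<dots> = 0"
      by (rule orth_proj_orth[OF M]) (use red v in \<open>auto simp: reduces_def\<close>)
    finally show ?thesis .
  qed
  have "orth_proj M r = 0"
    by (rule eq_0_if_orthogonal_dense[OF selfadjoint_dense[OF H] *])
  then have "cinner w r = 0" using cinner_orth_proj[OF M w, of r] by simp
  then show "cinner w (op_app H u - op_app H (orth_proj M u)) = 0"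
    by (simp add: r_def selfadjoint_diff[OF H u Pu])
qed

text \<open>The bound at \<open>z\<close> makes \<open>H - z\<close> injective on the part, with
  closed range; the bound at \<open>cnj z\<close> excludes vectors of \<open>M\<close> orthogonal to
  that range.\<close>

lemma not_in_spectrumI:
  assumes c: "0 < c"
    and low: "\<And>v. v \<in> dom H \<Longrightarrow> v \<in> M \<Longrightarrow> c * norm v \<le> norm (op_app H v - z *\<^sub>C v)"
    and low': "\<And>v. v \<in> dom H \<Longrightarrow> v \<in> M \<Longrightarrow> c * norm v \<le> norm (op_app H v - cnj z *\<^sub>C v)"
  shows "z \<notin> spectrum_in M (H |` M)"
proof -
  define f where "f = (\<lambda>u. op_app H u - z *\<^sub>C u)"
  let ?D = "dom H \<inter> M"
  have f_diff: "f (u - v) = f u - f v" if "u \<in> dom H" "v \<in> dom H" for u v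
    using that by (simp add: f_def selfadjoint_diff[OF H] scaleC_diff_right)
  have f_in: "f u \<in> M" if "u \<in> ?D" for u
    using that M reduces_in unfolding f_def csubspace_def
    by (metis IntE M(1) csubspace_diff csubspace_def)
  have diffD: "u - v \<in> ?D" if "u \<in> ?D" "v \<in> ?D" for u v
    using that selfadjoint_diff_dom[OF H] csubspace_diff[OF M(1)] by auto
  have low_diff: "c * norm (u - v) \<le> norm (f u - f v)" if "u \<in> ?D" "v \<in> ?D" for u v
    using low[of "u - v"] diffD[OF that] f_diff[of u v] that by (auto simp: f_def)
  have inj: "inj_on f ?D"
  proof (rule inj_onI)
    fix u v assume "u \<in> ?D" "v \<in> ?D" "f u = f v"
    then have "c * norm (u - v) \<le> 0" using low_diff by fastforce
    then show "u = v" using c by (simp add: mult_le_0_iff)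
  qed
  define R where "R = f ` ?D"
  have R_sub: "csubspace R"
    unfolding csubspace_def R_def
  proof (intro conjI ballI allI)
    have "0 \<in> ?D" using selfadjoint_zero_dom[OF H] M by (auto simp: csubspace_def)
    moreover have "f 0 = 0" using selfadjoint_scaleC[OF H selfadjoint_zero_dom[OF H], of 0] by (simp add: f_def)
    ultimately show "0 \<in> f ` ?D" by (metis imageI)
    fix x assume "x \<in> f ` ?D"
    then obtain u where u: "u \<in> ?D" "x = f u" by blast
    show "k *\<^sub>C x \<in> f ` ?D" for k
    proof (rule image_eqI)
      show "k *\<^sub>C u \<in> ?D" using u M selfadjoint_scaleC_dom[OF H] by (auto simp: csubspace_def)
      show "k *\<^sub>C x = f (k *\<^sub>C u)"
        using u by (simp add: f_def selfadjoint_scaleC[OF H] scaleC_diff_right scaleC_scaleC mult.commute)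
    qed
    fix y assume "y \<in> f ` ?D"
    then obtain v where v: "v \<in> ?D" "y = f v" by blast
    show "x + y \<in> f ` ?D"
    proof (rule image_eqI)
      show "u + v \<in> ?D" using u v M selfadjoint_add_dom[OF H] by (auto simp: csubspace_def)
      show "x + y = f (u + v)"
        using u v by (simp add: f_def selfadjoint_add[OF H] scaleC_add_right)
    qed
  qed
  \<comment> \<open>The lower bound turns convergence of images into convergence of preimages, and
    \<open>H\<close> is a closed operator.\<close>
  have R_closed: "closed R"
    unfolding closed_sequential_limits
  proof (intro allI impI, elim conjE)
    fix y l assume "\<forall>n. y n \<in> R" and yl: "y \<longlonglongrightarrow> l"
    then have "\<forall>n. \<exists>u. u \<in> ?D \<and> y n = f u" unfolding R_def by blast
    from choice[OF this] obtain s where s: "\<And>n. s n \<in> ?D" "\<And>n. y n = f (s n)" by blast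
    have "Cauchy y" using yl by (rule LIMSEQ_imp_Cauchy)
    have "Cauchy s"
    proof (rule metric_CauchyI)
      fix e :: real assume "0 < e"
      then have "0 < c * e" using c by simp
      from metric_CauchyD[OF \<open>Cauchy y\<close> this]
      obtain N where N: "\<forall>m\<ge>N. \<forall>n\<ge>N. dist (y m) (y n) < c * e" by blast
      have "dist (s m) (s n) < e" if "m \<ge> N" "n \<ge> N" for m n
      proof -
        have "c * dist (s m) (s n) < c * e"
          using low_diff[OF s(1)[of m] s(1)[of n]] N that by (fastforce simp: dist_norm s(2))
        then show ?thesis using c by simp
      qed
      then show "\<exists>N. \<forall>m\<ge>N. \<forall>n\<ge>N. dist (s m) (s n) < e" by blast
    qed
    then obtain x where x: "s \<longlonglongrightarrow> x" by (metis Cauchy_convergent_iff convergent_def)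
    have eq: "op_app H (s n) = y n + z *\<^sub>C s n" for n unfolding s(2) f_def by simp
    have "(\<lambda>n. y n + z *\<^sub>C s n) \<longlonglongrightarrow> l + z *\<^sub>C x"
      by (intro tendsto_add yl tendsto_scaleC x)
    then have "(\<lambda>n. op_app H (s n)) \<longlonglongrightarrow> l + z *\<^sub>C x" unfolding eq .
    from selfadjoint_closed[OF H _ x this] s(1)
    have "x \<in> dom H" "op_app H x = l + z *\<^sub>C x" by auto
    moreover have "x \<in> M" using closed_sequentially[OF M(2) _ x] s(1) by auto
    ultimately show "l \<in> R" unfolding R_def f_def by (intro image_eqI[of _ _ x]) auto
  qed
  have "M \<subseteq> R"
  proof
    fix y assume y: "y \<in> M"
    \<comment> \<open>\<open>w\<close> is the part of \<open>y\<close> missed by the range.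
      Orthogonality to the range makes it an eigenvector of \<open>H\<close> for
      \<open>cnj z\<close>, which \<open>low'\<close> forces to vanish.\<close>
    define w where "w = y - orth_proj R y"
    have "R \<subseteq> M" using f_in by (auto simp: R_def)
    then have "orth_proj R y \<in> M" using orth_proj_in[OF R_sub R_closed, of y] by blast
    then have wM: "w \<in> M" unfolding w_def by (intro csubspace_diff[OF M(1)] y)
    \<comment> \<open>Here \<open>u\<close> ranges over all of \<open>dom H\<close>, not only over
      vectors of \<open>M\<close>. As \<open>w\<close> lies in \<open>M\<close>, both
      \<open>u\<close> and \<open>op_app H u\<close> may be replaced by their projections, which
      \<open>reduces_commute\<close> relates.\<close>
    have *: "cinner (cnj z *\<^sub>C w) u = cinner w (op_app H u)" if u: "u \<in> dom H" for u
    proof -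
      have Pu: "orth_proj M u \<in> ?D" using reduces_dom[OF u] orth_proj_in[OF M] by blast
      have "cinner (f (orth_proj M u)) w = 0"
        unfolding w_def by (rule orth_proj_orth[OF R_sub R_closed]) (use Pu in \<open>auto simp: R_def\<close>)
      then have "cinner w (f (orth_proj M u)) = 0"
        using cinner_commute[of w "f (orth_proj M u)"] by simp
      then have "cinner w (orth_proj M (op_app H u)) - z * cinner w (orth_proj M u) = 0"
        by (simp add: f_def cinner_simps reduces_commute[OF u])
      then show ?thesis by (simp add: cinner_orth_proj[OF M wM] cinner_simps)
    qed
    have "w \<in> dom H" "op_app H w = cnj z *\<^sub>C w" using selfadjoint_adjoint_eqI[OF H *] by auto
    then have "c * norm w \<le> 0" using low'[OF _ wM] by simp
    then have "w = 0" using c by (simp add: mult_le_0_iff)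
    then show "y \<in> R" using orth_proj_in[OF R_sub R_closed, of y] by (simp add: w_def)
  qed
  then have surj: "f ` ?D = M" using f_in unfolding R_def by blast
  have bij: "bij_betw f ?D M" using inj surj by (simp add: bij_betw_def)
  have eq: "bij_betw (\<lambda>u. the ((H |` M) u) - z *\<^sub>C u) (dom (H |` M)) M"
    unfolding dom_restrict using bij by (subst bij_betw_cong[of _ _ f]) (auto simp: f_def)
  have bd: "norm (resolvent (H |` M) z y) \<le> (1 / c) * norm y" if "y \<in> M" for y
  proof -
    let ?u = "resolvent (H |` M) z y"
    have "?u \<in> dom (H |` M)" "the ((H |` M) ?u) - z *\<^sub>C ?u = y"
      using bij_betw_inv_into_right[OF eq that] inv_into_into[of y "\<lambda>u. the ((H |` M) u) - z *\<^sub>C u" "dom (H |` M)"]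
        eq that unfolding resolvent_def bij_betw_def by auto
    then have "?u \<in> dom H" "?u \<in> M" "op_app H ?u - z *\<^sub>C ?u = y" by (auto simp: dom_restrict)
    then have "c * norm ?u \<le> norm y" using low[of ?u] by simp
    then show ?thesis using c by (simp add: field_simps)
  qed
  have "\<exists>C. \<forall>y\<in>M. norm (resolvent (H |` M) z y) \<le> C * norm y" using bd by blast
  with eq show ?thesis unfolding spectrum_in_def by blast
qed

lemma not_in_spectrumD:
  assumes "z \<notin> spectrum_in M (H |` M)"
  obtains c where "0 < c"
    "\<And>v. v \<in> dom H \<Longrightarrow> v \<in> M \<Longrightarrow> c * norm v \<le> norm (op_app H v - z *\<^sub>C v)"
proof -
  let ?f = "\<lambda>u. the ((H |` M) u) - z *\<^sub>C u"
  obtain C where bij: "bij_betw ?f (dom (H |` M)) M"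
    and C: "\<And>y. y \<in> M \<Longrightarrow> norm (resolvent (H |` M) z y) \<le> C * norm y"
    using assms unfolding spectrum_in_def by auto
  \<comment> \<open>\<open>C\<close> can be zero or negative, for instance if \<open>M\<close> is
    the zero space; \<open>max C 1\<close> can always be inverted.\<close>
  have "inverse (max C 1) * norm v \<le> norm (op_app H v - z *\<^sub>C v)" if "v \<in> dom H" "v \<in> M" for v
  proof -
    have v: "v \<in> dom (H |` M)" using that by (simp add: dom_restrict)
    have fv: "?f v = op_app H v - z *\<^sub>C v" using that by simp
    have "norm v = norm (resolvent (H |` M) z (?f v))"
      unfolding resolvent_def using bij_betw_inv_into_left[OF bij v] by simp
    also have "\<dots> \<le> C * norm (?f v)" by (rule C) (use bij v in \<open>auto simp: bij_betw_def\<close>)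
    also have "\<dots> \<le> max C 1 * norm (?f v)" by (intro mult_right_mono) auto
    finally show ?thesis unfolding fv by (simp add: field_simps)
  qed
  then show ?thesis using that[of "inverse (max C 1)"] by simp
qed

lemma not_in_spectrumI':
  assumes "0 < c"
    and "\<And>v. v \<in> dom H \<Longrightarrow> v \<in> M \<Longrightarrow> c * norm v \<le> norm (op_app H v - z *\<^sub>C v)"
  shows "z \<notin> spectrum_in M (H |` M)"
  using assms by (intro not_in_spectrumI[of c]) (auto simp: norm_shift_cnj[OF H])

text \<open>Moving \<open>z\<close> by less than \<open>c / 2\<close> costs at most half of the
  lower bound \<open>c\<close>. Closedness is what later makes an almost sure spectrum a Borel
  set.\<close>

lemma closed_spectrum: "closed (spectrum_in M (H |` M))"
  unfolding closed_def open_dist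
proof (intro ballI)
  fix z assume "z \<in> - spectrum_in M (H |` M)"
  then obtain c where c: "0 < c"
    and low: "\<And>v. v \<in> dom H \<Longrightarrow> v \<in> M \<Longrightarrow> c * norm v \<le> norm (op_app H v - z *\<^sub>C v)"
    using not_in_spectrumD by auto
  have "z' \<notin> spectrum_in M (H |` M)" if z': "dist z' z < c / 2" for z'
  proof (rule not_in_spectrumI'[of "c / 2"])
    fix v assume v: "v \<in> dom H" "v \<in> M"
    have "op_app H v - z *\<^sub>C v = (op_app H v - z' *\<^sub>C v) + (z' - z) *\<^sub>C v"
      by (simp add: scaleC_diff_left)
    then have "norm (op_app H v - z *\<^sub>C v) \<le> norm (op_app H v - z' *\<^sub>C v) + cmod (z' - z) * norm v"
      by (metis norm_triangle_ineq norm_scaleC)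
    also have "cmod (z' - z) * norm v \<le> c / 2 * norm v"
      using z' by (intro mult_right_mono) (auto simp: dist_norm)
    finally show "c / 2 * norm v \<le> norm (op_app H v - z' *\<^sub>C v)" using low[OF v] by (simp add: algebra_simps)
  qed (use c in auto)
  then show "\<exists>e>0. \<forall>y. dist y z < e \<longrightarrow> y \<in> - spectrum_in M (H |` M)"
    using c by (intro exI[of _ "c / 2"]) auto
qed

end

section \<open>Resolvents at nonreal points\<close>

lemma norm_shift_nonreal:
  assumes H: "selfadjoint H" and v: "v \<in> dom H"
  shows "\<bar>Im z\<bar> * norm v \<le> norm (op_app H v - z *\<^sub>C v)"
proof (cases "v = 0")
  case False
  \<comment> \<open>The form of a symmetric operator is real, so the imaginary part of
    \<open>cinner v (op_app H v - z *\<^sub>C v)\<close> comes from \<open>z\<close> alone.\<close>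
  have "Im (cinner v (op_app H v)) = 0"
    using selfadjoint_symmetric[OF H v v] cinner_commute[of v "op_app H v"]
    by (metis complex_cnj_cancel_iff complex_cnj Im_complex_of_real Reals_cnj_iff complex_is_Real_iff)
  then have "\<bar>Im z\<bar> * (norm v)\<^sup>2 = \<bar>Im (cinner v (op_app H v - z *\<^sub>C v))\<bar>"
    by (simp add: cinner_simps cinner_self abs_mult)
  also have "\<dots> \<le> norm v * norm (op_app H v - z *\<^sub>C v)"
    using abs_Im_le_cmod cmod_cinner_le order_trans by blast
  finally have "norm v * (\<bar>Im z\<bar> * norm v) \<le> norm v * norm (op_app H v - z *\<^sub>C v)"
    by (simp add: power2_eq_square mult_ac)
  then show ?thesis using False by simp
qed simp

text \<open>The whole space reduces \<open>H\<close>, so the criterion for parts applies with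
  \<open>M = UNIV\<close>. It makes \<open>resolvent\<close>, defined through
  \<open>inv_into\<close>, a genuine inverse off the real axis.\<close>

lemma bij_betw_shift_nonreal:
  fixes H :: "'v::{complex_inner, complete_space} operator"
  assumes H: "selfadjoint H" and z: "z \<notin> \<real>"
  shows "bij_betw (\<lambda>u. op_app H u - z *\<^sub>C u) (dom H) UNIV"
proof -
  have U: "csubspace (UNIV :: 'v set)" by (simp add: csubspace_def)
  have "orth_proj UNIV u = u" for u :: 'v by (rule orth_proj_id[OF U]) auto
  then have red: "reduces UNIV H" by (auto simp: reduces_def)
  have "z \<notin> spectrum_in UNIV (H |` UNIV)"
    using z norm_shift_nonreal[OF H, of _ z]
    by (intro not_in_spectrumI'[OF H U closed_UNIV red, of "\<bar>Im z\<bar>"]) (auto simp: complex_is_Real_iff)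
  moreover have "H |` UNIV = H" by (rule ext) (simp add: restrict_map_def)
  ultimately show ?thesis by (simp add: spectrum_in_def)
qed

lemma resolvent_nonreal:
  fixes H :: "'v::{complex_inner, complete_space} operator"
  assumes "selfadjoint H" "z \<notin> \<real>"
  shows "resolvent H z y \<in> dom H"
    and "op_app H (resolvent H z y) - z *\<^sub>C resolvent H z y = y"
  using bij_betw_inv_into_right[OF bij_betw_shift_nonreal[OF assms], of y]
    bij_betw_shift_nonreal[OF assms] inv_into_into[of y "\<lambda>u. op_app H u - z *\<^sub>C u" "dom H"]
  unfolding resolvent_def bij_betw_def by auto

lemma resolvent_eqI:
  fixes H :: "'v::{complex_inner, complete_space} operator"
  assumes "selfadjoint H" "z \<notin> \<real>" "u \<in> dom H" "op_app H u - z *\<^sub>C u = y"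
  shows "resolvent H z y = u"
  unfolding resolvent_def
  using bij_betw_inv_into_left[OF bij_betw_shift_nonreal[OF assms(1,2)] assms(3)] assms(4) by simp

section \<open>Projection-valued measures\<close>

context
  fixes Q :: "'v::complex_inner \<Rightarrow> 'v"
  assumes Q: "projection_operator Q"
begin

lemma projection_operator_add: "Q (x + y) = Q x + Q y"
  and projection_operator_scaleC: "Q (c *\<^sub>C x) = c *\<^sub>C Q x"
  and projection_operator_symmetric: "cinner (Q x) y = cinner x (Q y)"
  using Q by (auto simp: projection_operator_def clinear_def)

lemma projection_operator_idem: "Q (Q x) = Q x"
  using Q unfolding projection_operator_def by (metis comp_apply)

lemma projection_operator_diff: "Q (x - y) = Q x - Q y"
  using projection_operator_add[of "x - y" y] by (simp add: algebra_simps)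

lemma cinner_projection_operator: "cinner x (Q x) = complex_of_real ((norm (Q x))\<^sup>2)"
  using projection_operator_symmetric[of x "Q x"]
  by (simp only: projection_operator_idem cinner_self)

lemma norm_projection_operator_le: "norm (Q x) \<le> norm x"
proof -
  have "cinner (Q x) (x - Q x) = 0"
    by (simp add: projection_operator_symmetric projection_operator_diff projection_operator_idem)
  from norm_sum_orthogonal[OF this] have "(norm (Q x))\<^sup>2 + (norm (x - Q x))\<^sup>2 = (norm x)\<^sup>2" by simp
  then have "(norm (Q x))\<^sup>2 \<le> (norm x)\<^sup>2" using zero_le_power2[of "norm (x - Q x)"] by linarith
  then show ?thesis by (rule power2_le_imp_le) simp
qed

end

context
  fixes E :: "real set \<Rightarrow> 'v::complex_inner \<Rightarrow> 'v"
  assumes E: "projection_valued_measure E"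
begin

lemma pvm_proj: "A \<in> sets borel \<Longrightarrow> projection_operator (E A)"
  using E by (simp add: projection_valued_measure_def)

lemma pvm_UNIV: "E UNIV x = x"
  using E by (simp add: projection_valued_measure_def)

lemma pvm_sums:
  "range A \<subseteq> sets borel \<Longrightarrow> disjoint_family A \<Longrightarrow> (\<lambda>n::nat. E (A n) x) sums E (\<Union>n. A n) x"
  using E by (simp add: projection_valued_measure_def)

text \<open>Countable additivity for the constant sequence of empty sets: a convergent series with
  equal terms has zero terms.\<close>

lemma pvm_empty: "E {} x = 0"
proof -
  have "(\<lambda>n::nat. E {} x) sums E (\<Union>n::nat. {}) x"
    by (rule pvm_sums[of "\<lambda>_. {}"]) (auto simp: disjoint_family_on_def)
  then have "(\<lambda>n::nat. E {} x) \<longlonglongrightarrow> 0" by (intro summable_LIMSEQ_zero) (rule sums_summable)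
  then show ?thesis by (simp add: LIMSEQ_const_iff)
qed

lemma pvm_Un:
  assumes "A \<in> sets borel" "B \<in> sets borel" "A \<inter> B = {}"
  shows "E (A \<union> B) x = E A x + E B x"
proof -
  have "(\<lambda>n. E (binaryset A B n) x) sums E (\<Union>n. binaryset A B n) x"
    using assms by (intro pvm_sums) (auto simp: range_binaryset_eq disjoint_family_on_def binaryset_def)
  moreover have "(\<lambda>n. E (binaryset A B n) x) sums (\<Sum>n\<in>{0,1}. E (binaryset A B n) x)"
    by (rule sums_finite) (auto simp: binaryset_def pvm_empty)
  ultimately have "E (\<Union>n. binaryset A B n) x = (\<Sum>n\<in>{0,1}. E (binaryset A B n) x)"
    by (rule sums_unique2)
  then show ?thesis by (simp add: UN_binaryset_eq) (simp add: binaryset_def)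
qed

lemma pvm_compl: "A \<in> sets borel \<Longrightarrow> E (- A) x = x - E A x"
  using pvm_Un[of A "- A" x] by (simp add: borel_comp pvm_UNIV algebra_simps)

text \<open>Multiplicativity is derived from additivity. On \<open>y = E B x\<close> additivity
  gives \<open>norm (E A y)\<close> squared plus \<open>norm y\<close> squared for the squared norm
  of \<open>E (A \<union> B) y\<close>, and a projection cannot enlarge \<open>y\<close>.\<close>

lemma pvm_disjoint:
  assumes "A \<in> sets borel" "B \<in> sets borel" "A \<inter> B = {}"
  shows "E A (E B x) = 0"
proof -
  note p = pvm_proj[OF assms(1)] pvm_proj[OF assms(2)]
  have AB: "A \<union> B \<in> sets borel" using assms by simp
  let ?y = "E B x"
  have "complex_of_real ((norm (E (A \<union> B) ?y))\<^sup>2) = cinner ?y (E A ?y + E B ?y)"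
    using cinner_projection_operator[OF pvm_proj[OF AB], of ?y] pvm_Un[OF assms] by simp
  also have "\<dots> = complex_of_real ((norm (E A ?y))\<^sup>2 + (norm (E B ?y))\<^sup>2)"
    using cinner_projection_operator[OF p(1), of ?y] cinner_projection_operator[OF p(2), of ?y]
    by (simp add: cinner_add_right)
  finally have "(norm (E (A \<union> B) ?y))\<^sup>2 = (norm (E A ?y))\<^sup>2 + (norm ?y)\<^sup>2"
    unfolding of_real_eq_iff by (simp add: projection_operator_idem[OF p(2)])
  moreover have "(norm (E (A \<union> B) ?y))\<^sup>2 \<le> (norm ?y)\<^sup>2"
    by (intro power_mono norm_projection_operator_le pvm_proj AB) simp
  ultimately show ?thesis by simp
qed

text \<open>Split \<open>A\<close> and \<open>B\<close> along their intersection; the mixed products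
  vanish by \<open>pvm_disjoint\<close>.\<close>

lemma pvm_Int:
  assumes "A \<in> sets borel" "B \<in> sets borel"
  shows "E A (E B x) = E (A \<inter> B) x"
proof -
  have s: "A \<inter> B \<in> sets borel" "A - B \<in> sets borel" "B - A \<in> sets borel" using assms by auto
  have A: "E A y = E (A \<inter> B) y + E (A - B) y" for y
    using pvm_Un[of "A \<inter> B" "A - B" y] s by (simp add: Int_Diff_Un Diff_disjoint inf_assoc)
  have "A \<inter> B \<union> (B - A) = B" "A \<inter> B \<inter> (B - A) = {}" by auto
  then have B: "E B y = E (A \<inter> B) y + E (B - A) y" for y
    using pvm_Un[of "A \<inter> B" "B - A" y] s by simp
  have d: "(A \<inter> B) \<inter> (B - A) = {}" "(A - B) \<inter> B = {}" by auto
  have "E A (E B x) = E (A \<inter> B) (E B x) + E (A - B) (E B x)" by (rule A)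
  also have "E (A - B) (E B x) = 0" by (rule pvm_disjoint[OF s(2) assms(2) d(2)])
  also have "E (A \<inter> B) (E B x) = E (A \<inter> B) (E (A \<inter> B) x) + E (A \<inter> B) (E (B - A) x)"
    by (simp only: B[of x] projection_operator_add[OF pvm_proj[OF s(1)]])
  also have "E (A \<inter> B) (E (B - A) x) = 0" by (rule pvm_disjoint[OF s(1) s(3) d(1)])
  finally show ?thesis by (simp add: projection_operator_idem[OF pvm_proj[OF s(1)]])
qed

lemma pvm_subset:
  assumes "A \<in> sets borel" "B \<in> sets borel" "A \<subseteq> B"
  shows "E B (E A x) = E A x"
  using pvm_Int[OF assms(2,1), of x] assms(3) by (simp add: Int_absorb1)

section \<open>Scalar measures\<close>

lemma space_scalar_measure [simp]: "space (scalar_measure E x) = UNIV"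
  and sets_scalar_measure [simp]: "sets (scalar_measure E x) = sets borel"
proof -
  have "sigma_sets UNIV (sets borel) = sets (borel :: real measure)"
    using sets.sigma_sets_eq[of "borel :: real measure"] by simp
  then show "space (scalar_measure E x) = UNIV" "sets (scalar_measure E x) = sets borel"
    by (simp_all add: scalar_measure_def space_measure_of_conv sets_measure_of_conv)
qed

text \<open>\<open>measure_of\<close> takes the prescribed values only once the set function is
  known to be countably additive; this follows from the vector-valued series in the definition and
  continuity of the inner product.\<close>

lemma emeasure_scalar_measure:
  assumes A: "A \<in> sets borel"
  shows "emeasure (scalar_measure E x) A = ennreal ((norm (E A x))\<^sup>2)"
proof -
  let ?f = "\<lambda>A. ennreal (Re (cinner x (E A x)))"
  have Re_eq: "Re (cinner x (E B x)) = (norm (E B x))\<^sup>2" if "B \<in> sets borel" for B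
    using cinner_projection_operator[OF pvm_proj[OF that], of x] by simp
  have ca: "countably_additive (sets borel) ?f"
    unfolding countably_additive_def
  proof (intro allI impI)
    fix B :: "nat \<Rightarrow> real set"
    assume B: "range B \<subseteq> sets borel" "disjoint_family B" "(\<Union>i. B i) \<in> sets borel"
    have "(\<lambda>n. Re (cinner x (E (B n) x))) sums Re (cinner x (E (\<Union>i. B i) x))"
      by (intro sums_Re bounded_linear.sums[OF bounded_linear_cinner_right] pvm_sums B)
    moreover have "Re (cinner x (E (B n) x)) \<ge> 0" for n using B(1) by (subst Re_eq) auto
    ultimately show "(\<Sum>i. ?f (B i)) = ?f (\<Union>i. B i)"
      by (subst suminf_ennreal2) (auto simp: sums_summable sums_unique[symmetric])
  qed
  have "emeasure (scalar_measure E x) A = ?f A"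
  proof (rule emeasure_measure_of[OF scalar_measure_def])
    show "positive (sets (scalar_measure E x)) ?f"
      by (simp add: positive_def pvm_empty)
    show "countably_additive (sets (scalar_measure E x)) ?f" using ca by simp
  qed (use A in auto)
  then show ?thesis by (simp add: Re_eq[OF A])
qed

lemma measure_scalar_measure:
  "A \<in> sets borel \<Longrightarrow> measure (scalar_measure E x) A = (norm (E A x))\<^sup>2"
  by (simp add: measure_def emeasure_scalar_measure)

lemma finite_measure_scalar_measure: "finite_measure (scalar_measure E x)"
  by (rule finite_measureI) (simp add: emeasure_scalar_measure)

text \<open>Multiplicativity of \<open>E\<close> in terms of measures. It turns the domain and form
  conditions of \<open>spectral_measure_of\<close> at \<open>E A x\<close> into integrals over
  \<open>A\<close> at \<open>x\<close>.\<close>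

lemma scalar_measure_proj:
  assumes A: "A \<in> sets borel"
  shows "scalar_measure E (E A x) = density (scalar_measure E x) (\<lambda>t. ennreal (indicator A t))"
proof (rule measure_eqI)
  show "sets (scalar_measure E (E A x)) = sets (density (scalar_measure E x) (\<lambda>t. ennreal (indicator A t)))"
    by simp
  fix B assume "B \<in> sets (scalar_measure E (E A x))"
  then have B: "B \<in> sets borel" by simp
  have "emeasure (density (scalar_measure E x) (\<lambda>t. ennreal (indicator A t))) B
      = (\<integral>\<^sup>+t. indicator (B \<inter> A) t \<partial>scalar_measure E x)"
  proof (subst emeasure_density)
    show "(\<lambda>t. ennreal (indicator A t)) \<in> borel_measurable (scalar_measure E x)"
      using A by (simp add: measurable_cong_sets[OF sets_scalar_measure refl])
    show "B \<in> sets (scalar_measure E x)" using B by simp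
  qed (rule nn_integral_cong, simp split: split_indicator)
  also have "\<dots> = emeasure (scalar_measure E x) (B \<inter> A)"
    using A B by simp
  also have "\<dots> = emeasure (scalar_measure E (E A x)) B"
    using A B by (simp add: emeasure_scalar_measure pvm_Int)
  finally show "emeasure (scalar_measure E (E A x)) B
      = emeasure (density (scalar_measure E x) (\<lambda>t. ennreal (indicator A t))) B" ..
qed

lemma AE_scalar_measure_in:
  assumes A: "A \<in> sets borel" and u: "E A u = u"
  shows "AE t in scalar_measure E u. t \<in> A"
proof (rule AE_I[where N = "- A"])
  show "- A \<in> sets (scalar_measure E u)" using A by (simp add: borel_comp)
  show "emeasure (scalar_measure E u) (- A) = 0"
    using A u by (simp add: emeasure_scalar_measure borel_comp pvm_compl)
qed auto

end

section \<open>Spectral measures of selfadjoint operators\<close>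

context
  fixes H :: "'v::complex_inner operator" and E :: "real set \<Rightarrow> 'v \<Rightarrow> 'v"
  assumes H: "selfadjoint H" and S: "spectral_measure_of H E"
begin

lemma spectral_pvm: "projection_valued_measure E"
  using S by (simp add: spectral_measure_of_def)

lemma spectral_dom_iff: "x \<in> dom H \<longleftrightarrow> (\<integral>\<^sup>+t. ennreal (t\<^sup>2) \<partial>scalar_measure E x) < \<infinity>"
  using S by (simp add: spectral_measure_of_def)

lemma spectral_form: "x \<in> dom H \<Longrightarrow> cinner x (op_app H x) = complex_of_real (\<integral>t. t \<partial>scalar_measure E x)"
  using S by (simp add: spectral_measure_of_def)

lemma integrable_id_scalar_measure:
  assumes x: "x \<in> dom H"
  shows "integrable (scalar_measure E x) (\<lambda>t. t)"
proof -
  interpret finite_measure "scalar_measure E x" by (rule finite_measure_scalar_measure[OF spectral_pvm])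
  note [measurable_cong] = sets_scalar_measure[OF spectral_pvm, of x]
  have "integrable (scalar_measure E x) (\<lambda>t. t\<^sup>2)"
    using x unfolding spectral_dom_iff by (intro integrableI_nonneg) auto
  then have "integrable (scalar_measure E x) (\<lambda>t. 1 + t\<^sup>2)" by simp
  then show ?thesis
  proof (rule Bochner_Integration.integrable_bound)
    have "\<bar>t\<bar> \<le> 1 + t\<^sup>2" for t :: real
      using sum_squares_bound[of 1 "\<bar>t\<bar>"] by simp
    then show "AE t in scalar_measure E x. norm t \<le> norm (1 + t\<^sup>2)" by simp
  qed measurable
qed

lemma spectral_proj_dom:
  assumes A: "A \<in> sets borel" and x: "x \<in> dom H"
  shows "E A x \<in> dom H"
proof -
  note [measurable_cong] = sets_scalar_measure[OF spectral_pvm, of x] and [measurable] = A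
  have "(\<integral>\<^sup>+t. ennreal (t\<^sup>2) \<partial>scalar_measure E (E A x))
      = (\<integral>\<^sup>+t. ennreal (indicator A t) * ennreal (t\<^sup>2) \<partial>scalar_measure E x)"
    unfolding scalar_measure_proj[OF spectral_pvm A] using A by (subst nn_integral_density) auto
  also have "\<dots> \<le> (\<integral>\<^sup>+t. ennreal (t\<^sup>2) \<partial>scalar_measure E x)"
    by (intro nn_integral_mono) (auto split: split_indicator)
  finally show ?thesis using x unfolding spectral_dom_iff by (auto simp: less_le_trans le_less_trans)
qed

text \<open>The form is the integral of \<open>t\<close>, and the integral splits over
  \<open>A\<close> and its complement. The absence of cross terms is the source of all commutation
  between \<open>H\<close> and \<open>E\<close>.\<close>

lemma spectral_form_split:
  assumes A: "A \<in> sets borel" and x: "x \<in> dom H"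
  shows "cinner x (op_app H x)
    = cinner (E A x) (op_app H (E A x)) + cinner (E (- A) x) (op_app H (E (- A) x))"
proof -
  let ?\<mu> = "scalar_measure E x"
  note [measurable_cong] = sets_scalar_measure[OF spectral_pvm, of x]
  have B: "- A \<in> sets borel" using A by (simp add: borel_comp)
  have *: "(\<integral>t. t \<partial>scalar_measure E (E C x)) = (\<integral>t. indicator C t * t \<partial>?\<mu>)"
    if "C \<in> sets borel" for C
    unfolding scalar_measure_proj[OF spectral_pvm that] using that by (subst integral_density) auto
  have int: "integrable ?\<mu> (\<lambda>t. indicator C t * t)" if "C \<in> sets borel" for C
    using integrable_mult_indicator[OF _ integrable_id_scalar_measure[OF x], of C] that
    by (simp add: sets_scalar_measure[OF spectral_pvm])
  have "(\<integral>t. t \<partial>?\<mu>) = (\<integral>t. indicator A t * t + indicator (- A) t * t \<partial>?\<mu>)"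
    by (intro Bochner_Integration.integral_cong) (auto split: split_indicator)
  also have "\<dots> = (\<integral>t. indicator A t * t \<partial>?\<mu>) + (\<integral>t. indicator (- A) t * t \<partial>?\<mu>)"
    by (intro Bochner_Integration.integral_add int A B)
  finally show ?thesis
    using spectral_form x spectral_proj_dom[OF A x] spectral_proj_dom[OF B x] *[OF A] *[OF B] by simp
qed

text \<open>By \<open>spectral_form_split\<close> the form at \<open>x + z\<close> has no cross
  terms. These are complex conjugates of each other, so their common real part vanishes.\<close>

lemma spectral_orthogonal:
  assumes A: "A \<in> sets borel" and x: "x \<in> dom H" "y \<in> dom H" "E A x = x" "E (- A) y = y"
  shows "cinner x (op_app H y) = 0"
proof -
  have B: "- A \<in> sets borel" using A by (simp add: borel_comp)
  have re: "Re (cinner x (op_app H z)) = 0" if z: "z \<in> dom H" "E (- A) z = z" for z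
  proof -
    have "E A z = 0" "E (- A) x = 0"
      using pvm_compl[OF spectral_pvm A, of z] pvm_compl[OF spectral_pvm A, of x] z x by auto
    then have e: "E A (x + z) = x" "E (- A) (x + z) = z"
      using projection_operator_add[OF pvm_proj[OF spectral_pvm A], of x z]
        projection_operator_add[OF pvm_proj[OF spectral_pvm B], of x z] x z by auto
    have "cinner (x + z) (op_app H (x + z)) = cinner x (op_app H x) + cinner z (op_app H z)"
      using spectral_form_split[OF A selfadjoint_add_dom[OF H x(1) z(1)]] unfolding e .
    then have "cinner x (op_app H z) + cinner z (op_app H x) = 0"
      by (simp add: selfadjoint_add[OF H x(1) z(1)] cinner_simps add.commute)
    moreover have "cinner z (op_app H x) = cnj (cinner x (op_app H z))"
      using selfadjoint_symmetric[OF H z(1) x(1)] cinner_commute[of "op_app H z" x] by simp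
    ultimately show ?thesis by (simp add: complex_eq_iff)
  qed
  \<comment> \<open>Multiplying \<open>y\<close> by \<i> exchanges real and imaginary parts.\<close>
  have "Re (cinner x (op_app H (\<i> *\<^sub>C y))) = 0"
    using x by (intro re selfadjoint_scaleC_dom[OF H]) (simp_all add: projection_operator_scaleC[OF pvm_proj[OF spectral_pvm B]])
  then have "Im (cinner x (op_app H y)) = 0"
    by (simp add: selfadjoint_scaleC[OF H x(2)] cinner_simps)
  with re[OF x(2) x(4)] show ?thesis by (simp add: complex_eq_iff)
qed

text \<open>Orthogonality against the dense domain makes \<open>H\<close> block diagonal with
  respect to \<open>E A\<close> and \<open>E (- A)\<close>.\<close>

lemma spectral_commute:
  assumes A: "A \<in> sets borel" and x: "x \<in> dom H"
  shows "op_app H (E A x) = E A (op_app H x)"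
proof -
  have *: "E (- C) (op_app H (E C x)) = 0" if C: "C \<in> sets borel" for C
  proof (rule eq_0_if_orthogonal_dense[OF selfadjoint_dense[OF H]])
    fix u assume u: "u \<in> dom H"
    have B: "- C \<in> sets borel" using C by (simp add: borel_comp)
    have "cinner (E (- C) u) (op_app H (E C x)) = 0"
    proof (rule spectral_orthogonal[OF B])
      show "E (- C) (E (- C) u) = E (- C) u" by (rule projection_operator_idem[OF pvm_proj[OF spectral_pvm B]])
      show "E (- (- C)) (E C x) = E C x" using projection_operator_idem[OF pvm_proj[OF spectral_pvm C]] by simp
    qed (intro spectral_proj_dom B C u x)+
    then show "cinner u (E (- C) (op_app H (E C x))) = 0"
      by (simp add: projection_operator_symmetric[OF pvm_proj[OF spectral_pvm B]])
  qed
  have B: "- A \<in> sets borel" using A by (simp add: borel_comp)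
  have "x = E A x + E (- A) x" using pvm_compl[OF spectral_pvm A, of x] by simp
  then have "op_app H x = op_app H (E A x) + op_app H (E (- A) x)"
    using selfadjoint_add[OF H spectral_proj_dom[OF A x] spectral_proj_dom[OF B x]] by simp
  then have "E A (op_app H x) = E A (op_app H (E A x)) + E A (op_app H (E (- A) x))"
    by (simp add: projection_operator_add[OF pvm_proj[OF spectral_pvm A]])
  also have "E A (op_app H (E (- A) x)) = 0" using *[OF B] by simp
  also have "E A (op_app H (E A x)) = op_app H (E A x)"
    using *[OF A] pvm_compl[OF spectral_pvm A, of "op_app H (E A x)"] by simp
  finally show ?thesis by simp
qed

section \<open>Form and norm bounds on spectral subspaces\<close>

lemma spectral_proj_bounded_dom:
  assumes A: "A \<in> sets borel" "A \<subseteq> {a..b}" and u: "E A u = u"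
  shows "u \<in> dom H"
proof -
  \<comment> \<open>The sum dominates the squares of both endpoints, hence of every point between
    them, whatever their signs.\<close>
  let ?K = "a\<^sup>2 + b\<^sup>2"
  have K: "t\<^sup>2 \<le> ?K" if "t \<in> A" for t
  proof -
    have "a \<le> t" "t \<le> b" using A that by auto
    then have "\<bar>t\<bar> \<le> max \<bar>a\<bar> \<bar>b\<bar>" by (auto simp: max_def)
    then have "\<bar>t\<bar>\<^sup>2 \<le> (max \<bar>a\<bar> \<bar>b\<bar>)\<^sup>2" by (intro power_mono) auto
    also have "\<dots> \<le> ?K" by (auto simp: max_def)
    finally show ?thesis by simp
  qed
  have "AE t in scalar_measure E u. ennreal (t\<^sup>2) \<le> ennreal ?K"
    by (rule eventually_mono[OF AE_scalar_measure_in[OF spectral_pvm A(1) u]]) (rule ennreal_leI[OF K])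
  then have "(\<integral>\<^sup>+t. ennreal (t\<^sup>2) \<partial>scalar_measure E u) \<le> (\<integral>\<^sup>+t. ennreal ?K \<partial>scalar_measure E u)"
    by (rule nn_integral_mono_AE)
  also have "\<dots> < \<infinity>"
    using finite_measure.emeasure_finite[OF finite_measure_scalar_measure[OF spectral_pvm], of u UNIV]
    by (simp add: space_scalar_measure[OF spectral_pvm] ennreal_mult_less_top less_top)
  finally show ?thesis by (simp add: spectral_dom_iff)
qed

lemma
  assumes A: "A \<in> sets borel" and u: "E A u = u" "u \<in> dom H"
  shows spectral_form_le: "A \<subseteq> {..b} \<Longrightarrow> Re (cinner u (op_app H u)) \<le> b * (norm u)\<^sup>2"
    and spectral_form_ge: "A \<subseteq> {a..} \<Longrightarrow> a * (norm u)\<^sup>2 \<le> Re (cinner u (op_app H u))"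
proof -
  interpret finite_measure "scalar_measure E u" by (rule finite_measure_scalar_measure[OF spectral_pvm])
  have const: "(\<integral>t. c \<partial>scalar_measure E u) = c * (norm u)\<^sup>2" for c
    by (simp add: space_scalar_measure[OF spectral_pvm] measure_scalar_measure[OF spectral_pvm] pvm_UNIV[OF spectral_pvm])
  have ae: "AE t in scalar_measure E u. t \<in> A" by (rule AE_scalar_measure_in[OF spectral_pvm A u(1)])
  have form: "Re (cinner u (op_app H u)) = (\<integral>t. t \<partial>scalar_measure E u)"
    by (simp add: spectral_form[OF u(2)])
  {
    assume "A \<subseteq> {..b}"
    then have "AE t in scalar_measure E u. t \<le> b" using ae by (auto elim: eventually_mono)
    then have "(\<integral>t. t \<partial>scalar_measure E u) \<le> (\<integral>t. b \<partial>scalar_measure E u)"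
      by (intro integral_mono_AE integrable_id_scalar_measure u) auto
    then show "Re (cinner u (op_app H u)) \<le> b * (norm u)\<^sup>2" by (simp only: form const)
  }
  {
    assume "A \<subseteq> {a..}"
    then have "AE t in scalar_measure E u. a \<le> t" using ae by (auto elim: eventually_mono)
    then have "(\<integral>t. a \<partial>scalar_measure E u) \<le> (\<integral>t. t \<partial>scalar_measure E u)"
      by (intro integral_mono_AE integrable_id_scalar_measure u) auto
    then show "a * (norm u)\<^sup>2 \<le> Re (cinner u (op_app H u))" by (simp only: form const)
  }
qed

text \<open>The norm of a symmetric operator is governed by its quadratic form. The form of
  \<open>H - l\<close> on the range of \<open>E A\<close> is at most \<open>r\<close> in absolute
  value, and polarization converts this into a norm bound.\<close>

lemma norm_spectral_shift_le:
  assumes A: "A \<in> sets borel" "A \<subseteq> {l - r..l + r}" and u: "E A u = u"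
  shows "norm (op_app H u - complex_of_real l *\<^sub>C u) \<le> r * norm u"
proof -
  define f where "f = (\<lambda>v. op_app H v - complex_of_real l *\<^sub>C v)"
  have uD: "u \<in> dom H" by (rule spectral_proj_bounded_dom[OF A u])
  have P: "projection_operator (E A)" by (rule pvm_proj[OF spectral_pvm A(1)])
  have q: "\<bar>Re (cinner v (f v))\<bar> \<le> r * (norm v)\<^sup>2" if "E A v = v" for v
  proof -
    have vD: "v \<in> dom H" by (rule spectral_proj_bounded_dom[OF A that])
    have "A \<subseteq> {..l + r}" "A \<subseteq> {l - r..}" using A by auto
    then have "Re (cinner v (op_app H v)) \<le> (l + r) * (norm v)\<^sup>2"
      "(l - r) * (norm v)\<^sup>2 \<le> Re (cinner v (op_app H v))"
      using spectral_form_le[OF A(1) that vD] spectral_form_ge[OF A(1) that vD] by auto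
    then show ?thesis by (simp add: f_def cinner_simps cinner_self algebra_simps abs_le_iff)
  qed
  define y where "y = f u"
  have y: "E A y = y"
    unfolding y_def f_def
    using spectral_commute[OF A(1) uD] u
    by (simp add: projection_operator_diff[OF P] projection_operator_scaleC[OF P])
  show ?thesis
  proof (cases "y = 0 \<or> u = 0")
    case True
    then show ?thesis
    proof
      assume "y = 0"
      \<comment> \<open>The sign of \<open>r\<close> is not given; for nonzero \<open>u\<close> it
        follows from the form bound \<open>q\<close>.\<close>
      moreover have "0 \<le> r * norm u"
      proof (cases "u = 0")
        case False
        have "0 \<le> r * (norm u)\<^sup>2" using q[OF u] by linarith
        then show ?thesis using False by (simp add: zero_le_mult_iff)
      qed simp
      ultimately show ?thesis by (simp add: y_def f_def)
    next
      assume "u = 0"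
      then show ?thesis
        using selfadjoint_scaleC[OF H selfadjoint_zero_dom[OF H], of 0] by simp
    qed
  next
    case False
    \<comment> \<open>\<open>w\<close> is \<open>f u\<close> rescaled to the norm of
      \<open>u\<close>, so that the parallelogram law gives exactly
      \<open>4 * (norm u)\<^sup>2\<close>. It stays in the range of \<open>E A\<close> because
      \<open>H\<close> commutes with \<open>E A\<close>.\<close>
    define s where "s = norm u / norm y"
    define w where "w = complex_of_real s *\<^sub>C y"
    have s: "s > 0" using False by (simp add: s_def)
    have w: "E A w = w" by (simp add: w_def projection_operator_scaleC[OF P] y)
    have wD: "w \<in> dom H" by (rule spectral_proj_bounded_dom[OF A w])
    have "norm w = s * norm y" using s by (simp add: w_def norm_scaleC)
    then have nw: "norm w = norm u" using False by (simp add: s_def)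
    have fadd: "f (u + w) = f u + f w" "f (u - w) = f u - f w"
      by (simp_all add: f_def selfadjoint_add[OF H uD wD] selfadjoint_diff[OF H uD wD]
          scaleC_add_right scaleC_diff_right)
    have sym: "cinner (f u) w = cinner u (f w)"
      by (simp add: f_def cinner_simps selfadjoint_symmetric[OF H uD wD])
    have "Re (cinner u (f w)) = Re (cinner w (f u))"
      unfolding sym[symmetric] by (subst cinner_commute) simp
    then have pol: "Re (cinner (u + w) (f (u + w))) - Re (cinner (u - w) (f (u - w))) = 4 * Re (cinner w (f u))"
      unfolding fadd by (simp add: cinner_simps)
    have "E A (u + w) = u + w" "E A (u - w) = u - w"
      using u w by (simp_all add: projection_operator_add[OF P] projection_operator_diff[OF P])
    from this[THEN q] pol
    have "4 * Re (cinner w (f u)) \<le> r * (norm (u + w))\<^sup>2 + r * (norm (u - w))\<^sup>2" by linarith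
    also have "\<dots> = 4 * r * (norm u)\<^sup>2"
    proof -
      have "(norm (u + w))\<^sup>2 + (norm (u - w))\<^sup>2 = 2 * (norm u)\<^sup>2 + 2 * (norm w)\<^sup>2"
        by (simp add: power2_norm_eq_inner inner_simps inner_commute)
      then have "(norm (u + w))\<^sup>2 + (norm (u - w))\<^sup>2 = 4 * (norm u)\<^sup>2" by (simp add: nw)
      then show ?thesis by (simp add: distrib_left[symmetric])
    qed
    finally have "Re (cinner w (f u)) \<le> r * (norm u)\<^sup>2" by simp
    moreover have "Re (cinner w (f u)) = s * (norm y)\<^sup>2"
      unfolding y_def[symmetric] w_def by (simp add: cinner_scaleC_left cinner_self)
    ultimately have "norm u * norm y \<le> norm u * (r * norm u)"
      using False by (simp add: s_def power2_eq_square mult_ac)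
    then show ?thesis using False by (simp add: y_def f_def)
  qed
qed

text \<open>Pair \<open>(H - l) u\<close> with the reflected vector \<open>p - m\<close>, where
  \<open>p\<close> and \<open>m\<close> are the components of \<open>u\<close> above and below the
  gap. This imitates the sign of \<open>H - l\<close>: both components contribute positively, and
  reflection preserves the norm.\<close>

lemma norm_spectral_shift_ge:
  assumes A: "A \<in> sets borel" "A \<inter> {l - e<..<l + e} = {}" and u: "E A u = u" "u \<in> dom H"
  shows "e * norm u \<le> norm (op_app H u - complex_of_real l *\<^sub>C u)"
proof (cases "u = 0")
  case False
  define B where "B = {l + e..}"
  have B: "B \<in> sets borel" "- B \<in> sets borel" by (auto simp: B_def)
  define p where "p = E B u"
  define m where "m = E (- B) u"
  note PB = pvm_proj[OF spectral_pvm B(1)] and PC = pvm_proj[OF spectral_pvm B(2)]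
  have um: "u = p + m" using pvm_compl[OF spectral_pvm B(1), of u] by (simp add: p_def m_def)
  have pD: "p \<in> dom H" and mD: "m \<in> dom H"
    unfolding p_def m_def by (intro spectral_proj_dom B u)+
  have "E A p = p" "E A m = m"
    using u(1) pvm_Int[OF spectral_pvm A(1) B(1), of u] pvm_Int[OF spectral_pvm B(1) A(1), of u]
      pvm_Int[OF spectral_pvm A(1) B(2), of u] pvm_Int[OF spectral_pvm B(2) A(1), of u]
    by (simp_all add: p_def m_def Int_commute)
  then have p: "E (A \<inter> B) p = p" and m: "E (A - B) m = m"
    using pvm_Int[OF spectral_pvm A(1) B(1), of p] pvm_Int[OF spectral_pvm A(1) B(2), of m]
      projection_operator_idem[OF PB, of u] projection_operator_idem[OF PC, of u]
    by (simp_all add: p_def m_def Diff_eq)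
  have q1: "(l + e) * (norm p)\<^sup>2 \<le> Re (cinner p (op_app H p))"
    by (rule spectral_form_ge[OF _ p pD]) (use A B in \<open>auto simp: B_def\<close>)
  have "A - B \<subseteq> {..l - e}"
  proof
    fix t assume "t \<in> A - B"
    then have "t \<notin> {l - e<..<l + e}" "t < l + e" using A(2) by (auto simp: B_def)
    then show "t \<in> {..l - e}" by auto
  qed
  then have q2: "Re (cinner m (op_app H m)) \<le> (l - e) * (norm m)\<^sup>2"
    by (intro spectral_form_le[OF _ m mD]) (use A B in auto)
  have Ep: "E B p = p" unfolding p_def by (rule projection_operator_idem[OF PB])
  have Em: "E (- B) m = m" unfolding m_def by (rule projection_operator_idem[OF PC])
  have o1: "cinner p (op_app H m) = 0" by (rule spectral_orthogonal[OF B(1) pD mD Ep Em])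
  have o2: "cinner m (op_app H p) = 0"
    using spectral_orthogonal[OF B(2) mD pD Em] Ep by simp
  have o3: "cinner p m = 0"
    using projection_operator_symmetric[OF PB, of p m] Ep pvm_compl[OF spectral_pvm B(1), of m] Em by simp
  then have o4: "cinner m p = 0" using cinner_commute[of m p] by simp
  have n1: "(norm u)\<^sup>2 = (norm p)\<^sup>2 + (norm m)\<^sup>2"
    unfolding um by (rule norm_sum_orthogonal[OF o3])
  have n2: "(norm (p - m))\<^sup>2 = (norm p)\<^sup>2 + (norm m)\<^sup>2"
    using norm_sum_orthogonal[of p "- m"] o3 by (simp add: cinner_minus_right)
  have "norm (p - m) = norm u" using n1 n2 by (metis norm_ge_zero power2_eq_imp_eq)
  \<comment> \<open>The cross terms vanish by \<open>o1\<close> to \<open>o4\<close>; the minus sign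
    makes the component below the gap contribute at least
    \<open>e * (norm m)\<^sup>2\<close>.\<close>
  have "Re (cinner (p - m) (op_app H u - complex_of_real l *\<^sub>C u))
      = Re (cinner p (op_app H p)) - l * (norm p)\<^sup>2 - (Re (cinner m (op_app H m)) - l * (norm m)\<^sup>2)"
    unfolding um selfadjoint_add[OF H pD mD]
    by (simp add: cinner_simps o1 o2 o3 o4 cinner_self algebra_simps)
  then have "e * (norm u)\<^sup>2 \<le> Re (cinner (p - m) (op_app H u - complex_of_real l *\<^sub>C u))"
    using q1 q2 unfolding n1 by (simp add: algebra_simps)
  also have "\<dots> \<le> norm (p - m) * norm (op_app H u - complex_of_real l *\<^sub>C u)"
    using complex_Re_le_cmod cmod_cinner_le order_trans by blast
  finally have "norm u * (e * norm u) \<le> norm u * norm (op_app H u - complex_of_real l *\<^sub>C u)"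
    unfolding \<open>norm (p - m) = norm u\<close> by (simp add: power2_eq_square mult_ac)
  then show ?thesis using False by simp
qed simp

end

section \<open>Resolvents and spectral measures\<close>

lemma cmod_resolvent_kernel_le:
  assumes "z \<notin> \<real>"
  shows "cmod (1 / (complex_of_real t - z)) \<le> 1 / \<bar>Im z\<bar>"
proof -
  have "\<bar>Im z\<bar> \<le> cmod (complex_of_real t - z)"
    using abs_Im_le_cmod[of "complex_of_real t - z"] by simp
  then show ?thesis using assms by (simp add: norm_divide complex_is_Real_iff frac_le)
qed

lemma cmod_resolvent_kernel_diff_le:
  assumes z: "z \<notin> \<real>"
  shows "cmod (1 / (complex_of_real s - z) - 1 / (complex_of_real t - z)) \<le> \<bar>s - t\<bar> / \<bar>Im z\<bar>\<^sup>2"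
proof -
  have nz: "complex_of_real r - z \<noteq> 0" for r using z by auto
  have "1 / (complex_of_real s - z) - 1 / (complex_of_real t - z)
      = complex_of_real (t - s) * (1 / (complex_of_real s - z)) * (1 / (complex_of_real t - z))"
    using nz[of s] nz[of t] by (simp add: divide_simps)
  then have "cmod (1 / (complex_of_real s - z) - 1 / (complex_of_real t - z))
      = \<bar>s - t\<bar> * (cmod (1 / (complex_of_real s - z)) * cmod (1 / (complex_of_real t - z)))"
    by (simp only: norm_mult norm_of_real) (simp add: abs_minus_commute)
  also have "\<dots> \<le> \<bar>s - t\<bar> * (1 / \<bar>Im z\<bar> * (1 / \<bar>Im z\<bar>))"
    by (intro mult_left_mono mult_mono cmod_resolvent_kernel_le z) auto
  finally show ?thesis by (simp add: power2_eq_square)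
qed

lemma borel_measurable_resolvent_kernel:
  assumes "z \<notin> \<real>"
  shows "(\<lambda>t. 1 / (complex_of_real t - z)) \<in> borel_measurable borel"
  using assms by (intro borel_measurable_continuous_onI continuous_intros) auto

text \<open>On the spectral subspace of an interval of length \<open>h\<close> the resolvent is multiplication
  by a constant up to an error of order \<open>h\<close>; orthogonality of the pieces makes the errors add up
  to \<open>O(h)\<close>.\<close>

lemma cinner_resolvent:
  fixes H :: "'v::{complex_inner, complete_space} operator"
  assumes H: "selfadjoint H" and S: "spectral_measure_of H E" and z: "z \<notin> \<real>"
  shows "cinner y (resolvent H z y) = (\<integral>t. 1 / (complex_of_real t - z) \<partial>scalar_measure E y)"
proof -
  note E = spectral_pvm[OF H S]
  define d where "d = \<bar>Im z\<bar>"
  have d: "d > 0" using z by (simp add: d_def complex_is_Real_iff)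
  define u where "u = resolvent H z y"
  have uD: "u \<in> dom H" and uy: "op_app H u - z *\<^sub>C u = y"
    unfolding u_def by (rule resolvent_nonreal[OF H z])+
  define f where "f = (\<lambda>t. 1 / (complex_of_real t - z))"
  let ?\<mu> = "scalar_measure E y"
  interpret finite_measure ?\<mu> by (rule finite_measure_scalar_measure[OF E])
  note [measurable_cong] = sets_scalar_measure[OF E, of y]
  have f_meas [measurable]: "f \<in> borel_measurable ?\<mu>"
    using borel_measurable_resolvent_kernel[OF z] unfolding f_def by measurable
  have f_le: "cmod (f t) \<le> 1 / d" for t
    unfolding f_def d_def by (rule cmod_resolvent_kernel_le[OF z])
  have f_int: "integrable ?\<mu> f"
    by (rule integrable_const_bound[of _ "1 / d"]) (auto simp: f_le)
  have bound: "cmod (cinner y u - (\<integral>t. f t \<partial>?\<mu>)) \<le> 2 * (norm y)\<^sup>2 / d\<^sup>2 * h" if h: "h > 0" for h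
  proof -
    \<comment> \<open>The cells of a grid of mesh \<open>h\<close> are indexed by integers;
      \<open>int_decode\<close> enumerates them by natural numbers, as countable additivity of
      \<open>E\<close> requires.\<close>
    define t where "t k = h * real_of_int (int_decode k)" for k
    define A where "A k = {t k..<t k + h}" for k
    have A: "A k \<in> sets borel" for k by (simp add: A_def)
    have A_iff: "x \<in> A k \<longleftrightarrow> \<lfloor>x / h\<rfloor> = int_decode k" for x k
      using h by (auto simp: A_def t_def floor_eq_iff field_simps)
    have disj: "A i \<inter> A j = {}" if "i \<noteq> j" for i j
      using that by (auto simp: A_iff int_decode_eq)
    then have dA: "disjoint_family A" by (auto simp: disjoint_family_on_def)
    have UA: "(\<Union>k. A k) = UNIV"
    proof (intro set_eqI iffI)
      fix x :: real
      have "x \<in> A (int_encode \<lfloor>x / h\<rfloor>)" by (simp add: A_iff)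
      then show "x \<in> (\<Union>k. A k)" by blast
    qed simp
    note P = pvm_proj[OF E A]
    define a where "a k = cinner (E (A k) y) (E (A k) u)" for k
    define b where "b k = (\<integral>s. indicator (A k) s *\<^sub>R f s \<partial>?\<mu>)" for k
    have E_sums: "(\<lambda>k. E (A k) x) sums x" for x
      using pvm_sums[OF E _ dA, of x] A unfolding UA pvm_UNIV[OF E] by auto
    have a_sums: "a sums cinner y u"
    proof -
      have "(\<lambda>k. cinner y (E (A k) u)) sums cinner y u"
        by (rule bounded_linear.sums[OF bounded_linear_cinner_right E_sums])
      then show ?thesis
        unfolding a_def by (simp add: projection_operator_symmetric[OF P] projection_operator_idem[OF P])
    qed
    have y_sums: "(\<lambda>k. (norm (E (A k) y))\<^sup>2) sums (norm y)\<^sup>2"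
    proof -
      have "(\<lambda>k. Re (cinner y (E (A k) y))) sums Re (cinner y y)"
        by (intro sums_Re bounded_linear.sums[OF bounded_linear_cinner_right E_sums])
      then show ?thesis by (simp add: cinner_projection_operator[OF P] cinner_self)
    qed
    have b_sum: "(\<integral>s. f s \<partial>?\<mu>) = (\<Sum>k. b k)"
      using lebesgue_integral_countable_add[of A ?\<mu> f] disj A f_int
      by (simp add: UA b_def set_lebesgue_integral_def set_integrable_def sets_scalar_measure[OF E])
    \<comment> \<open>On a cell \<open>H\<close> is close to \<open>t k\<close>, so
      \<open>(H - z) ?u = ?y\<close> makes \<open>?u\<close> close to
      \<open>f (t k) *\<^sub>C ?y\<close>. The error carries \<open>h\<close> and two factors
      \<open>1 / d\<close>, one from the kernel and one from
      \<open>norm ?u \<le> norm ?y / d\<close>.\<close>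
    have a_le: "cmod (a k - complex_of_real ((norm (E (A k) y))\<^sup>2) * f (t k)) \<le> h / d\<^sup>2 * (norm (E (A k) y))\<^sup>2" for k
    proof -
      let ?y = "E (A k) y" and ?u = "E (A k) u"
      have uk: "?u \<in> dom H" by (rule spectral_proj_dom[OF H S A uD])
      have yk: "op_app H ?u - z *\<^sub>C ?u = ?y"
        unfolding uy[symmetric] spectral_commute[OF H S A uD]
        by (simp add: projection_operator_diff[OF P] projection_operator_scaleC[OF P])
      define r where "r = op_app H ?u - complex_of_real (t k) *\<^sub>C ?u"
      have "A k \<subseteq> {t k - h..t k + h}" using h by (auto simp: A_def)
      then have r: "norm r \<le> h * norm ?u"
        unfolding r_def by (rule norm_spectral_shift_le[OF H S A _ projection_operator_idem[OF P]])
      have du: "norm ?u \<le> norm ?y / d"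
        using norm_shift_nonreal[OF H uk, of z] d unfolding yk by (simp add: d_def field_simps)
      have nz: "complex_of_real (t k) - z \<noteq> 0" using z by auto
      have "?y = r + (complex_of_real (t k) - z) *\<^sub>C ?u"
        unfolding r_def yk[symmetric] by (simp add: scaleC_diff_left)
      then have "f (t k) *\<^sub>C ?y = f (t k) *\<^sub>C r + ?u"
        using nz by (simp add: scaleC_add_right scaleC_scaleC f_def)
      then have "?u - f (t k) *\<^sub>C ?y = - (f (t k) *\<^sub>C r)" by simp
      moreover have "a k - complex_of_real ((norm ?y)\<^sup>2) * f (t k) = cinner ?y (?u - f (t k) *\<^sub>C ?y)"
        by (simp add: a_def cinner_simps cinner_self)
      ultimately have "cmod (a k - complex_of_real ((norm ?y)\<^sup>2) * f (t k)) \<le> norm ?y * (cmod (f (t k)) * norm r)"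
        using cmod_cinner_le[of ?y "- (f (t k) *\<^sub>C r)"] by (simp add: norm_scaleC)
      also have "\<dots> \<le> norm ?y * (1 / d * (h * (norm ?y / d)))"
        using r du h d by (intro mult_left_mono mult_mono f_le order_trans[OF r]) auto
      finally show ?thesis by (simp add: power2_eq_square mult_ac)
    qed
    \<comment> \<open>The integral over the cell is compared with the same reference value, now by
      the Lipschitz bound for the kernel.\<close>
    have b_le: "cmod (b k - complex_of_real ((norm (E (A k) y))\<^sup>2) * f (t k)) \<le> h / d\<^sup>2 * (norm (E (A k) y))\<^sup>2" for k
    proof -
      have Ak: "A k \<in> sets ?\<mu>" using A sets_scalar_measure[OF E] by simp
      have m: "measure ?\<mu> (A k) = (norm (E (A k) y))\<^sup>2" by (rule measure_scalar_measure[OF E A])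
      have i1: "integrable ?\<mu> (\<lambda>s. indicator (A k) s *\<^sub>R f s)"
        by (rule integrable_mult_indicator[OF Ak f_int])
      have i2: "integrable ?\<mu> (\<lambda>s. indicator (A k) s *\<^sub>R f (t k))"
        by (rule integrable_mult_indicator[OF Ak]) simp
      have "(\<integral>s. indicator (A k) s *\<^sub>R f (t k) \<partial>?\<mu>) = complex_of_real ((norm (E (A k) y))\<^sup>2) * f (t k)"
        using Ak by (simp add: m scaleR_conv_of_real)
      then have "b k - complex_of_real ((norm (E (A k) y))\<^sup>2) * f (t k)
          = (\<integral>s. indicator (A k) s *\<^sub>R f s - indicator (A k) s *\<^sub>R f (t k) \<partial>?\<mu>)"
        unfolding b_def by (simp add: Bochner_Integration.integral_diff[OF i1 i2])
      also have "cmod \<dots> \<le> (\<integral>s. indicator (A k) s * (h / d\<^sup>2) \<partial>?\<mu>)"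
      proof (rule order_trans[OF integral_norm_bound integral_mono])
        show "integrable ?\<mu> (\<lambda>s. norm (indicator (A k) s *\<^sub>R f s - indicator (A k) s *\<^sub>R f (t k)))"
          by (intro integrable_norm Bochner_Integration.integrable_diff i1 i2)
        show "integrable ?\<mu> (\<lambda>s. indicator (A k) s * (h / d\<^sup>2))"
          by (intro integrable_mult_left integrable_real_indicator)
            (simp_all add: Ak emeasure_scalar_measure[OF E A])
        fix s
        show "norm (indicator (A k) s *\<^sub>R f s - indicator (A k) s *\<^sub>R f (t k)) \<le> indicator (A k) s * (h / d\<^sup>2)"
        proof (cases "s \<in> A k")
          case True
          then have "\<bar>s - t k\<bar> \<le> h" by (auto simp: A_def)
          then have "\<bar>s - t k\<bar> / \<bar>Im z\<bar>\<^sup>2 \<le> h / d\<^sup>2" unfolding d_def by (intro divide_right_mono) auto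
          with cmod_resolvent_kernel_diff_le[OF z, of s "t k"] True show ?thesis by (simp add: f_def)
        qed simp
      qed
      also have "\<dots> = h / d\<^sup>2 * (norm (E (A k) y))\<^sup>2" using Ak by (simp add: m)
      finally show ?thesis .
    qed
    have ab: "norm (a k - b k) \<le> 2 * h / d\<^sup>2 * (norm (E (A k) y))\<^sup>2" for k
    proof -
      let ?q = "complex_of_real ((norm (E (A k) y))\<^sup>2) * f (t k)"
      have "norm (a k - b k) \<le> norm (a k - ?q) + norm (b k - ?q)"
        using norm_triangle_ineq4[of "a k - ?q" "b k - ?q"] by simp
      also have "\<dots> \<le> h / d\<^sup>2 * (norm (E (A k) y))\<^sup>2 + h / d\<^sup>2 * (norm (E (A k) y))\<^sup>2"
        by (intro add_mono a_le b_le)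
      finally show ?thesis by simp
    qed
    have g: "(\<lambda>k. 2 * h / d\<^sup>2 * (norm (E (A k) y))\<^sup>2) sums (2 * h / d\<^sup>2 * (norm y)\<^sup>2)"
      by (rule sums_mult[OF y_sums])
    have ab_sum: "summable (\<lambda>k. a k - b k)"
      by (rule summable_comparison_test'[OF sums_summable[OF g]]) (rule ab)
    have "summable b"
      using summable_diff[OF sums_summable[OF a_sums] ab_sum] by simp
    then have "(\<Sum>k. a k - b k) = cinner y u - (\<integral>s. f s \<partial>?\<mu>)"
      using suminf_diff[OF sums_summable[OF a_sums], of b] sums_unique[OF a_sums] b_sum by simp
    moreover have "norm (\<Sum>k. a k - b k) \<le> 2 * h / d\<^sup>2 * (norm y)\<^sup>2"
      using norm_suminf_le[OF ab sums_summable[OF g]] sums_unique[OF g] by simp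
    ultimately show ?thesis by (simp add: mult_ac)
  qed
  have "cmod (cinner y u - (\<integral>t. f t \<partial>?\<mu>)) \<le> 0"
  proof (rule field_le_epsilon)
    fix e :: real assume e: "0 < e"
    define K where "K = 2 * (norm y)\<^sup>2 / d\<^sup>2"
    have K: "0 \<le> K" by (simp add: K_def)
    \<comment> \<open>This is the mesh that makes the error at most \<open>e\<close>; the added 1
      covers \<open>K = 0\<close>, that is \<open>y = 0\<close>.\<close>
    have "0 < e / (K + 1)" using e K by simp
    from bound[OF this] have "cmod (cinner y u - (\<integral>t. f t \<partial>?\<mu>)) \<le> K * (e / (K + 1))"
      by (simp only: K_def)
    also have "\<dots> \<le> 0 + e" using e K by (simp add: field_simps)
    finally show "cmod (cinner y u - (\<integral>t. f t \<partial>?\<mu>)) \<le> 0 + e" .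
  qed
  then show ?thesis by (simp add: u_def f_def)
qed

section \<open>From resolvent kernels to measures of Borel sets\<close>

lemma cmod_inverse_nonreal_le:
  assumes c: "c \<notin> \<real>"
  shows "cmod (1 / (1 - c * complex_of_real v)) \<le> cmod c / \<bar>Im c\<bar>"
proof -
  have c0: "c \<noteq> 0" using c by auto
  have ic: "1 / c \<notin> \<real>" using c Reals_divide[of 1 "1 / c"] by auto
  \<comment> \<open>The function is a multiple of the resolvent kernel at the nonreal point
    \<open>1 / c\<close>.\<close>
  have "1 / (1 - c * complex_of_real v) = (- 1 / c) * (1 / (complex_of_real v - 1 / c))"
  proof -
    have "complex_of_real v - 1 / c \<noteq> 0" using ic by (metis eq_iff_diff_eq_0 Reals_of_real)
    moreover have "1 - c * complex_of_real v = - c * (complex_of_real v - 1 / c)"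
      using c0 by (simp add: algebra_simps)
    ultimately show ?thesis using c0 by simp
  qed
  then have "cmod (1 / (1 - c * complex_of_real v)) = 1 / cmod c * cmod (1 / (complex_of_real v - 1 / c))"
    by (simp only: norm_mult norm_divide norm_minus_cancel norm_one)
  also have "\<dots> \<le> 1 / cmod c * (1 / \<bar>Im (1 / c)\<bar>)"
    by (intro mult_left_mono cmod_resolvent_kernel_le ic) auto
  also have "\<bar>Im (1 / c)\<bar> = \<bar>Im c\<bar> / (cmod c)\<^sup>2"
    by (simp add: Im_divide cmod_power2 abs_of_nonneg)
  also have "1 / cmod c * (1 / (\<bar>Im c\<bar> / (cmod c)\<^sup>2)) = cmod c / \<bar>Im c\<bar>"
    using c0 by (simp add: power2_eq_square)
  finally show ?thesis .
qed

lemma one_minus_nonreal_nonzero: "c \<notin> \<real> \<Longrightarrow> 1 - c * complex_of_real v \<noteq> 0"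
proof
  assume c: "c \<notin> \<real>" and "1 - c * complex_of_real v = 0"
  then have "c * complex_of_real v = 1" by simp
  then have "c = 1 / complex_of_real v" by (metis mult_zero_right nonzero_eq_divide_eq zero_neq_one)
  then show False using c by (metis Reals_1 Reals_divide Reals_of_real)
qed

text \<open>With the fixed radius \<open>r\<close> the limit at the endpoints would be 1/2. The
  radii \<open>r / (1 + (2 / 3) ^ k)\<close> increase to \<open>r\<close>, fast enough to keep all
  interior points and slowly enough for the powers at the endpoints to diverge.\<close>

lemma tendsto_indicator_interval:
  fixes x r t :: real
  assumes r: "r > 0"
  shows "(\<lambda>k. 1 / (1 + ((t - x) / (r / (1 + (2 / 3) ^ k))) ^ (2 ^ Suc k))) \<longlonglongrightarrow> indicator {x - r<..<x + r} t"
proof -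
  define p :: "nat \<Rightarrow> real" where "p k = 1 + (2 / 3) ^ k" for k
  \<comment> \<open>The two cases are \<open>q < 1\<close>, the open interval, and
    \<open>q \<ge> 1\<close>, which includes the endpoints.\<close>
  define q where "q = \<bar>t - x\<bar> / r"
  have q0: "q \<ge> 0" using r by (simp add: q_def)
  have p1: "p k \<ge> 1" for k by (simp add: p_def)
  have u: "((t - x) / (r / (1 + (2 / 3) ^ k))) ^ (2 ^ Suc k) = (p k * q) ^ (2 ^ Suc k)" for k
  proof -
    have "\<bar>(t - x) / (r / (1 + (2 / 3) ^ k))\<bar> = p k * q"
      using r p1[of k] by (simp add: p_def q_def abs_mult abs_divide)
    then show ?thesis by (metis even_Suc_Suc_iff even_numeral even_power power_even_abs zero_less_Suc)
  qed
  show ?thesis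
  proof (cases "q < 1")
    case True
    then have "t \<in> {x - r<..<x + r}" using r by (auto simp: q_def abs_less_iff)
    moreover have "(\<lambda>k. (p k * q) ^ (2 ^ Suc k)) \<longlonglongrightarrow> 0"
    proof (rule tendsto_sandwich[of "\<lambda>_. 0" _ _ "\<lambda>k. ((1 + q) / 2) ^ k"])
      \<comment> \<open>Since \<open>p k * q\<close> tends to \<open>q\<close>, it is eventually
        below the midpoint of \<open>q\<close> and 1, which is itself less than 1.\<close>
      have "(\<lambda>k. p k * q) \<longlonglongrightarrow> (1 + 0) * q"
        unfolding p_def by (intro tendsto_intros LIMSEQ_realpow_zero) auto
      then have "\<forall>\<^sub>F k in sequentially. p k * q < (1 + q) / 2" using True by (intro order_tendstoD) auto
      then show "\<forall>\<^sub>F k in sequentially. (p k * q) ^ (2 ^ Suc k) \<le> ((1 + q) / 2) ^ k"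
      proof eventually_elim
        case (elim k)
        have "(p k * q) ^ (2 ^ Suc k) \<le> ((1 + q) / 2) ^ (2 ^ Suc k)"
          using elim p1[of k] q0 by (intro power_mono) auto
        also have "\<dots> \<le> ((1 + q) / 2) ^ k"
          using True q0 less_exp[of "Suc k"] by (intro power_decreasing) auto
        finally show ?case .
      qed
      show "(\<lambda>k. ((1 + q) / 2) ^ k) \<longlonglongrightarrow> 0" using True q0 by (intro LIMSEQ_realpow_zero) auto
      show "\<forall>\<^sub>F k in sequentially. 0 \<le> (p k * q) ^ (2 ^ Suc k)"
        using p1 q0 by (intro always_eventually allI zero_le_power mult_nonneg_nonneg) (auto intro: order_trans[of 0 1])
    qed auto
    then have "(\<lambda>k. 1 / (1 + (p k * q) ^ (2 ^ Suc k))) \<longlonglongrightarrow> 1 / (1 + 0)"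
      by (intro tendsto_intros) auto
    ultimately show ?thesis unfolding u by simp
  next
    case False
    then have "t \<notin> {x - r<..<x + r}" using r by (auto simp: q_def field_simps abs_le_iff)
    moreover have "(\<lambda>k. 1 / (1 + (p k * q) ^ (2 ^ Suc k))) \<longlonglongrightarrow> 0"
    proof (rule tendsto_sandwich[of "\<lambda>_. 0" _ _ "\<lambda>k. (3 / 4) ^ k"])
      \<comment> \<open>Bernoulli's inequality: the exponent doubles while the excess
        \<open>p k - 1\<close> shrinks only by the factor 2/3, a net growth rate of 4/3.\<close>
      have *: "(4 / 3) ^ k \<le> 1 + (p k * q) ^ (2 ^ Suc k)" for k
      proof -
        have "(4 / 3) ^ k = 2 ^ k * (2 / 3 :: real) ^ k" by (simp flip: power_mult_distrib)
        also have "\<dots> \<le> 1 + real (2 ^ Suc k) * (2 / 3) ^ k" by (simp add: mult_right_mono)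
        also have "\<dots> \<le> p k ^ (2 ^ Suc k)"
          unfolding p_def by (rule Bernoulli_inequality) (simp add: order_trans[of "-1" 0])
        also have "\<dots> \<le> (p k * q) ^ (2 ^ Suc k)"
          using False p1[of k] mult_left_mono[of 1 q "p k"] by (intro power_mono) auto
        finally show ?thesis by simp
      qed
      show "\<forall>\<^sub>F k in sequentially. 1 / (1 + (p k * q) ^ (2 ^ Suc k)) \<le> (3 / 4) ^ k"
      proof (intro always_eventually allI)
        fix k
        have "1 / (1 + (p k * q) ^ (2 ^ Suc k)) \<le> 1 / (4 / 3) ^ k"
          by (rule frac_le[OF _ _ _ *]) auto
        also have "\<dots> = (3 / 4) ^ k" by (simp add: power_divide)
        finally show "1 / (1 + (p k * q) ^ (2 ^ Suc k)) \<le> (3 / 4) ^ k" .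
      qed
      show "(\<lambda>k. (3 / 4 :: real) ^ k) \<longlonglongrightarrow> 0" by (intro LIMSEQ_realpow_zero) auto
      show "\<forall>\<^sub>F k in sequentially. 0 \<le> 1 / (1 + (p k * q) ^ (2 ^ Suc k))"
      proof (intro always_eventually allI)
        fix k
        have "0 < (4 / 3 :: real) ^ k" by simp
        then show "0 \<le> 1 / (1 + (p k * q) ^ (2 ^ Suc k))" using *[of k] by simp
      qed
    qed auto
    ultimately show ?thesis unfolding u by simp
  qed
qed

text \<open>Since \<open>1 / (1 - w\<^sup>2)\<close> is the average of \<open>1 / (1 - w)\<close> and \<open>1 / (1 + w)\<close>, the
  resolvent kernels determine the integrals of \<open>1 / (1 + ((t - x) / a)\<^sup>N)\<close> for \<open>N = 2\<^sup>m\<close>, \<open>m \<ge> 1\<close>,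
  and these functions approximate indicator functions of intervals.\<close>

context
  fixes N :: "'a measure" and \<mu> :: "'a \<Rightarrow> real measure"
  assumes fin: "\<And>\<omega>. \<omega> \<in> space N \<Longrightarrow> finite_measure (\<mu> \<omega>)"
    and sets_\<mu>: "\<And>\<omega>. \<omega> \<in> space N \<Longrightarrow> sets (\<mu> \<omega>) = sets borel"
    and meas: "\<And>z. z \<notin> \<real> \<Longrightarrow> (\<lambda>\<omega>. \<integral>t. 1 / (complex_of_real t - z) \<partial>\<mu> \<omega>) \<in> borel_measurable N"
begin

lemma integrable_inverse_nonreal:
  assumes \<omega>: "\<omega> \<in> space N" and c: "c \<notin> \<real>"
  shows "integrable (\<mu> \<omega>) (\<lambda>t. 1 / (1 - c * complex_of_real (((t - x) / a) ^ k)))"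
proof -
  interpret finite_measure "\<mu> \<omega>" by (rule fin[OF \<omega>])
  note [measurable_cong] = sets_\<mu>[OF \<omega>]
  show ?thesis
    by (rule integrable_const_bound[of _ "cmod c / \<bar>Im c\<bar>"]) (auto simp only: cmod_inverse_nonreal_le[OF c] eventually_True, measurable)
qed

text \<open>The induction covers all nonreal \<open>c\<close> at once, because its step passes from
  \<open>c\<close> to the square roots \<open>s\<close> and \<open>- s\<close>; these are nonreal
  since squares of reals are real.\<close>

lemma measurable_integral_inverse_power:
  assumes a: "a > 0" and c: "c \<notin> \<real>"
  shows "(\<lambda>\<omega>. \<integral>t. 1 / (1 - c * complex_of_real (((t - x) / a) ^ (2 ^ m))) \<partial>\<mu> \<omega>) \<in> borel_measurable N"
  using c
proof (induction m arbitrary: c)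
  case 0
  \<comment> \<open>\<open>z\<close> is the pole of the integrand in \<open>t\<close>, which is
    therefore a multiple of the resolvent kernel at \<open>z\<close>.\<close>
  define z where "z = complex_of_real x + complex_of_real a / c"
  have c0: "c \<noteq> 0" using 0 by auto
  have z: "z \<notin> \<real>"
  proof
    assume "z \<in> \<real>"
    then have "z - complex_of_real x \<in> \<real>" by simp
    then have "complex_of_real a / c \<in> \<real>" by (simp add: z_def)
    then have "complex_of_real a / (complex_of_real a / c) \<in> \<real>"
      by (rule Reals_divide[OF Reals_of_real])
    then show False using 0 a by simp
  qed
  have "1 / (1 - c * complex_of_real (((t - x) / a) ^ (2 ^ 0)))
      = - (complex_of_real a / c) * (1 / (complex_of_real t - z))" for t
  proof -
    have eq: "1 - c * complex_of_real (((t - x) / a) ^ (2 ^ 0)) = - (c / complex_of_real a) * (complex_of_real t - z)"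
      using c0 a by (simp add: z_def field_simps)
    have "complex_of_real t - z \<noteq> 0" using z by auto
    then show ?thesis unfolding eq using c0 a by simp
  qed
  then have "(\<lambda>\<omega>. \<integral>t. 1 / (1 - c * complex_of_real (((t - x) / a) ^ (2 ^ 0))) \<partial>\<mu> \<omega>)
      = (\<lambda>\<omega>. - (complex_of_real a / c) * (\<integral>t. 1 / (complex_of_real t - z) \<partial>\<mu> \<omega>))"
    by (simp only: integral_mult_right_zero)
  also have "\<dots> \<in> borel_measurable N"
    by (intro borel_measurable_times borel_measurable_const meas z)
  finally show ?case .
next
  case (Suc m)
  define s where "s = csqrt c"
  have s2: "s * s = c" using power2_csqrt[of c] by (simp add: s_def power2_eq_square)
  have s: "s \<notin> \<real>" using Suc.prems s2 Reals_mult by metis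
  then have ms: "- s \<notin> \<real>" by simp
  define g where "g c t = 1 / (1 - c * complex_of_real (((t - x) / a) ^ (2 ^ m)))" for c t
  have split: "1 / (1 - c * complex_of_real (((t - x) / a) ^ (2 ^ Suc m))) = (1 / 2) * (g s t + g (- s) t)" for t
  proof -
    define w where "w = complex_of_real (((t - x) / a) ^ (2 ^ m))"
    have "complex_of_real (((t - x) / a) ^ (2 ^ Suc m)) = w * w"
      by (simp only: w_def power_Suc mult_2 power_add of_real_mult)
    then have eq: "1 - c * complex_of_real (((t - x) / a) ^ (2 ^ Suc m)) = (1 - s * w) * (1 - (- s) * w)"
      by (simp add: s2[symmetric] algebra_simps)
    have "1 - s * w \<noteq> 0" "1 - (- s) * w \<noteq> 0"
      unfolding w_def by (rule one_minus_nonreal_nonzero; fact)+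
    then show ?thesis unfolding eq g_def w_def[symmetric] by (simp add: divide_simps)
  qed
  have "(\<integral>t. 1 / (1 - c * complex_of_real (((t - x) / a) ^ (2 ^ Suc m))) \<partial>\<mu> \<omega>)
      = (1 / 2) * ((\<integral>t. g s t \<partial>\<mu> \<omega>) + (\<integral>t. g (- s) t \<partial>\<mu> \<omega>))" if "\<omega> \<in> space N" for \<omega>
    unfolding split integral_mult_right_zero g_def
    by (subst Bochner_Integration.integral_add) (intro integrable_inverse_nonreal that s ms refl)+
  moreover have "(\<lambda>\<omega>. (1 / 2) * ((\<integral>t. g s t \<partial>\<mu> \<omega>) + (\<integral>t. g (- s) t \<partial>\<mu> \<omega>))) \<in> borel_measurable N"
    unfolding g_def by (intro borel_measurable_times borel_measurable_const borel_measurable_add Suc.IH s ms)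
  ultimately show ?case by (subst measurable_cong) auto
qed

text \<open>The value \<open>c = - 1\<close> is real and so outside
  \<open>measurable_integral_inverse_power\<close>, but its square roots \<i> and
  \<open>- \<i>\<close> are nonreal. One more splitting step with them produces the exponent
  \<open>2 ^ Suc m\<close>.\<close>

lemma measurable_integral_even_power:
  assumes a: "a > 0"
  shows "(\<lambda>\<omega>. \<integral>t. 1 / (1 + ((t - x) / a) ^ (2 ^ Suc m)) \<partial>\<mu> \<omega>) \<in> borel_measurable N"
proof -
  have i: "\<i> \<notin> \<real>" "- \<i> \<notin> \<real>" by (auto simp: complex_is_Real_iff)
  define g where "g c t = 1 / (1 - c * complex_of_real (((t - x) / a) ^ (2 ^ m)))" for c t
  have split: "complex_of_real (1 / (1 + ((t - x) / a) ^ (2 ^ Suc m))) = (1 / 2) * (g \<i> t + g (- \<i>) t)" for t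
  proof -
    define w where "w = complex_of_real (((t - x) / a) ^ (2 ^ m))"
    have "complex_of_real (((t - x) / a) ^ (2 ^ Suc m)) = w * w"
      by (simp only: w_def power_Suc mult_2 power_add of_real_mult)
    then have eq: "complex_of_real (1 + ((t - x) / a) ^ (2 ^ Suc m)) = (1 - \<i> * w) * (1 - (- \<i>) * w)"
      by (simp add: algebra_simps)
    have "1 - \<i> * w \<noteq> 0" "1 - (- \<i>) * w \<noteq> 0"
      unfolding w_def by (rule one_minus_nonreal_nonzero; fact)+
    then show ?thesis unfolding of_real_divide eq g_def w_def[symmetric] by (simp add: divide_simps)
  qed
  have "(\<integral>t. 1 / (1 + ((t - x) / a) ^ (2 ^ Suc m)) \<partial>\<mu> \<omega>)
      = Re ((1 / 2) * ((\<integral>t. g \<i> t \<partial>\<mu> \<omega>) + (\<integral>t. g (- \<i>) t \<partial>\<mu> \<omega>)))" if "\<omega> \<in> space N" for \<omega>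
  proof -
    have "complex_of_real (\<integral>t. 1 / (1 + ((t - x) / a) ^ (2 ^ Suc m)) \<partial>\<mu> \<omega>)
        = (\<integral>t. (1 / 2) * (g \<i> t + g (- \<i>) t) \<partial>\<mu> \<omega>)"
      unfolding split[symmetric] by (rule integral_complex_of_real[symmetric])
    also have "\<dots> = (1 / 2) * ((\<integral>t. g \<i> t \<partial>\<mu> \<omega>) + (\<integral>t. g (- \<i>) t \<partial>\<mu> \<omega>))"
      unfolding integral_mult_right_zero g_def
      by (subst Bochner_Integration.integral_add) (intro integrable_inverse_nonreal that i refl)+
    finally show ?thesis by (metis Re_complex_of_real)
  qed
  moreover have "(\<lambda>\<omega>. Re ((1 / 2) * ((\<integral>t. g \<i> t \<partial>\<mu> \<omega>) + (\<integral>t. g (- \<i>) t \<partial>\<mu> \<omega>)))) \<in> borel_measurable N"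
    unfolding g_def
    by (intro measurable_compose[OF _ borel_measurable_Re] borel_measurable_times borel_measurable_const borel_measurable_add
        measurable_integral_inverse_power a i)
  ultimately show ?thesis by (subst measurable_cong) auto
qed

lemma measurable_measure_interval:
  "(\<lambda>\<omega>. measure (\<mu> \<omega>) {a<..<b}) \<in> borel_measurable N"
proof (cases "a < b")
  case True
  define x r where "x = (a + b) / 2" and "r = (b - a) / 2"
  have r: "r > 0" and ab: "{a<..<b} = {x - r<..<x + r}" using True by (auto simp: x_def r_def field_simps)
  define g where "g k t = 1 / (1 + ((t - x) / (r / (1 + (2 / 3) ^ k))) ^ (2 ^ Suc k))" for k and t :: real
  have g01: "0 \<le> g k t" "g k t \<le> 1" for k t
  proof -
    have "0 \<le> ((t - x) / (r / (1 + (2 / 3) ^ k))) ^ (2 ^ Suc k)" by (simp add: zero_le_even_power)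
    moreover have "0 \<le> 1 / (1 + P) \<and> 1 / (1 + P) \<le> 1" if "0 \<le> P" for P :: real
      using that by simp
    ultimately show "0 \<le> g k t" "g k t \<le> 1" unfolding g_def by blast+
  qed
  show ?thesis
  proof (rule borel_measurable_LIMSEQ_metric)
    show "(\<lambda>\<omega>. \<integral>t. g k t \<partial>\<mu> \<omega>) \<in> borel_measurable N" for k
      unfolding g_def using r by (intro measurable_integral_even_power divide_pos_pos) (auto simp: add_pos_pos)
    fix \<omega> assume \<omega>: "\<omega> \<in> space N"
    interpret finite_measure "\<mu> \<omega>" by (rule fin[OF \<omega>])
    note [measurable_cong] = sets_\<mu>[OF \<omega>]
    have "(\<lambda>k. \<integral>t. g k t \<partial>\<mu> \<omega>) \<longlonglongrightarrow> (\<integral>t. indicator {a<..<b} t \<partial>\<mu> \<omega>)"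
    proof (rule integral_dominated_convergence[where w = "\<lambda>_. 1"])
      show "AE t in \<mu> \<omega>. (\<lambda>k. g k t) \<longlonglongrightarrow> indicator {a<..<b} t"
        unfolding ab g_def using tendsto_indicator_interval[OF r] by simp
      show "AE t in \<mu> \<omega>. norm (g k t) \<le> 1" for k using g01 by simp
      show "g k \<in> borel_measurable (\<mu> \<omega>)" for k unfolding g_def by measurable
    qed (simp_all, measurable)
    moreover have "{a<..<b} \<inter> space (\<mu> \<omega>) = {a<..<b}"
      using sets_eq_imp_space_eq[OF sets_\<mu>[OF \<omega>]] by simp
    ultimately show "(\<lambda>k. \<integral>t. g k t \<partial>\<mu> \<omega>) \<longlonglongrightarrow> measure (\<mu> \<omega>) {a<..<b}" by simp
  qed
qed simp

text \<open>Dynkin's argument: open intervals are stable under intersection and generate the Borel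
  sets.\<close>

lemma measurable_measure_of_resolvent:
  assumes A: "A \<in> sets borel"
  shows "(\<lambda>\<omega>. measure (\<mu> \<omega>) A) \<in> borel_measurable N"
proof -
  have borel: "sets borel = sigma_sets UNIV (range (\<lambda>(a, b). {a<..<b :: real}))"
    using arg_cong[OF borel_eq_box[where 'a = real], of sets] by (simp add: box_real)
  \<comment> \<open>The total mass may depend on \<omega>, so its measurability has to be known
    before complements can be handled.\<close>
  have UNIV: "(\<lambda>\<omega>. measure (\<mu> \<omega>) UNIV) \<in> borel_measurable N"
  proof (rule borel_measurable_LIMSEQ_metric)
    show "(\<lambda>\<omega>. measure (\<mu> \<omega>) {- real n<..<real n}) \<in> borel_measurable N" for n
      by (rule measurable_measure_interval)
    fix \<omega> assume \<omega>: "\<omega> \<in> space N"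
    interpret finite_measure "\<mu> \<omega>" by (rule fin[OF \<omega>])
    have "(\<Union>n. {- real n<..<real n}) = UNIV"
    proof (intro set_eqI iffI)
      fix t :: real
      obtain n where "\<bar>t\<bar> < real n" using reals_Archimedean2 by blast
      then have "t \<in> {- real n<..<real n}" by auto
      then show "t \<in> (\<Union>n. {- real n<..<real n})" by blast
    qed simp
    moreover have "(\<lambda>n. measure (\<mu> \<omega>) {- real n<..<real n}) \<longlonglongrightarrow> measure (\<mu> \<omega>) (\<Union>n. {- real n<..<real n})"
      by (rule finite_Lim_measure_incseq) (auto simp: sets_\<mu>[OF \<omega>] incseq_def)
    ultimately show "(\<lambda>n. measure (\<mu> \<omega>) {- real n<..<real n}) \<longlonglongrightarrow> measure (\<mu> \<omega>) UNIV" by simp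
  qed
  have "Int_stable (range (\<lambda>(a, b). {a<..<b :: real}))"
  proof (rule Int_stableI_image)
    fix i j :: "real \<times> real"
    show "\<exists>k\<in>UNIV. (case i of (a, b) \<Rightarrow> {a<..<b}) \<inter> (case j of (a, b) \<Rightarrow> {a<..<b}) = (case k of (a, b) \<Rightarrow> {a<..<b})"
      by (rule bexI[of _ "(max (fst i) (fst j), min (snd i) (snd j))"]) (auto split: prod.splits)
  qed
  moreover have "range (\<lambda>(a, b). {a<..<b :: real}) \<subseteq> Pow UNIV" by simp
  moreover have "A \<in> sigma_sets UNIV (range (\<lambda>(a, b). {a<..<b :: real}))" using A borel by simp
  ultimately show ?thesis
  proof (induction rule: sigma_sets_induct_disjoint)
    case (basic A)
    then show ?case using measurable_measure_interval by auto
  next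
    case empty
    then show ?case by simp
  next
    case (compl A)
    have "measure (\<mu> \<omega>) (UNIV - A) = measure (\<mu> \<omega>) UNIV - measure (\<mu> \<omega>) A" if \<omega>: "\<omega> \<in> space N" for \<omega>
    proof -
      interpret finite_measure "\<mu> \<omega>" by (rule fin[OF \<omega>])
      show ?thesis
        using finite_measure_compl[of A] compl(1) sets_eq_imp_space_eq[OF sets_\<mu>[OF \<omega>]]
        by (simp add: sets_\<mu>[OF \<omega>] borel)
    qed
    moreover have "(\<lambda>\<omega>. measure (\<mu> \<omega>) UNIV - measure (\<mu> \<omega>) A) \<in> borel_measurable N"
      by (intro borel_measurable_diff UNIV compl(2))
    ultimately show ?case by (subst measurable_cong) auto
  next
    case (union A)
    show ?case
    proof (rule borel_measurable_LIMSEQ_metric)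
      show "(\<lambda>\<omega>. \<Sum>i<n. measure (\<mu> \<omega>) (A i)) \<in> borel_measurable N" for n
        by (intro borel_measurable_sum union(3))
      fix \<omega> assume \<omega>: "\<omega> \<in> space N"
      interpret finite_measure "\<mu> \<omega>" by (rule fin[OF \<omega>])
      have "range A \<subseteq> sets (\<mu> \<omega>)" using union(2) by (auto simp: sets_\<mu>[OF \<omega>] borel)
      then have "(\<lambda>i. measure (\<mu> \<omega>) (A i)) sums measure (\<mu> \<omega>) (\<Union>i. A i)"
        by (rule finite_measure_UNION) (rule union(1))
      then show "(\<lambda>n. \<Sum>i<n. measure (\<mu> \<omega>) (A i)) \<longlonglongrightarrow> measure (\<mu> \<omega>) (\<Union>i. A i)"
        by (simp add: sums_def)
    qed
  qed
qed

end

text \<open>Measurability with respect to a trivial \<open>\<sigma>\<close>-algebra means being constant, so the uniqueness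
  theorem is a special case of the measurability theorem.\<close>

lemma measure_eq_of_resolvent:
  fixes M M' :: "real measure"
  assumes "finite_measure M" "finite_measure M'" "sets M = sets borel" "sets M' = sets borel"
    and "\<And>z. z \<notin> \<real> \<Longrightarrow> (\<integral>t. 1 / (complex_of_real t - z) \<partial>M) = (\<integral>t. 1 / (complex_of_real t - z) \<partial>M')"
    and "A \<in> sets borel"
  shows "measure M A = measure M' A"
proof -
  define N :: "bool measure" where "N = sigma UNIV {}"
  have sN: "sets N = {{}, UNIV}" by (simp add: N_def sigma_sets_empty_eq)
  define \<mu> where "\<mu> b = (if b then M else M')" for b
  have "(\<lambda>b. measure (\<mu> b) A) \<in> borel_measurable N"
  proof (rule measurable_measure_of_resolvent)
    fix z :: complex assume "z \<notin> \<real>"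
    then have "(\<integral>t. 1 / (complex_of_real t - z) \<partial>\<mu> b) = (\<integral>t. 1 / (complex_of_real t - z) \<partial>M)" for b
      using assms(5) by (simp add: \<mu>_def)
    then show "(\<lambda>b. \<integral>t. 1 / (complex_of_real t - z) \<partial>\<mu> b) \<in> borel_measurable N" by simp
  qed (use assms in \<open>auto simp: \<mu>_def\<close>)
  then have "(\<lambda>b. measure (\<mu> b) A) -` {measure M A} \<inter> space N \<in> sets N"
    by (rule measurable_sets) simp
  moreover have "True \<in> (\<lambda>b. measure (\<mu> b) A) -` {measure M A} \<inter> space N"
    by (simp add: \<mu>_def N_def)
  ultimately have "False \<in> (\<lambda>b. measure (\<mu> b) A) -` {measure M A} \<inter> space N"
    unfolding sN by blast
  then show ?thesis by (simp add: \<mu>_def)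
qed

section \<open>Spectral gaps of parts of an operator\<close>

context
  fixes H :: "'v::{complex_inner, complete_space} operator" and E and M :: "'v set"
  assumes H: "selfadjoint H" and S: "spectral_measure_of H E"
    and M: "csubspace M" "closed M" and red: "reduces M H"
begin

text \<open>Cutting the interval into \<open>n\<close> pieces, the projection to \<open>M\<close> has norm \<open>O(1 / n)\<close> on each
  of the \<open>n\<close> orthogonal spectral subspaces, hence norm \<open>O(1 / \<surd>n)\<close> on their sum.\<close>

lemma orth_proj_spectral_interval_eq_0:
  assumes c: "c > 0" and r: "r > 0"
    and low: "\<And>l' v. l' \<in> {l - r..l + r} \<Longrightarrow> v \<in> dom H \<Longrightarrow> v \<in> M \<Longrightarrow>
      c * norm v \<le> norm (op_app H v - complex_of_real l' *\<^sub>C v)"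
  shows "orth_proj M (E {l - r..<l + r} y) = 0"
proof -
  note E = spectral_pvm[OF H S]
  let ?P = "orth_proj M"
  interpret P: bounded_linear ?P by (rule bounded_linear_orth_proj[OF M])
  have bound: "(norm (?P (E {l - r..<l + r} y)))\<^sup>2 \<le> 4 * r\<^sup>2 / c\<^sup>2 * (norm y)\<^sup>2 / real n"
    if n: "n > 0" for n :: nat
  proof -
    define h where "h = 2 * r / n"
    have h: "h > 0" using r n by (simp add: h_def)
    define t where "t k = l - r + h * real k" for k
    have t_Suc: "t (Suc k) = t k + h" and t_le: "t 0 \<le> t k" "t k \<le> t (Suc k)" for k
      using h by (simp_all add: t_def algebra_simps)
    have tn: "t 0 = l - r" "t n = l + r" using n by (simp_all add: t_def h_def)
    define w where "w k = E {t k..<t (Suc k)} y" for k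
    have sum: "E {t 0..<t m} y = (\<Sum>k<m. w k)" for m
    proof (induction m)
      case 0
      show ?case by (simp add: pvm_empty[OF E])
    next
      case (Suc m)
      have "{t 0..<t m} \<union> {t m..<t (Suc m)} = {t 0..<t (Suc m)}"
        by (rule ivl_disj_un_two(3)) (rule t_le)+
      then show ?case
        using pvm_Un[OF E, of "{t 0..<t m}" "{t m..<t (Suc m)}" y] Suc by (simp add: w_def)
    qed
    have cw: "cinner y (w k) = complex_of_real ((norm (w k))\<^sup>2)" for k
      unfolding w_def by (rule cinner_projection_operator[OF pvm_proj[OF E]]) simp
    have "cinner y (E {t 0..<t n} y) = (\<Sum>k<n. cinner y (w k))"
      unfolding sum by (rule linear_sum[OF bounded_linear.linear[OF bounded_linear_cinner_right]])
    then have "complex_of_real ((norm (E {t 0..<t n} y))\<^sup>2) = complex_of_real (\<Sum>k<n. (norm (w k))\<^sup>2)"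
      using cinner_projection_operator[OF pvm_proj[OF E], of "{t 0..<t n}" y] by (simp add: cw)
    then have sq: "(\<Sum>k<n. (norm (w k))\<^sup>2) = (norm (E {t 0..<t n} y))\<^sup>2"
      unfolding of_real_eq_iff by simp
    also have "\<dots> \<le> (norm y)\<^sup>2"
      by (intro power_mono norm_projection_operator_le[OF pvm_proj[OF E]]) auto
    finally have sq_le: "(\<Sum>k<n. (norm (w k))\<^sup>2) \<le> (norm y)\<^sup>2" .
    \<comment> \<open>\<open>H - t k\<close> is bounded below by \<open>c\<close> on
      \<open>M\<close> and above by \<open>h\<close> on the spectral subspace of the piece. As the
      projection commutes with \<open>H\<close>, it shrinks the piece by
      \<open>h / c\<close>.\<close>
    have piece: "norm (?P (w k)) \<le> h / c * norm (w k)" if "k < n" for k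
    proof -
      have B: "{t k..<t (Suc k)} \<in> sets borel" "{t k..<t (Suc k)} \<subseteq> {t k - h..t k + h}"
        using h by (auto simp: t_Suc)
      have Ew: "E {t k..<t (Suc k)} (w k) = w k"
        unfolding w_def by (rule projection_operator_idem[OF pvm_proj[OF E B(1)]])
      have wD: "w k \<in> dom H" by (rule spectral_proj_bounded_dom[OF H S B Ew])
      have PD: "?P (w k) \<in> dom H" by (rule reduces_dom[OF H M red wD])
      have "h * real k \<le> h * real n" using that h by simp
      moreover have "0 \<le> h * real k" using h by simp
      moreover have "l - r + h * real n = l + r" using tn(2) by (simp add: t_def)
      ultimately have tk: "t k \<in> {l - r..l + r}"
        unfolding t_def atLeastAtMost_iff by linarith
      have "c * norm (?P (w k)) \<le> norm (op_app H (?P (w k)) - complex_of_real (t k) *\<^sub>C ?P (w k))"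
        by (rule low[OF tk PD orth_proj_in[OF M]])
      also have "\<dots> = norm (?P (op_app H (w k) - complex_of_real (t k) *\<^sub>C w k))"
        by (simp add: reduces_commute[OF H M red wD] P.diff orth_proj_scaleC[OF M])
      also have "\<dots> \<le> norm (op_app H (w k) - complex_of_real (t k) *\<^sub>C w k)"
        by (rule norm_orth_proj_le[OF M])
      also have "\<dots> \<le> h * norm (w k)" by (rule norm_spectral_shift_le[OF H S B Ew])
      finally show ?thesis using c by (simp add: field_simps)
    qed
    have "norm (?P (E {t 0..<t n} y)) \<le> (\<Sum>k<n. norm (?P (w k)))"
      unfolding sum P.sum by (rule norm_sum)
    also have "\<dots> \<le> (\<Sum>k<n. h / c * norm (w k))" by (intro sum_mono piece) auto
    also have "\<dots> = h / c * (\<Sum>k<n. norm (w k))" by (simp add: sum_distrib_left)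
    finally have "(norm (?P (E {t 0..<t n} y)))\<^sup>2 \<le> (h / c * (\<Sum>k<n. norm (w k)))\<^sup>2"
      by (intro power_mono) auto
    also have "\<dots> = (h / c)\<^sup>2 * (\<Sum>k<n. norm (w k))\<^sup>2" by (rule power_mult_distrib)
    \<comment> \<open>Cauchy-Schwarz for \<open>n\<close> terms costs a factor \<open>n\<close>
      against \<open>h\<^sup>2\<close> of order \<open>1 / n\<^sup>2\<close>.\<close>
    also have "\<dots> \<le> (h / c)\<^sup>2 * ((norm y)\<^sup>2 * real n)"
      using sum_squared_le_sum_of_squares[of "\<lambda>k. norm (w k)" "{..<n}"] mult_right_mono[OF sq_le, of "real n"]
      by (intro mult_left_mono) auto
    also have "\<dots> = 4 * r\<^sup>2 / c\<^sup>2 * (norm y)\<^sup>2 / real n"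
      using n by (simp add: h_def power_divide power_mult_distrib) (simp add: power2_eq_square mult_ac)
    finally show ?thesis unfolding tn .
  qed
  have "(\<lambda>n. 4 * r\<^sup>2 / c\<^sup>2 * (norm y)\<^sup>2 * inverse (real (Suc n))) \<longlonglongrightarrow> 4 * r\<^sup>2 / c\<^sup>2 * (norm y)\<^sup>2 * 0"
    by (intro tendsto_intros LIMSEQ_inverse_real_of_nat)
  then have "(norm (?P (E {l - r..<l + r} y)))\<^sup>2 \<le> 4 * r\<^sup>2 / c\<^sup>2 * (norm y)\<^sup>2 * 0"
    by (rule LIMSEQ_le_const) (use bound[of "Suc _"] in \<open>auto simp: divide_inverse simp del: of_nat_Suc\<close>)
  then show ?thesis by simp
qed

text \<open>The lower bound at \<open>t\<close> persists nearby. Rational endpoints leave only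
  countably many candidate intervals, so that countable additivity can be applied to the cover built
  from them.\<close>

lemma orth_proj_spectral_rational_interval_eq_0:
  assumes t: "complex_of_real t \<notin> spectrum_in M (H |` M)"
  obtains a b :: rat where "t \<in> {of_rat a..<of_rat b}" "\<And>y. orth_proj M (E {of_rat a..<of_rat b} y) = 0"
proof -
  note E = spectral_pvm[OF H S]
  obtain c where c: "0 < c"
    and low: "\<And>v. v \<in> dom H \<Longrightarrow> v \<in> M \<Longrightarrow> c * norm v \<le> norm (op_app H v - complex_of_real t *\<^sub>C v)"
    using not_in_spectrumD[OF H M red t] by auto
  \<comment> \<open>Moving \<open>t\<close> by at most \<open>c / 2\<close> leaves the lower bound
    \<open>c / 2\<close>, so \<open>r\<close> serves both as radius and as bound.\<close>
  define r where "r = c / 2"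
  have r: "r > 0" using c by (simp add: r_def)
  have "r * norm v \<le> norm (op_app H v - complex_of_real l *\<^sub>C v)"
    if l: "l \<in> {t - r..t + r}" and v: "v \<in> dom H" "v \<in> M" for l v
  proof -
    have "op_app H v - complex_of_real t *\<^sub>C v
        = (op_app H v - complex_of_real l *\<^sub>C v) + complex_of_real (l - t) *\<^sub>C v"
      by (simp add: scaleC_diff_left)
    then have "norm (op_app H v - complex_of_real t *\<^sub>C v)
        \<le> norm (op_app H v - complex_of_real l *\<^sub>C v) + \<bar>l - t\<bar> * norm v"
      by (metis norm_triangle_ineq norm_scaleC norm_of_real)
    also have "\<bar>l - t\<bar> * norm v \<le> r * norm v" using l by (intro mult_right_mono) auto
    finally show ?thesis using low[OF v] by (simp add: r_def)
  qed
  then have zero: "orth_proj M (E {t - r..<t + r} y) = 0" for y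
    by (intro orth_proj_spectral_interval_eq_0[OF r r])
  obtain a where a: "t - r < of_rat a" "of_rat a < t" using of_rat_dense[of "t - r" t] r by auto
  obtain b where b: "t < of_rat b" "of_rat b < t + r" using of_rat_dense[of t "t + r"] r by auto
  have "{of_rat a..<of_rat b} \<subseteq> {t - r..<t + r}" using a b by auto
  then have "E {t - r..<t + r} (E {of_rat a..<of_rat b} y) = E {of_rat a..<of_rat b} y" for y
    by (intro pvm_subset[OF E]) auto
  then have "orth_proj M (E {of_rat a..<of_rat b} y) = 0" for y
    using zero by metis
  then show ?thesis using a b that[of a b] by auto
qed

text \<open>Near \<open>l\<close> every point lies in \<open>A\<close>, where \<open>E\<close>
  vanishes, or off the spectrum of the part, where the projected \<open>E\<close> vanishes. Together
  these give a spectral gap of \<open>H\<close> on the vectors of \<open>M\<close>, hence a lower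
  bound for \<open>H - l\<close> there.\<close>

lemma not_in_spectrum_of_proj_eq_0:
  assumes A: "A \<in> sets borel" "\<And>y. E A y = 0" and e: "e > 0"
    and sub: "\<And>t. t \<in> {l - e<..<l + e} \<Longrightarrow> complex_of_real t \<in> spectrum_in M (H |` M) \<Longrightarrow> t \<in> A"
  shows "complex_of_real l \<notin> spectrum_in M (H |` M)"
proof -
  note E = spectral_pvm[OF H S]
  let ?P = "orth_proj M"
  interpret P: bounded_linear ?P by (rule bounded_linear_orth_proj[OF M])
  \<comment> \<open>\<open>Q\<close> lists all half-open rational intervals; \<open>B\<close> keeps
    those whose spectral subspace is annihilated by the projection. Making them disjoint allows
    summation.\<close>
  define Q :: "nat \<Rightarrow> real set" where
    "Q n = (case from_nat n :: rat \<times> rat of (a, b) \<Rightarrow> {of_rat a..<of_rat b})" for n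
  define B where "B n = (if \<forall>y. ?P (E (Q n) y) = 0 then Q n else {})" for n
  have Bs: "B n \<in> sets borel" for n by (auto simp: B_def Q_def split: prod.splits)
  have B0: "?P (E (B n) y) = 0" for n y by (simp add: B_def pvm_empty[OF E] P.zero)
  have cover: "t \<in> (\<Union>n. B n)" if t: "complex_of_real t \<notin> spectrum_in M (H |` M)" for t
  proof -
    obtain a b :: rat where ab: "t \<in> {of_rat a..<of_rat b}" "\<And>y. ?P (E {of_rat a..<of_rat b} y) = 0"
      using orth_proj_spectral_rational_interval_eq_0[OF t] by blast
    then have "B (to_nat (a, b)) = {of_rat a..<of_rat b}" by (simp add: B_def Q_def)
    with ab(1) show ?thesis by blast
  qed
  define D where "D = disjointed B"
  have Ds: "range D \<subseteq> sets borel"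
    unfolding D_def using Bs by (intro sets.range_disjointed_sets) auto
  then have Dn: "D n \<in> sets borel" for n by auto
  have D0: "?P (E (D n) y) = 0" for n y
  proof -
    have "E (B n) (E (D n) y) = E (D n) y"
      by (rule pvm_subset[OF E Dn Bs]) (simp add: D_def disjointed_subset)
    then show ?thesis using B0 by metis
  qed
  define V where "V = (\<Union>n. B n)"
  have Vs: "V \<in> sets borel" unfolding V_def using Bs by auto
  have V0: "?P (E V y) = 0" for y
  proof -
    have "(\<lambda>n. E (D n) y) sums E (\<Union>n. D n) y"
      by (rule pvm_sums[OF E Ds]) (simp add: D_def disjoint_family_disjointed)
    then have "(\<lambda>n. ?P (E (D n) y)) sums ?P (E V y)"
      unfolding D_def UN_disjointed_eq V_def by (rule P.sums)
    then show ?thesis unfolding D0 using sums_unique2[OF sums_zero] by metis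
  qed
  define J where "J = {l - e<..<l + e}"
  have Js: "J \<in> sets borel" "J \<inter> A \<in> sets borel" "J - A \<in> sets borel" using A by (auto simp: J_def)
  have J0: "?P (E J y) = 0" for y
  proof -
    have "J - A \<subseteq> V" using cover sub unfolding J_def V_def by blast
    then have "E V (E (J - A) y) = E (J - A) y" by (rule pvm_subset[OF E Js(3) Vs])
    then have 1: "?P (E (J - A) y) = 0" using V0 by metis
    have "E A (E (J \<inter> A) y) = E (J \<inter> A) y" by (rule pvm_subset[OF E Js(2) A(1)]) auto
    then have 2: "E (J \<inter> A) y = 0" using A(2) by metis
    have "J = J \<inter> A \<union> (J - A)" "J \<inter> A \<inter> (J - A) = {}" by auto
    then have "E J y = E (J \<inter> A) y + E (J - A) y"
      using pvm_Un[OF E Js(2,3), of y] by metis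
    then show ?thesis using 1 2 by simp
  qed
  show ?thesis
  proof (rule not_in_spectrumI'[OF H M red e])
    fix v assume v: "v \<in> dom H" "v \<in> M"
    \<comment> \<open>For \<open>v\<close> in \<open>M\<close> the projection can be inserted in
      front of \<open>E J v\<close>, and the resulting inner product is the squared norm of
      \<open>E J v\<close>.\<close>
    have "cinner v (E J v) = 0" using cinner_orth_proj[OF M v(2), of "E J v"] J0 by simp
    then have "E J v = 0" using cinner_projection_operator[OF pvm_proj[OF E Js(1)], of v] by simp
    then have "E (- J) v = v" using pvm_compl[OF E Js(1), of v] by simp
    then show "e * norm v \<le> norm (op_app H v - complex_of_real l *\<^sub>C v)"
      by (intro norm_spectral_shift_ge[OF H S, of "- J"] v) (use Js in \<open>auto simp: J_def borel_comp\<close>)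
  qed
qed

end

section \<open>Ergodic families\<close>

context
  fixes U :: "'v::complex_inner \<Rightarrow> 'v"
  assumes U: "unitary U"
begin

lemma unitary_inv [simp]: "U (inv U x) = x" "inv U (U x) = x"
  using U by (auto simp: unitary_def bij_def surj_f_inv_f)

lemma cinner_unitary_inv: "cinner (inv U x) y = cinner x (U y)"
  using U unfolding unitary_def by (metis unitary_inv(1))

lemma cadjoint_unitary: "cadjoint U = inv U"
  unfolding cadjoint_def
proof (rule the_equality)
  show "\<forall>x y. cinner (inv U x) y = cinner x (U y)" by (simp add: cinner_unitary_inv)
  fix C assume C: "\<forall>x y. cinner (C x) y = cinner x (U y)"
  show "C = inv U"
  proof
    fix x
    have "cinner (C x - inv U x) y = 0" for y
      using C by (simp add: cinner_simps cinner_unitary_inv)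
    from this[of "C x - inv U x"] show "C x = inv U x" by (simp add: cinner_self)
  qed
qed

end

text \<open>Covariance is stated for diagonal matrix elements of the resolvent, because these are
  the integrals that determine the scalar measures.\<close>

lemma cinner_resolvent_conjugate:
  fixes H :: "'v::{complex_inner, complete_space} operator"
  assumes U: "unitary U" and H: "selfadjoint H" and H': "selfadjoint H'"
    and eq: "H' = map_option U \<circ> H \<circ> cadjoint U" and z: "z \<notin> \<real>"
  shows "cinner x (resolvent H' z x) = cinner (inv U x) (resolvent H z (inv U x))"
proof -
  define u where "u = resolvent H z (inv U x)"
  have u: "u \<in> dom H" "op_app H u - z *\<^sub>C u = inv U x"
    unfolding u_def by (rule resolvent_nonreal[OF H z])+
  have lin: "U (a + b) = U a + U b" "U (c *\<^sub>C a) = c *\<^sub>C U a" for a b c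
    using U by (auto simp: unitary_def clinear_def)
  have H'u: "H' (U u) = Some (U (op_app H u))"
    using u(1) by (auto simp: eq cadjoint_unitary[OF U] unitary_inv[OF U])
  have "op_app H u = inv U x + z *\<^sub>C u" using u(2) by (simp add: algebra_simps)
  then have "U (op_app H u) = x + z *\<^sub>C U u" by (simp add: lin unitary_inv[OF U])
  then have "resolvent H' z x = U u"
    using H'u by (intro resolvent_eqI[OF H' z]) auto
  then show ?thesis by (simp add: u_def cinner_unitary_inv[OF U])
qed

context
  fixes P :: "'w measure" and H :: "'w \<Rightarrow> 'v::{complex_inner, complete_space} operator"
    and U :: "('d::finite \<Rightarrow> int) \<Rightarrow> 'v \<Rightarrow> 'v" and E
  assumes P: "prob_space P" and erg: "ergodic_family P U H"
    and S: "\<And>\<omega>. \<omega> \<in> space P \<Longrightarrow> spectral_measure_of (H \<omega>) (E \<omega>)"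
begin

lemma ergodic_family_selfadjoint: "\<omega> \<in> space P \<Longrightarrow> selfadjoint (H \<omega>)"
  using erg by (simp add: ergodic_family_def measurable_family_def)

text \<open>\<open>measurable_family\<close> speaks of resolvents; \<open>cinner_resolvent\<close>
  rewrites their diagonal elements as kernel integrals, to which
  \<open>measurable_measure_of_resolvent\<close> applies.\<close>

lemma measurable_spectral_measure:
  assumes A: "A \<in> sets borel"
  shows "(\<lambda>\<omega>. (norm (E \<omega> A x))\<^sup>2) \<in> borel_measurable P"
proof -
  have "(\<lambda>\<omega>. measure (scalar_measure (E \<omega>) x) A) \<in> borel_measurable P"
  proof (rule measurable_measure_of_resolvent)
    fix z :: complex assume z: "z \<notin> \<real>"
    have "(\<lambda>\<omega>. cinner x (resolvent (H \<omega>) z x)) \<in> borel_measurable P"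
      using erg z by (simp add: ergodic_family_def measurable_family_def)
    then show "(\<lambda>\<omega>. \<integral>t. 1 / (complex_of_real t - z) \<partial>scalar_measure (E \<omega>) x) \<in> borel_measurable P"
      by (simp add: cinner_resolvent[OF ergodic_family_selfadjoint S z] cong: measurable_cong_simp)
  qed (use A spectral_pvm[OF ergodic_family_selfadjoint S] in \<open>auto intro!: finite_measure_scalar_measure\<close>)
  then show ?thesis
    by (simp add: measure_scalar_measure[OF spectral_pvm[OF ergodic_family_selfadjoint S] A] cong: measurable_cong_simp)
qed

text \<open>A vanishing integral gives the claim for \<open>x\<close> itself almost surely, and
  invariance transports it to \<open>T i \<omega>\<close>. There the scalar measure at
  \<open>x\<close> agrees with the one of \<omega> at \<open>inv (U i) x\<close>. The index group is
  countable, so one null set serves all \<open>i\<close>.\<close>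

lemma AE_translates_spectral_proj_eq_0:
  assumes A: "A \<in> sets borel" and zero: "(\<integral>\<^sup>+\<omega>. ennreal ((norm (E \<omega> A x))\<^sup>2) \<partial>P) = 0"
  shows "AE \<omega> in P. \<forall>i. E \<omega> A (inv (U i) x) = 0"
proof -
  interpret prob_space P by (rule P)
  obtain T where T: "measure_preserving_family P T"
    and HT: "\<And>i \<omega>. \<omega> \<in> space P \<Longrightarrow> H (T i \<omega>) = map_option (U i) \<circ> H \<omega> \<circ> cadjoint (U i)"
    using erg unfolding ergodic_family_def by auto
  have U: "unitary (U i)" for i using erg by (simp add: ergodic_family_def)
  have Tm: "T i \<in> measurable P P" for i using T by (simp add: measure_preserving_family_def)
  have TP: "distr P P (T i) = P" for i
  proof (rule measure_eqI)
    fix B assume "B \<in> sets (distr P P (T i))"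
    then show "emeasure (distr P P (T i)) B = emeasure P B"
      using T Tm[of i] by (simp add: emeasure_distr emeasure_eq_measure measure_preserving_family_def)
  qed simp
  have "AE \<omega> in P. E \<omega> A x = 0"
    using zero measurable_spectral_measure[OF A, of x] by (subst (asm) nn_integral_0_iff_AE) auto
  then have "AE \<omega> in P. E (T i \<omega>) A x = 0" for i by (rule AE_compose[OF Tm TP])
  then have "AE \<omega> in P. E \<omega> A (inv (U i) x) = 0" for i
  proof (rule AE_mp[OF _ AE_I2], intro impI)
    fix \<omega> assume \<omega>: "\<omega> \<in> space P" and 0: "E (T i \<omega>) A x = 0"
    have \<omega>': "T i \<omega> \<in> space P" using measurable_space[OF Tm \<omega>] .
    note sa = ergodic_family_selfadjoint[OF \<omega>] ergodic_family_selfadjoint[OF \<omega>']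
    note pvm = spectral_pvm[OF sa(1) S[OF \<omega>]] spectral_pvm[OF sa(2) S[OF \<omega>']]
    have "measure (scalar_measure (E (T i \<omega>)) x) A = measure (scalar_measure (E \<omega>) (inv (U i) x)) A"
    proof (rule measure_eq_of_resolvent)
      fix z :: complex assume z: "z \<notin> \<real>"
      show "(\<integral>t. 1 / (complex_of_real t - z) \<partial>scalar_measure (E (T i \<omega>)) x)
          = (\<integral>t. 1 / (complex_of_real t - z) \<partial>scalar_measure (E \<omega>) (inv (U i) x))"
        using cinner_resolvent_conjugate[OF U sa HT[OF \<omega>] z, of x]
          cinner_resolvent[OF sa(1) S[OF \<omega>] z] cinner_resolvent[OF sa(2) S[OF \<omega>'] z] by simp
    qed (use A pvm in \<open>auto intro!: finite_measure_scalar_measure\<close>)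
    then show "E \<omega> A (inv (U i) x) = 0"
      using 0 A by (simp add: measure_scalar_measure[OF pvm(1)] measure_scalar_measure[OF pvm(2)])
  qed
  then show ?thesis by (simp add: AE_all_countable)
qed

lemma almost_sure_spectrum_closed:
  assumes "almost_sure_spectrum P H \<sigma>"
  shows "closed \<sigma>"
proof -
  interpret prob_space P by (rule P)
  obtain M \<Omega> where M: "\<And>\<omega>. \<omega> \<in> space P \<Longrightarrow> csubspace (M \<omega>) \<and> closed (M \<omega>) \<and> reduces (M \<omega>) (H \<omega>)"
    and \<Omega>: "\<Omega> \<in> sets P" "measure P \<Omega> = 1"
    and spec: "\<And>\<omega>. \<omega> \<in> \<Omega> \<Longrightarrow> complex_of_real ` \<sigma> = spectrum_in (M \<omega>) (H \<omega> |` M \<omega>)"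
    using assms unfolding almost_sure_spectrum_def by blast
  \<comment> \<open>A single sample point is enough, since \<sigma> is the same set at all points of
    \<Omega>.\<close>
  have "\<Omega> \<noteq> {}" using \<Omega> by auto
  then obtain \<omega> where \<omega>: "\<omega> \<in> \<Omega>" "\<omega> \<in> space P" using sets.sets_into_space[OF \<Omega>(1)] by auto
  have "closed (complex_of_real ` \<sigma>)"
    unfolding spec[OF \<omega>(1)] using M[OF \<omega>(2)]
    by (intro closed_spectrum ergodic_family_selfadjoint \<omega>) auto
  then have "closed (complex_of_real -` (complex_of_real ` \<sigma>))"
    by (intro closed_vimage continuous_intros)
  then show ?thesis by (simp add: inj_vimage_image_eq inj_of_real)
qed

text \<open>The common core of both models. \<open>X\<close> plays the role of the vectors tested by
  the density of states: \<delta> at the origin, or basis vectors cut off to the unit cube. The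
  condition \<open>total\<close> says that their translates detect every vector.\<close>

lemma almost_sure_spectrum_interior_disjoint:
  fixes X :: "'v set"
  assumes spec: "almost_sure_spectrum P H \<sigma>" and I: "closed I" and X: "countable X"
    and zero: "\<And>x. x \<in> X \<Longrightarrow> (\<integral>\<^sup>+\<omega>. ennreal ((norm (E \<omega> (I \<inter> \<sigma>) x))\<^sup>2) \<partial>P) = 0"
    and total: "\<And>f. (\<And>i x. x \<in> X \<Longrightarrow> cinner x (U i f) = 0) \<Longrightarrow> f = 0"
  shows "interior I \<inter> \<sigma> = {}"
proof -
  interpret prob_space P by (rule P)
  obtain M \<Omega> where M: "\<And>\<omega>. \<omega> \<in> space P \<Longrightarrow> csubspace (M \<omega>) \<and> closed (M \<omega>) \<and> reduces (M \<omega>) (H \<omega>)"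
    and \<Omega>: "\<Omega> \<in> sets P" "measure P \<Omega> = 1"
    and sp: "\<And>\<omega>. \<omega> \<in> \<Omega> \<Longrightarrow> complex_of_real ` \<sigma> = spectrum_in (M \<omega>) (H \<omega> |` M \<omega>)"
    using spec unfolding almost_sure_spectrum_def by blast
  have A: "I \<inter> \<sigma> \<in> sets borel"
    using I almost_sure_spectrum_closed[OF spec] by (intro borel_closed closed_Int)
  have "AE \<omega> in P. \<forall>x\<in>X. \<forall>i. E \<omega> (I \<inter> \<sigma>) (inv (U i) x) = 0"
    using X by (intro AE_ball_countable') (auto intro: AE_translates_spectral_proj_eq_0[OF A zero])
  moreover have "AE \<omega> in P. \<omega> \<in> \<Omega>" by (rule AE_prob_1[OF \<Omega>(2)])
  ultimately have "AE \<omega> in P. \<omega> \<in> space P \<and> \<omega> \<in> \<Omega> \<and> (\<forall>x\<in>X. \<forall>i. E \<omega> (I \<inter> \<sigma>) (inv (U i) x) = 0)"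
    using AE_space by eventually_elim auto
  then obtain \<omega> where \<omega>: "\<omega> \<in> space P" "\<omega> \<in> \<Omega>"
    and E0: "\<And>x i. x \<in> X \<Longrightarrow> E \<omega> (I \<inter> \<sigma>) (inv (U i) x) = 0"
    using eventually_happens'[OF ae_filter_bot] by blast
  have sa: "selfadjoint (H \<omega>)" by (rule ergodic_family_selfadjoint[OF \<omega>(1)])
  note Q = pvm_proj[OF spectral_pvm[OF sa S[OF \<omega>(1)]] A]
  have U: "unitary (U i)" for i using erg by (simp add: ergodic_family_def)
  \<comment> \<open>Moving \<open>U i\<close> and then the projection to the left factor leaves
    \<open>E \<omega> (I \<inter> \<sigma>)\<close> applied to a translate of \<open>x\<close>,
    which is zero.\<close>
  have EA: "E \<omega> (I \<inter> \<sigma>) y = 0" for y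
  proof (rule total)
    fix i x assume x: "x \<in> X"
    show "cinner x (U i (E \<omega> (I \<inter> \<sigma>) y)) = 0"
      unfolding cinner_unitary_inv[OF U, symmetric] projection_operator_symmetric[OF Q, symmetric] E0[OF x]
      by simp
  qed
  have "l \<notin> \<sigma>" if "l \<in> interior I" for l
  proof
    assume l: "l \<in> \<sigma>"
    obtain e where e: "e > 0" "ball l e \<subseteq> I" using \<open>l \<in> interior I\<close> by (auto simp: mem_interior)
    have "complex_of_real l \<notin> spectrum_in (M \<omega>) (H \<omega> |` M \<omega>)"
    proof (rule not_in_spectrum_of_proj_eq_0[OF sa S[OF \<omega>(1)] _ _ _ A EA e(1)])
      fix t assume t: "t \<in> {l - e<..<l + e}" "complex_of_real t \<in> spectrum_in (M \<omega>) (H \<omega> |` M \<omega>)"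
      then have "t \<in> \<sigma>" unfolding sp[OF \<omega>(2), symmetric] by auto
      moreover have "t \<in> I" using t(1) e(2) by (auto simp: ball_def dist_real_def subset_iff abs_less_iff)
      ultimately show "t \<in> I \<inter> \<sigma>" by blast
    qed (use M[OF \<omega>(1)] in auto)
    with l show False unfolding sp[OF \<omega>(2), symmetric] by blast
  qed
  then show ?thesis by blast
qed

end

section \<open>Completeness of \<open>L\<^sub>2\<close>\<close>

lemma square_integrable_rep_L2: "square_integrable (rep_L2 f)"
  using Quotient3_rep_reflp[OF Quotient3_L2, of f] by (simp add: L2_rel_def)

lemma abs_rep_L2: "abs_L2 (rep_L2 f) = f"
  by (rule Quotient3_abs_rep[OF Quotient3_L2])

lemma L2_rel_refl: "square_integrable f \<Longrightarrow> L2_rel f f"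
  by (simp add: L2_rel_def)

lemma square_integrable_diff:
  "square_integrable f \<Longrightarrow> square_integrable g \<Longrightarrow> square_integrable (\<lambda>x. f x - g x)"
  using square_integrable_add[of f "\<lambda>x. - 1 * g x"] square_integrable_scale[of g "- 1"] by simp

lemma abs_L2_diff:
  assumes "square_integrable f" "square_integrable g"
  shows "abs_L2 f - abs_L2 g = abs_L2 (\<lambda>x. f x - g x)"
proof -
  have g: "square_integrable (\<lambda>x. - g x)" using square_integrable_scale[OF assms(2), of "- 1"] by simp
  have "abs_L2 f - abs_L2 g = abs_L2 f + abs_L2 (\<lambda>x. - g x)"
    by (simp add: minus_L2_def uminus_L2.abs_eq L2_rel_refl assms)
  also have "\<dots> = abs_L2 (\<lambda>x. f x + - g x)"
    by (rule plus_L2.abs_eq) (simp_all add: L2_rel_refl assms g)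
  finally show ?thesis by simp
qed

lemma nn_integral_abs_L2:
  assumes f: "square_integrable f"
  shows "(\<integral>\<^sup>+x. ennreal ((cmod (f x))\<^sup>2) \<partial>base_measure) = ennreal ((norm (abs_L2 f))\<^sup>2)"
proof -
  have "complex_of_real ((norm (abs_L2 f))\<^sup>2) = (\<integral>x. cnj (f x) * f x \<partial>base_measure)"
    unfolding cinner_self[symmetric] by (simp add: cinner_L2.abs_eq L2_rel_refl f)
  also have "\<dots> = complex_of_real (\<integral>x. (cmod (f x))\<^sup>2 \<partial>base_measure)"
    by (simp add: mult.commute complex_norm_square[symmetric] flip: integral_complex_of_real)
  finally have "(norm (abs_L2 f))\<^sup>2 = (\<integral>x. (cmod (f x))\<^sup>2 \<partial>base_measure)"
    unfolding of_real_eq_iff .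
  then show ?thesis
    using f by (subst nn_integral_eq_integral) (auto simp: square_integrable_def)
qed

text \<open>Each term is bounded by the sum \<open>c\<close>, and the weight is the square of
  \<open>2 ^ n\<close>, so the increments are at most \<open>sqrt c * (1 / 2) ^ n\<close>.\<close>

lemma convergent_of_weighted_suminf_finite:
  fixes f :: "nat \<Rightarrow> complex"
  assumes fin: "(\<Sum>n. ennreal (4 ^ n * (cmod (f (Suc n) - f n))\<^sup>2)) \<noteq> \<infinity>"
  shows "convergent f"
proof -
  let ?a = "\<lambda>n. 4 ^ n * (cmod (f (Suc n) - f n))\<^sup>2"
  obtain c where c: "c \<ge> 0" "(\<Sum>n. ennreal (?a n)) = ennreal c"
    using fin less_top_ennreal[of "\<Sum>n. ennreal (?a n)"]
    unfolding infinity_ennreal_def top.not_eq_extremum by blast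
  have "?a n \<le> c" for n
  proof -
    have le: "F n \<le> suminf F" for F :: "nat \<Rightarrow> ennreal"
      using sum_le_suminf[of F "{n}"] by simp
    have "ennreal (?a n) \<le> (\<Sum>n. ennreal (?a n))" by (rule le)
    then show ?thesis unfolding c(2) ennreal_le_iff[OF c(1)] .
  qed
  moreover have "(2 ^ n)\<^sup>2 = (4 :: real) ^ n" for n
    by (simp add: power2_eq_square flip: power_mult_distrib)
  ultimately have "(2 ^ n * cmod (f (Suc n) - f n))\<^sup>2 \<le> c" for n
    unfolding power_mult_distrib by simp
  then have "2 ^ n * cmod (f (Suc n) - f n) \<le> sqrt c" for n by (rule real_le_rsqrt)
  then have le: "norm (f (Suc n) - f n) \<le> sqrt c * (1 / 2) ^ n" for n
    by (simp add: field_simps)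
  have "summable (\<lambda>n. f (Suc n) - f n)"
    by (rule summable_comparison_test'[OF summable_mult[OF summable_geometric] le]) simp
  then have "convergent (\<lambda>n. \<Sum>k<n. f (Suc k) - f k)" by (simp add: summable_iff_convergent)
  then have "convergent (\<lambda>n. f n - f 0)" by (simp add: sum_lessThan_telescope)
  then have "convergent (\<lambda>n. (f n - f 0) + f 0)" by (intro convergent_add convergent_const)
  then show ?thesis by simp
qed

text \<open>Riesz-Fischer. The rate is chosen so that squared increments of order
  \<open>(1 / 16) ^ n\<close>, weighted by \<open>4 ^ n\<close>, still have a finite sum; this
  yields pointwise convergence almost everywhere.\<close>

lemma L2_limit_of_fast_Cauchy:
  fixes X :: "nat \<Rightarrow> 'a::base_measure L2"
  assumes fast: "\<And>m n. n \<le> m \<Longrightarrow> norm (X m - X n) \<le> (1 / 4) ^ n"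
  obtains g where "\<And>n. norm (X n - g) \<le> (1 / 4) ^ n"
proof -
  define f where "f n = rep_L2 (X n)" for n
  have f_sq: "square_integrable (f n)" for n by (simp add: f_def square_integrable_rep_L2)
  have X: "X n = abs_L2 (f n)" for n by (simp add: f_def abs_rep_L2)
  have [measurable]: "f n \<in> borel_measurable base_measure" for n
    by (rule square_integrable_measurable[OF f_sq])
  have diff: "(\<integral>\<^sup>+x. ennreal ((cmod (f m x - f n x))\<^sup>2) \<partial>base_measure) \<le> ennreal (((1 / 4) ^ n)\<^sup>2)"
    if "n \<le> m" for m n
    using fast[OF that] unfolding X abs_L2_diff[OF f_sq f_sq]
    by (subst nn_integral_abs_L2) (auto intro!: square_integrable_diff f_sq ennreal_leI power_mono)
  have "(\<integral>\<^sup>+x. (\<Sum>n. ennreal (4 ^ n * (cmod (f (Suc n) x - f n x))\<^sup>2)) \<partial>base_measure)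
      = (\<Sum>n. ennreal (4 ^ n) * (\<integral>\<^sup>+x. ennreal ((cmod (f (Suc n) x - f n x))\<^sup>2) \<partial>base_measure))"
    by (subst nn_integral_suminf) (simp_all add: ennreal_mult nn_integral_cmult)
  also have "\<dots> \<le> (\<Sum>n. ennreal ((1 / 4) ^ n))"
  proof (rule suminf_le)
    fix n
    have "ennreal (4 ^ n) * (\<integral>\<^sup>+x. ennreal ((cmod (f (Suc n) x - f n x))\<^sup>2) \<partial>base_measure)
        \<le> ennreal (4 ^ n) * ennreal (((1 / 4) ^ n)\<^sup>2)"
      by (intro mult_left_mono diff) auto
    also have "\<dots> = ennreal ((1 / 4) ^ n)"
      by (simp add: ennreal_mult[symmetric] power2_eq_square power_divide)
    finally show "ennreal (4 ^ n) * (\<integral>\<^sup>+x. ennreal ((cmod (f (Suc n) x - f n x))\<^sup>2) \<partial>base_measure) \<le> ennreal ((1 / 4) ^ n)" .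
  qed auto
  also have "\<dots> = ennreal (\<Sum>n. (1 / 4) ^ n)" by (rule suminf_ennreal2) (auto intro: summable_geometric)
  also have "\<dots> < \<infinity>" by simp
  finally have "AE x in base_measure. (\<Sum>n. ennreal (4 ^ n * (cmod (f (Suc n) x - f n x))\<^sup>2)) \<noteq> \<infinity>"
    by (intro nn_integral_noteq_infinite) auto
  then have conv: "AE x in base_measure. convergent (\<lambda>n. f n x)"
    by eventually_elim (rule convergent_of_weighted_suminf_finite)
  \<comment> \<open>Where the sequence diverges \<open>lim\<close> has an unspecified value, but
    that happens only on a null set.\<close>
  define g where "g x = lim (\<lambda>n. f n x)" for x
  have [measurable]: "g \<in> borel_measurable base_measure" unfolding g_def by measurable
  have gn: "(\<integral>\<^sup>+x. ennreal ((cmod (f n x - g x))\<^sup>2) \<partial>base_measure) \<le> ennreal (((1 / 4) ^ n)\<^sup>2)" for n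
  proof -
    \<comment> \<open>Fatou's lemma, with \<open>n\<close> fixed, carries the rate over to the limit
      function.\<close>
    have "AE x in base_measure. ennreal ((cmod (f n x - g x))\<^sup>2) \<le> liminf (\<lambda>m. ennreal ((cmod (f m x - f n x))\<^sup>2))"
      using conv
    proof eventually_elim
      case (elim x)
      then have "(\<lambda>m. f m x) \<longlonglongrightarrow> g x" unfolding g_def by (simp add: convergent_LIMSEQ_iff)
      then have "(\<lambda>m. ennreal ((cmod (f m x - f n x))\<^sup>2)) \<longlonglongrightarrow> ennreal ((cmod (g x - f n x))\<^sup>2)"
        by (intro tendsto_intros)
      then have "liminf (\<lambda>m. ennreal ((cmod (f m x - f n x))\<^sup>2)) = ennreal ((cmod (g x - f n x))\<^sup>2)"
        by (intro lim_imp_Liminf) auto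
      then show ?case by (simp add: norm_minus_commute)
    qed
    then have "(\<integral>\<^sup>+x. ennreal ((cmod (f n x - g x))\<^sup>2) \<partial>base_measure)
        \<le> (\<integral>\<^sup>+x. liminf (\<lambda>m. ennreal ((cmod (f m x - f n x))\<^sup>2)) \<partial>base_measure)"
      by (rule nn_integral_mono_AE)
    also have "\<dots> \<le> liminf (\<lambda>m. \<integral>\<^sup>+x. ennreal ((cmod (f m x - f n x))\<^sup>2) \<partial>base_measure)"
      by (rule nn_integral_liminf) measurable
    also have "\<dots> \<le> limsup (\<lambda>m. \<integral>\<^sup>+x. ennreal ((cmod (f m x - f n x))\<^sup>2) \<partial>base_measure)"
      by (rule Liminf_le_Limsup) simp
    also have "\<dots> \<le> ennreal (((1 / 4) ^ n)\<^sup>2)"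
      by (rule Limsup_bounded) (use diff in \<open>auto simp: eventually_sequentially\<close>)
    finally show ?thesis .
  qed
  have dn: "square_integrable (\<lambda>x. f n x - g x)" for n
  proof -
    have "(\<integral>\<^sup>+x. ennreal ((cmod (f n x - g x))\<^sup>2) \<partial>base_measure) < \<infinity>"
      using gn[of n] by (rule le_less_trans) simp
    then show ?thesis
      unfolding square_integrable_def by (intro conjI integrableI_nonneg) auto
  qed
  have g_sq: "square_integrable g" using square_integrable_diff[OF f_sq dn, of 0 0] by simp
  have "norm (X n - abs_L2 g) \<le> (1 / 4) ^ n" for n
  proof -
    have "ennreal ((norm (X n - abs_L2 g))\<^sup>2) \<le> ennreal (((1 / 4) ^ n)\<^sup>2)"
      unfolding X abs_L2_diff[OF f_sq g_sq] using gn[of n] by (simp add: nn_integral_abs_L2[OF dn])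
    then have "(norm (X n - abs_L2 g))\<^sup>2 \<le> ((1 / 4) ^ n)\<^sup>2" by simp
    then show ?thesis by (rule power2_le_imp_le) simp
  qed
  then show ?thesis by (rule that)
qed

instance L2 :: (base_measure) complete_space
proof
  fix X :: "nat \<Rightarrow> 'a L2"
  assume X: "Cauchy X"
  have "\<forall>n. \<exists>N. \<forall>m\<ge>N. \<forall>k\<ge>N. norm (X m - X k) < (1 / 4) ^ n"
    using X by (auto simp: Cauchy_iff)
  then obtain N where N: "\<And>n m k. m \<ge> N n \<Longrightarrow> k \<ge> N n \<Longrightarrow> norm (X m - X k) < (1 / 4) ^ n"
    by metis
  \<comment> \<open>The running sum is a monotone index that dominates every
    \<open>N n\<close>.\<close>
  define r where "r n = (\<Sum>k\<le>n. N k)" for n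
  have r_N: "r n \<ge> N n" for n unfolding r_def by (rule member_le_sum) auto
  have r_mono: "n \<le> m \<Longrightarrow> r n \<le> r m" for n m unfolding r_def by (intro sum_mono2) auto
  have rN: "N n \<le> r m" if "n \<le> m" for n m using r_N[of n] r_mono[OF that] by simp
  obtain g where g: "\<And>n. norm (X (r n) - g) \<le> (1 / 4) ^ n"
    by (rule L2_limit_of_fast_Cauchy[of "\<lambda>n. X (r n)"]) (auto intro!: less_imp_le N rN)
  have "X \<longlonglongrightarrow> g"
  proof (rule metric_LIMSEQ_I)
    fix e :: real assume "e > 0"
    then obtain n where n: "(1 / 4 :: real) ^ n < e / 2"
      using real_arch_pow_inv[of "e / 2" "1 / 4"] by auto
    have "dist (X m) g < e" if "m \<ge> N n" for m
    proof -
      have "dist (X m) g \<le> norm (X m - X (r n)) + norm (X (r n) - g)"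
        using dist_triangle[of "X m" g "X (r n)"] by (simp add: dist_norm)
      also have "\<dots> < e / 2 + e / 2"
        using N[OF that rN[of n n]] g[of n] n by simp
      finally show ?thesis by simp
    qed
    then show "\<exists>no. \<forall>n\<ge>no. dist (X n) g < e" by blast
  qed
  then show "convergent X" by (auto simp: convergent_def)
qed

section \<open>The continuous and the discrete model\<close>

lemma cinner_delta0:
  fixes f :: "('d::finite \<Rightarrow> int) \<Rightarrow> complex"
  assumes "square_integrable f"
  shows "cinner delta0 (abs_L2 f) = f (\<lambda>_. 0)"
proof -
  define \<delta> :: "('d \<Rightarrow> int) \<Rightarrow> complex" where "\<delta> n = (if n = (\<lambda>_. 0) then 1 else 0)" for n
  have "delta0 = abs_L2 \<delta>" by (simp add: delta0_def \<delta>_def[abs_def])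
  moreover have "square_integrable \<delta>"
    using delta0.rsp by (simp add: L2_rel_def \<delta>_def[abs_def])
  ultimately have "cinner delta0 (abs_L2 f) = (\<integral>n. cnj (\<delta> n) * f n \<partial>base_measure)"
    using cinner_L2.abs_eq[OF L2_rel_refl L2_rel_refl, OF _ assms, of \<delta>] by metis
  also have "\<dots> = (\<integral>n. cnj (\<delta> n) * f n \<partial>count_space UNIV)" by (simp only: base_measure_fun_def)
  also have "\<dots> = (\<Sum>n\<in>{\<lambda>_. 0}. cnj (\<delta> n) * f n)"
  proof (subst lebesgue_integral_count_space_finite_support)
    show "finite {n \<in> UNIV. cnj (\<delta> n) * f n \<noteq> 0}"
      by (rule finite_subset[of _ "{\<lambda>_. 0}"]) (auto simp: \<delta>_def)
    show "(\<Sum>n | n \<in> UNIV \<and> cnj (\<delta> n) * f n \<noteq> 0. cnj (\<delta> n) * f n) = (\<Sum>n\<in>{\<lambda>_. 0}. cnj (\<delta> n) * f n)"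
      by (rule sum.mono_neutral_left) (auto simp: \<delta>_def)
  qed
  finally show ?thesis by (simp add: \<delta>_def)
qed

text \<open>Pairing with the translate by \<open>- n\<close> evaluates the representative at
  \<open>n\<close>.\<close>

lemma eq_0_if_orthogonal_translates_delta0:
  assumes "\<And>i. cinner delta0 (translate_discr i f) = 0"
  shows "f = 0"
proof -
  define \<phi> where "\<phi> = rep_L2 f"
  have \<phi>: "square_integrable \<phi>" and f: "f = abs_L2 \<phi>"
    by (simp_all add: \<phi>_def square_integrable_rep_L2 abs_rep_L2)
  have "\<phi> n = 0" for n
  proof -
    let ?i = "\<lambda>k. - n k"
    have "square_integrable (\<lambda>m. \<phi> (\<lambda>k. m k - ?i k))"
      by (rule square_integrable_compose[OF base_measure_lattice_shift \<phi>])
    then have "cinner delta0 (abs_L2 (\<lambda>m. \<phi> (\<lambda>k. m k - ?i k))) = \<phi> (\<lambda>k. 0 - ?i k)"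
      by (rule cinner_delta0)
    moreover have "translate_discr ?i f = abs_L2 (\<lambda>m. \<phi> (\<lambda>k. m k - ?i k))"
      unfolding f by (rule translate_discr.abs_eq[OF L2_rel_refl[OF \<phi>]])
    ultimately have "cinner delta0 (translate_discr ?i f) = \<phi> n" by simp
    then show ?thesis using assms by simp
  qed
  then have "\<phi> = (\<lambda>_. 0)" by auto
  then show ?thesis by (simp add: f zero_L2_def)
qed

section \<open>Totality of translates in the continuous model\<close>

lemma mult_unit_cube_symmetric: "cinner (mult_unit_cube f) g = cinner f (mult_unit_cube g)"
proof transfer
  fix f g :: "real ^ 'a \<Rightarrow> complex"
  show "(\<integral>x. cnj (indicator unit_cube x * f x) * g x \<partial>base_measure)
      = (\<integral>x. cnj (f x) * (indicator unit_cube x * g x) \<partial>base_measure)"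
    by (rule Bochner_Integration.integral_cong) (auto split: split_indicator)
qed

lemma ex_lattice_translate_in_unit_cube:
  fixes x :: "real ^ 'd::finite"
  obtains i :: "'d \<Rightarrow> int" where "x - (\<chi> k. real_of_int (i k)) \<in> unit_cube"
proof -
  let ?i = "\<lambda>k. round (x $ k)"
  have "- (1 / 2) \<le> x $ k - real_of_int (?i k) \<and> x $ k - real_of_int (?i k) \<le> 1 / 2" for k
    using of_int_round_abs_le[of "x $ k"] by linarith
  then show ?thesis by (intro that[of ?i]) (auto simp: unit_cube_def mem_box_cart)
qed

text \<open>Countably many lattice translates of the unit cube cover the space; their exceptional
  null sets can be collected into one.\<close>

lemma eq_0_if_translates_vanish_on_unit_cube:
  fixes f :: "(real ^ 'd::finite) L2"
  assumes "\<And>i. mult_unit_cube (translate_cont i f) = 0"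
  shows "f = 0"
proof -
  define \<phi> where "\<phi> = rep_L2 f"
  have \<phi>: "square_integrable \<phi>" and f: "f = abs_L2 \<phi>"
    by (simp_all add: \<phi>_def square_integrable_rep_L2 abs_rep_L2)
  define s :: "('d \<Rightarrow> int) \<Rightarrow> real ^ 'd" where "s i = (\<chi> k. real_of_int (i k))" for i
  have "AE x in base_measure. indicator unit_cube (x - s i) * \<phi> x = 0" for i
  proof -
    \<comment> \<open>Translating by \<open>- i\<close> brings the cube centred at \<open>i\<close>
      to the unit cube; \<open>AE_compose\<close> shifts the conclusion back.\<close>
    let ?j = "\<lambda>k. - i k"
    have sj: "s ?j = - s i" by (simp add: s_def vec_eq_iff)
    have "L2_rel \<phi> \<phi>" by (rule L2_rel_refl[OF \<phi>])
    then have rel: "L2_rel (\<lambda>x. \<phi> (x - s ?j)) (\<lambda>x. \<phi> (x - s ?j))"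
      by (rule L2_rel_compose[OF base_measure_vec_shift])
    have "translate_cont ?j f = abs_L2 (\<lambda>x. \<phi> (x - s ?j))"
      unfolding f s_def by (rule translate_cont.abs_eq[OF \<open>L2_rel \<phi> \<phi>\<close>])
    then have "abs_L2 (\<lambda>x. indicator unit_cube x * \<phi> (x - s ?j)) = abs_L2 (\<lambda>_. 0)"
      using assms[of ?j] mult_unit_cube.abs_eq[OF rel] by (simp add: zero_L2_def)
    \<comment> \<open>The quotient is partial, so equal classes give related functions only when
      both functions are square integrable.\<close>
    then have "L2_rel (\<lambda>x. indicator unit_cube x * \<phi> (x - s ?j)) (\<lambda>_. 0)"
      using Quotient3_rel[OF Quotient3_L2, of "\<lambda>x. indicator unit_cube x * \<phi> (x - s ?j)" "\<lambda>_. 0"]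
        rel_funD[OF mult_unit_cube.rsp, OF rel] L2_rel_refl[OF square_integrable_zero] by blast
    then have "AE x in base_measure. indicator unit_cube x * \<phi> (x - s ?j) = 0"
      by (simp add: L2_rel_def)
    from AE_compose[OF base_measure_vec_shift this, of "s i"] show ?thesis
      by (simp add: sj)
  qed
  then have "AE x in base_measure. \<forall>i. indicator unit_cube (x - s i) * \<phi> x = 0"
    unfolding AE_all_countable by blast
  then have "AE x in base_measure. \<phi> x = 0"
  proof eventually_elim
    case (elim x)
    obtain i where "x - s i \<in> unit_cube" using ex_lattice_translate_in_unit_cube unfolding s_def by blast
    with elim show "\<phi> x = 0" by (metis indicator_simps(1) mult_1)
  qed
  then have "L2_rel \<phi> (\<lambda>_. 0)" using \<phi> by (simp add: L2_rel_def square_integrable_zero)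
  then show ?thesis unfolding f zero_L2_def by (rule Quotient3_rel_abs[OF Quotient3_L2])
qed

lemma eq_0_if_orthogonal_basis:
  fixes v :: "'v::complex_inner"
  assumes \<phi>: "orthonormal_basis \<phi>" and 0: "\<And>n. cinner (\<phi> n) v = 0"
  shows "v = 0"
proof (rule eq_0_if_orthogonal_dense)
  show "closure (csubspace hull range \<phi>) = UNIV" using \<phi> by (simp add: orthonormal_basis_def)
  fix u assume "u \<in> csubspace hull range \<phi>"
  moreover have "csubspace hull range \<phi> \<subseteq> {u. cinner u v = 0}"
    by (rule hull_minimal) (auto simp: 0 csubspace_def cinner_simps)
  ultimately show "cinner u v = 0" by blast
qed

section \<open>Conclusion in the two models\<close>

lemma interior_disjoint_cont:
  fixes H :: "'w \<Rightarrow> (real ^ 'd::finite) L2 operator"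
  assumes P: "prob_space P" and \<gamma>: "sets \<gamma> = sets borel" "absolutely_continuous \<gamma> \<nu>"
    and I: "closed I" and 0: "emeasure \<gamma> (I \<inter> \<sigma>) = 0"
    and erg: "ergodic_family P translate_cont H" and dos: "dos_measure_cont P H \<nu>"
    and spec: "almost_sure_spectrum P H \<sigma>"
  shows "interior I \<inter> \<sigma> = {}"
proof -
  obtain E \<phi> where S: "\<And>\<omega>. \<omega> \<in> space P \<Longrightarrow> spectral_measure_of (H \<omega>) (E \<omega>)"
    and \<phi>: "orthonormal_basis \<phi>" and \<nu>: "\<And>A. A \<in> sets borel \<Longrightarrow> emeasure \<nu> A =
      (\<integral>\<^sup>+\<omega>. trace_in \<phi> (mult_unit_cube \<circ> E \<omega> A \<circ> mult_unit_cube) \<partial>P)"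
    using dos unfolding dos_measure_cont_def by blast
  let ?A = "I \<inter> \<sigma>"
  have A: "?A \<in> sets borel"
    using I almost_sure_spectrum_closed[OF P erg S spec] by (intro borel_closed closed_Int)
  then have "?A \<in> null_sets \<nu>" using \<gamma> 0 by (auto simp: absolutely_continuous_def null_sets_def)
  then have \<nu>0: "(\<integral>\<^sup>+\<omega>. trace_in \<phi> (mult_unit_cube \<circ> E \<omega> ?A \<circ> mult_unit_cube) \<partial>P) = 0"
    using \<nu>[OF A] by (simp add: null_sets_def)
  show ?thesis
  proof (rule almost_sure_spectrum_interior_disjoint[OF P erg S spec I, of "range (\<lambda>n. mult_unit_cube (\<phi> n))"])
    fix x assume "x \<in> range (\<lambda>n. mult_unit_cube (\<phi> n))"
    then obtain n where x: "x = mult_unit_cube (\<phi> n)" by blast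
    have "(\<integral>\<^sup>+\<omega>. ennreal ((norm (E \<omega> ?A x))\<^sup>2) \<partial>P)
        \<le> (\<integral>\<^sup>+\<omega>. trace_in \<phi> (mult_unit_cube \<circ> E \<omega> ?A \<circ> mult_unit_cube) \<partial>P)"
    proof (rule nn_integral_mono)
      fix \<omega> assume \<omega>: "\<omega> \<in> space P"
      note Q = pvm_proj[OF spectral_pvm[OF ergodic_family_selfadjoint[OF P erg S \<omega>] S[OF \<omega>]] A]
      let ?t = "\<lambda>n. ennreal (Re (cinner (\<phi> n) ((mult_unit_cube \<circ> E \<omega> ?A \<circ> mult_unit_cube) (\<phi> n))))"
      \<comment> \<open>Symmetry of the cutoff identifies this squared norm with the diagonal entry
        number \<open>n\<close>, and a trace of nonnegative entries dominates each of them.\<close>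
      have "ennreal ((norm (E \<omega> ?A x))\<^sup>2) = ?t n"
        using cinner_projection_operator[OF Q, of x] by (simp add: x mult_unit_cube_symmetric[symmetric])
      also have "\<dots> \<le> trace_in \<phi> (mult_unit_cube \<circ> E \<omega> ?A \<circ> mult_unit_cube)"
        unfolding trace_in_def using sum_le_suminf[of ?t "{n}"] by simp
      finally show "ennreal ((norm (E \<omega> ?A x))\<^sup>2) \<le> \<dots>" .
    qed
    then show "(\<integral>\<^sup>+\<omega>. ennreal ((norm (E \<omega> ?A x))\<^sup>2) \<partial>P) = 0" by (simp add: \<nu>0)
  next
    fix f :: "(real ^ 'd) L2"
    assume *: "\<And>i x. x \<in> range (\<lambda>n. mult_unit_cube (\<phi> n)) \<Longrightarrow> cinner x (translate_cont i f) = 0"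
    show "f = 0"
    proof (rule eq_0_if_translates_vanish_on_unit_cube, rule eq_0_if_orthogonal_basis[OF \<phi>])
      show "cinner (\<phi> n) (mult_unit_cube (translate_cont i f)) = 0" for i n
        using *[of "mult_unit_cube (\<phi> n)" i] by (simp add: mult_unit_cube_symmetric)
    qed
  qed auto
qed

lemma interior_disjoint_discr:
  fixes H :: "'w \<Rightarrow> ('d::finite \<Rightarrow> int) L2 operator"
  assumes P: "prob_space P" and \<gamma>: "sets \<gamma> = sets borel" "absolutely_continuous \<gamma> \<nu>"
    and I: "closed I" and 0: "emeasure \<gamma> (I \<inter> \<sigma>) = 0"
    and erg: "ergodic_family P translate_discr H" and dos: "dos_measure_discr P H \<nu>"
    and spec: "almost_sure_spectrum P H \<sigma>"
  shows "interior I \<inter> \<sigma> = {}"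
proof -
  obtain E where S: "\<And>\<omega>. \<omega> \<in> space P \<Longrightarrow> spectral_measure_of (H \<omega>) (E \<omega>)"
    and \<nu>: "\<And>A. A \<in> sets borel \<Longrightarrow> emeasure \<nu> A =
      (\<integral>\<^sup>+\<omega>. ennreal (Re (cinner delta0 (E \<omega> A delta0))) \<partial>P)"
    using dos unfolding dos_measure_discr_def by blast
  let ?A = "I \<inter> \<sigma>"
  have A: "?A \<in> sets borel"
    using I almost_sure_spectrum_closed[OF P erg S spec] by (intro borel_closed closed_Int)
  then have "?A \<in> null_sets \<nu>" using \<gamma> 0 by (auto simp: absolutely_continuous_def null_sets_def)
  then have \<nu>0: "(\<integral>\<^sup>+\<omega>. ennreal (Re (cinner delta0 (E \<omega> ?A delta0))) \<partial>P) = 0"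
    using \<nu>[OF A] by (simp add: null_sets_def)
  show ?thesis
  proof (rule almost_sure_spectrum_interior_disjoint[OF P erg S spec I, of "{delta0}"])
    fix x :: "('d \<Rightarrow> int) L2" assume "x \<in> {delta0}"
    then have x: "x = delta0" by simp
    have "(\<integral>\<^sup>+\<omega>. ennreal ((norm (E \<omega> ?A x))\<^sup>2) \<partial>P)
        = (\<integral>\<^sup>+\<omega>. ennreal (Re (cinner delta0 (E \<omega> ?A delta0))) \<partial>P)"
    proof (rule nn_integral_cong)
      fix \<omega> assume \<omega>: "\<omega> \<in> space P"
      note Q = pvm_proj[OF spectral_pvm[OF ergodic_family_selfadjoint[OF P erg S \<omega>] S[OF \<omega>]] A]
      show "ennreal ((norm (E \<omega> ?A x))\<^sup>2) = ennreal (Re (cinner delta0 (E \<omega> ?A delta0)))"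
        using cinner_projection_operator[OF Q, of x] by (simp add: x)
    qed
    then show "(\<integral>\<^sup>+\<omega>. ennreal ((norm (E \<omega> ?A x))\<^sup>2) \<partial>P) = 0" by (simp add: \<nu>0)
  next
    fix f :: "('d \<Rightarrow> int) L2"
    assume *: "\<And>i x. x \<in> {delta0} \<Longrightarrow> cinner x (translate_discr i f) = 0"
    show "f = 0" by (rule eq_0_if_orthogonal_translates_delta0) (simp add: *)
  qed auto
qed

theorem corollary1:
  fixes P :: "'w measure" and \<gamma> \<nu> :: "real measure" and I \<sigma> :: "real set"
    and Hc :: "'w \<Rightarrow> (real ^ 'd::finite) L2 operator"
    and Hd :: "'w \<Rightarrow> ('d \<Rightarrow> int) L2 operator"
  assumes "prob_space P" and "complete_measure P"
    and "sets \<gamma> = sets borel" and "absolutely_continuous \<gamma> \<nu>"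
    and "closed I" and "is_interval I" and "emeasure \<gamma> (I \<inter> \<sigma>) = 0"
  shows "(ergodic_family P translate_cont Hc \<and> dos_measure_cont P Hc \<nu> \<and>
            almost_sure_spectrum P Hc \<sigma> \<longrightarrow> interior I \<inter> \<sigma> = {}) \<and>
         (ergodic_family P translate_discr Hd \<and> dos_measure_discr P Hd \<nu> \<and>
            almost_sure_spectrum P Hd \<sigma> \<longrightarrow> interior I \<inter> \<sigma> = {})"
  using interior_disjoint_cont[of P \<gamma> \<nu> I \<sigma> Hc] interior_disjoint_discr[of P \<gamma> \<nu> I \<sigma> Hd] assms
  by blast

end
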